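(* Let $N\ge 2$. For every $u\in H^1(\mathbb{R}^N;m_N)$, $$\int_{\mathbb{R}^N}|\nabla u|^2\,dm_N\ \ge\ \frac14\int_{\mathbb{R}^N}u^2\,\rho_{N,T}(|x|)^2\,dm_N,$$ where $$\rho_{N,T}(r)=\begin{cases}\rho_N(r) & 0<r<T,\\ \rho_N(T) & r\ge T.\end{cases}$$ Moreover, the constant $\frac14$ is sharp, i.e. the inequality fails for some $u\in H^1(\mathbb{R}^N;m_N)$ if $\frac14$ is replaced by any larger constant.
   Context: The measure $m_N$ on $\mathbb{R}^N$ is $dm_N=e^{|x|^2/2}\,dx$, and $H^1(\mathbb{R}^N;m_N)$ is the weighted Sobolev space of functions $u\in L^2(\mathbb{R}^N;m_N)$ with weak gradient in $L^2(\mathbb{R}^N;m_N)$. For $r>0$, $$\rho_N(r)=\frac{r^{1-N}e^{-r^2/2}}{\int_r^{+\infty}t^{1-N}e^{-t^2/2}\,dt}.$$ The function $\rho_N$ is positive on $(0,+\infty)$, tends to $+\infty$ as $r\to0^+$ and as $r\to+\infty$, and has a unique minimum point in $(0,+\infty)$, denoted $T$. *)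

theory Defs
  imports "HOL-Analysis.Analysis"
begin

definition gauss_measure :: "(real^'n) measure" where
  "gauss_measure = density lebesgue (\<lambda>x. ennreal (exp ((norm x)\<^sup>2 / 2)))"

definition partial_deriv :: "'n \<Rightarrow> (real^'n \<Rightarrow> real) \<Rightarrow> real^'n \<Rightarrow> real" where
  "partial_deriv i f x = frechet_derivative f (at x) (axis i 1)"

fun continuously_differentiable :: "nat \<Rightarrow> (real^'n \<Rightarrow> real) \<Rightarrow> bool" where
  "continuously_differentiable 0 f \<longleftrightarrow> continuous_on UNIV f"
| "continuously_differentiable (Suc k) f \<longleftrightarrow>
     (\<forall>x. f differentiable (at x)) \<and> (\<forall>i. continuously_differentiable k (partial_deriv i f))"

definition test_function :: "(real^'n \<Rightarrow> real) \<Rightarrow> bool" where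
  "test_function \<phi> \<longleftrightarrow>
     (\<forall>k. continuously_differentiable k \<phi>) \<and> compact (closure {x. \<phi> x \<noteq> 0})"

definition locally_integrable :: "(real^'n \<Rightarrow> 'b::{banach, second_countable_topology}) \<Rightarrow> bool" where
  "locally_integrable f \<longleftrightarrow> (\<forall>K. compact K \<longrightarrow> set_integrable lebesgue K f)"

text \<open>Weak gradients are unique only up to null sets, hence a relation rather than a function.
  They are taken with respect to Lebesgue measure, also in the weighted Sobolev space.\<close>

definition has_weak_gradient :: "(real^'n \<Rightarrow> real) \<Rightarrow> (real^'n \<Rightarrow> real^'n) \<Rightarrow> bool" where
  "has_weak_gradient u g \<longleftrightarrow> locally_integrable u \<and> locally_integrable g \<and>
     (\<forall>\<phi>. test_function \<phi> \<longrightarrow> (\<forall>i.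
        (LINT x|lebesgue. u x * partial_deriv i \<phi> x) = - (LINT x|lebesgue. g x $ i * \<phi> x)))"

definition L2 :: "'a measure \<Rightarrow> ('a \<Rightarrow> 'b::real_normed_vector) set" where
  "L2 M = {f \<in> borel_measurable M. integrable M (\<lambda>x. (norm (f x))\<^sup>2)}"

definition H1 :: "(real^'n) measure \<Rightarrow> (real^'n \<Rightarrow> real) set" where
  "H1 M = {u \<in> L2 M. \<exists>g \<in> L2 M. has_weak_gradient u g}"

definition rho :: "nat \<Rightarrow> real \<Rightarrow> real" where
  "rho N r = r powr (1 - real N) * exp (- r\<^sup>2 / 2) /
     (LBINT t:{r<..}. t powr (1 - real N) * exp (- t\<^sup>2 / 2))"

definition rho_argmin :: "nat \<Rightarrow> real" where
  "rho_argmin N = (THE T. is_arg_min (rho N) (\<lambda>r. 0 < r) T)"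

text \<open>Only the values at \<open>r > 0\<close> matter: the value at \<open>r = 0\<close> enters the integrals only at the origin.\<close>

definition rho_trunc :: "nat \<Rightarrow> real \<Rightarrow> real" where
  "rho_trunc N r = (if r < rho_argmin N then rho N r else rho N (rho_argmin N))"

end

theory Submission
  imports Defs "HOL-Real_Asymp.Real_Asymp"
begin

text \<open>Let \<open>W(r) = \<integral>\<^sub>r\<^sup>\<infinity> t\<^bsup>1-N\<^esup> e\<^bsup>-t^2/2\<^esup> dt\<close>, so that \<open>\<rho> = - (ln W)'\<close>. Since \<open>\<rho>\<^sub>T \<le> \<rho>\<close>, it suffices to prove the
  inequality with \<open>\<rho>\<close> itself. The field \<open>\<rho>(|x|) x/|x|\<close> has weighted divergence \<open>\<rho>\<^sup>2\<close>, so integrating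
  \<open>|\<nabla>u + \<rho> u x / (2|x|)|\<^sup>2 \<ge> 0\<close> by parts gives the inequality. For a weak gradient this is done with a smooth
  compactly supported truncation of the field, and needs only the weak identity \<open>\<nabla>(u\<^sup>2) = 2 u \<nabla>u\<close>.
  The constant is approached by \<open>u = sqrt W S(ln W)\<close> with \<open>S\<close> slowly varying and supported where
  \<open>|x| < T\<close>, which is possible because \<open>W(0+) = \<infinity>\<close> when \<open>N \<ge> 2\<close>.\<close>

section \<open>Smooth functions\<close>

text \<open>Multiplied by the radial density r^(N-1) e^(r^2/2), \<open>W'\<close> is constant: W is
  the radial solution of the weighted Laplace equation that vanishes at infinity. In terms of \<rho>
  this is the Riccati equation \<rho>' + (r + (N-1)/r) \<rho> = \<rho>^2, whence the divergence
  \<rho>^2. The completed square vanishes for u = sqrt W, so this is the virtual extremal; it is not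
  admissible, because for it the weighted integral of u^2 \<rho>^2 reduces to that of \<rho> dr = -
  d ln W, which diverges at the origin. The factor S makes this divergence finite at small cost. The
  difficulty is regularity. The field is singular at the origin and unbounded in extent, while weak
  gradients may be tested only with smooth functions of compact support; so the cutoffs must be
  explicit, and all derivatives of \<rho> must exist. Moreover u times a test function is not a test
  function, so the identity for u^2 does not follow by inserting it; doubling the variables replaces
  one factor u(x) by u(y), which is constant while testing in x.\<close>

definition smooth :: "(real^'n \<Rightarrow> real) \<Rightarrow> bool" where
  "smooth f \<longleftrightarrow> (\<forall>k. continuously_differentiable k f)"

lemma partial_deriv_eq:
  "(f has_derivative D) (at x) \<Longrightarrow> partial_deriv i f x = D (axis i 1)"
  unfolding partial_deriv_def by (metis frechet_derivative_at)

lemma continuously_differentiable_SucI: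
  assumes "\<And>x. (f has_derivative D x) (at x)"
    and "\<And>i. continuously_differentiable k (\<lambda>x. D x (axis i 1))"
  shows "continuously_differentiable (Suc k) f"
proof -
  have "partial_deriv i f = (\<lambda>x. D x (axis i 1))" for i
    using partial_deriv_eq[OF assms(1)] by blast
  then show ?thesis
    using assms unfolding continuously_differentiable.simps differentiable_def by auto
qed

lemma continuously_differentiable_has_derivative:
  assumes "continuously_differentiable (Suc k) f"
  shows "(f has_derivative frechet_derivative f (at x)) (at x)"
  using assms by (simp add: frechet_derivative_works)

lemma continuously_differentiable_Suc_imp:
  "continuously_differentiable (Suc k) f \<Longrightarrow> continuously_differentiable k f"
proof (induction k arbitrary: f)
  case 0
  then show ?case
    by (auto simp: continuous_on_eq_continuous_at intro!: differentiable_imp_continuous_within)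
next
  case (Suc k)
  then show ?case by (metis continuously_differentiable.simps(2))
qed

lemma continuously_differentiable_const: "continuously_differentiable k (\<lambda>x. c)"
proof (induction k arbitrary: c)
  case (Suc k)
  show ?case
    by (rule continuously_differentiable_SucI[where D="\<lambda>x h. 0"]) (auto intro: Suc)
qed auto

lemma continuously_differentiable_add:
  "continuously_differentiable k f \<Longrightarrow> continuously_differentiable k g \<Longrightarrow>
    continuously_differentiable k (\<lambda>x. f x + g x)"
proof (induction k arbitrary: f g)
  case (Suc k)
  show ?case
  proof (rule continuously_differentiable_SucI)
    show "((\<lambda>x. f x + g x) has_derivative
        (\<lambda>h. frechet_derivative f (at x) h + frechet_derivative g (at x) h)) (at x)" for x
      using Suc.prems by (intro has_derivative_add continuously_differentiable_has_derivative)
    show "continuously_differentiable k (\<lambda>x. frechet_derivative f (at x) (axis i 1)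
        + frechet_derivative g (at x) (axis i 1))" for i
      using Suc.IH[of "partial_deriv i f" "partial_deriv i g"] Suc.prems
      unfolding partial_deriv_def continuously_differentiable.simps by blast
  qed
qed (auto intro: continuous_on_add)

lemma continuously_differentiable_mult:
  "continuously_differentiable k f \<Longrightarrow> continuously_differentiable k g \<Longrightarrow>
    continuously_differentiable k (\<lambda>x. f x * g x)"
proof (induction k arbitrary: f g)
  case (Suc k)
  show ?case
  proof (rule continuously_differentiable_SucI)
    show "((\<lambda>x. f x * g x) has_derivative
        (\<lambda>h. f x * frechet_derivative g (at x) h + frechet_derivative f (at x) h * g x)) (at x)" for x
      using Suc.prems by (intro has_derivative_mult continuously_differentiable_has_derivative)
    have "continuously_differentiable k (\<lambda>x. f x * partial_deriv i g x + partial_deriv i f x * g x)" for i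
      using Suc.prems continuously_differentiable_Suc_imp
      by (intro continuously_differentiable_add Suc.IH) auto
    then show "continuously_differentiable k (\<lambda>x. f x * frechet_derivative g (at x) (axis i 1)
        + frechet_derivative f (at x) (axis i 1) * g x)" for i
      by (simp add: partial_deriv_def)
  qed
qed (auto intro: continuous_on_mult)

text \<open>A dilation followed by a translation covers both v((x + y)/2) and \<eta>((x -
  y)/\<epsilon>) as functions of x with y frozen.\<close>

lemma continuously_differentiable_affine:
  "continuously_differentiable k f \<Longrightarrow> continuously_differentiable k (\<lambda>x. f (c *\<^sub>R x + v))"
proof (induction k arbitrary: f)
  case 0
  then show ?case
    by (auto intro!: continuous_on_compose2[of UNIV f] continuous_intros)
next
  case (Suc k)
  show ?case
  proof (rule continuously_differentiable_SucI)
    show "((\<lambda>x. f (c *\<^sub>R x + v)) has_derivative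
        (\<lambda>h. frechet_derivative f (at (c *\<^sub>R x + v)) (c *\<^sub>R h))) (at x)" for x
    proof (rule has_derivative_compose[where g=f and f="\<lambda>x. c *\<^sub>R x + v"])
      show "((\<lambda>x. c *\<^sub>R x + v) has_derivative (*\<^sub>R) c) (at x)"
        by (auto intro!: derivative_eq_intros)
    qed (use Suc.prems in \<open>simp add: frechet_derivative_works\<close>)
    have "frechet_derivative f (at y) (c *\<^sub>R axis i 1) = c * partial_deriv i f y" for i y
    proof -
      have "linear (frechet_derivative f (at y))"
        using Suc.prems continuously_differentiable_has_derivative has_derivative_linear by blast
      then show ?thesis by (simp add: linear_cmul partial_deriv_def)
    qed
    moreover have "continuously_differentiable k (\<lambda>x. c * partial_deriv i f (c *\<^sub>R x + v))" for i
      using Suc.prems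
      by (intro continuously_differentiable_mult continuously_differentiable_const Suc.IH) auto
    ultimately show "continuously_differentiable k
        (\<lambda>x. frechet_derivative f (at (c *\<^sub>R x + v)) (c *\<^sub>R axis i 1))" for i
      by simp
  qed
qed

lemma continuously_differentiable_nth: "continuously_differentiable k (\<lambda>x. x $ i)"
proof (cases k)
  case (Suc k')
  show ?thesis unfolding Suc
    by (rule continuously_differentiable_SucI[where D="\<lambda>x h. h $ i"])
      (auto intro!: continuously_differentiable_const bounded_linear_imp_has_derivative
        bounded_linear_vec_nth)
qed (auto intro: continuous_intros)

lemma smooth_const: "smooth (\<lambda>x. c)"
  and smooth_nth: "smooth (\<lambda>x. x $ i)"
  and smooth_add: "smooth f \<Longrightarrow> smooth g \<Longrightarrow> smooth (\<lambda>x. f x + g x)"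
  and smooth_mult: "smooth f \<Longrightarrow> smooth g \<Longrightarrow> smooth (\<lambda>x. f x * g x)"
  and smooth_affine: "smooth f \<Longrightarrow> smooth (\<lambda>x. f (c *\<^sub>R x + v))"
  unfolding smooth_def
  by (auto intro: continuously_differentiable_const continuously_differentiable_nth
    continuously_differentiable_add continuously_differentiable_mult
    continuously_differentiable_affine)

lemma smooth_partial_deriv: "smooth f \<Longrightarrow> smooth (partial_deriv i f)"
  unfolding smooth_def by (metis continuously_differentiable.simps(2))

lemma smooth_has_derivative: "smooth f \<Longrightarrow> (f has_derivative frechet_derivative f (at x)) (at x)"
  unfolding smooth_def using continuously_differentiable_has_derivative by blast

lemma smooth_continuous_on: "smooth f \<Longrightarrow> continuous_on A f"
  unfolding smooth_def
  by (metis continuously_differentiable.simps(1) continuous_on_subset subset_UNIV)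

text \<open>Order k + 1 for one member reduces to order k for the members that represent its partial
  derivatives, so the induction on k runs over the whole family X at once. The smooth factor
  \<open>c\<close> admits families that are closed under differentiation only up to a factor, such
  as the coordinate x_i that a radial function produces.\<close>

lemma smooth_coinduct:
  assumes "f \<in> X"
    and "\<And>f. f \<in> X \<Longrightarrow> \<exists>D. (\<forall>x. (f has_derivative D x) (at x)) \<and>
      (\<forall>i. \<exists>c f'. smooth c \<and> f' \<in> X \<and> (\<lambda>x. D x (axis i 1)) = (\<lambda>x. c x * f' x))"
  shows "smooth f"
proof -
  have "\<forall>f\<in>X. continuously_differentiable k f" for k
  proof (induction k)
    case 0
    show ?case
    proof
      fix f assume "f \<in> X"
      then obtain D where "\<forall>x. (f has_derivative D x) (at x)"
        using assms(2) by blast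
      then show "continuously_differentiable 0 f"
        by (auto simp: continuous_on_eq_continuous_at intro: has_derivative_continuous)
    qed
  next
    case (Suc k)
    show ?case
    proof
      fix f assume "f \<in> X"
      then obtain D where D: "\<And>x. (f has_derivative D x) (at x)"
        and *: "\<And>i. \<exists>c f'. smooth c \<and> f' \<in> X \<and> (\<lambda>x. D x (axis i 1)) = (\<lambda>x. c x * f' x)"
        using assms(2)[of f] by blast
      show "continuously_differentiable (Suc k) f"
      proof (rule continuously_differentiable_SucI[OF D])
        fix i
        obtain c f' where "smooth c" "f' \<in> X" "(\<lambda>x. D x (axis i 1)) = (\<lambda>x. c x * f' x)"
          using * by blast
        then show "continuously_differentiable k (\<lambda>x. D x (axis i 1))"
          using Suc.IH by (auto simp: smooth_def intro!: continuously_differentiable_mult)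
      qed
    qed
  qed
  then show ?thesis using assms(1) by (auto simp: smooth_def)
qed

text \<open>The derivatives of \<open>exp (- 1 / t)\<close> are combinations of these functions.\<close>

definition bump :: "nat \<Rightarrow> real \<Rightarrow> real" where
  "bump n t = (if t > 0 then exp (- 1 / t) / t ^ n else 0)"

text \<open>Raises the index at the price of a polynomial factor. All terms of a derivative can so
  be brought to one common index, and a product "smooth factor times \<open>bump\<close>" stays a
  single product.\<close>

lemma bump_Suc: "bump n t = t * bump (Suc n) t"
  by (auto simp: bump_def field_simps)

lemma bump_tendsto_0: "((\<lambda>t. bump n t) \<longlongrightarrow> 0) (at_right 0)"
proof -
  have "((\<lambda>t. exp (- 1 / t) / t ^ n) \<longlongrightarrow> (0::real)) (at_right 0)"
    by real_asymp
  then show ?thesis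
    by (rule Lim_transform_eventually)
      (auto simp: bump_def eventually_at_right_field intro!: exI[of _ 1])
qed

lemma bump_has_derivative:
  "(bump n has_real_derivative bump (n + 2) t - real n * bump (n + 1) t) (at t)"
proof -
  consider "t > 0" | "t < 0" | "t = 0" by linarith
  then show ?thesis
  proof cases
    case 1
    have "((\<lambda>t. exp (- 1 / t) / t ^ n) has_real_derivative
        bump (n + 2) t - real n * bump (n + 1) t) (at t)"
      using 1
      apply (auto intro!: derivative_eq_intros simp: bump_def)
      apply (cases n)
       apply (auto simp: field_simps power2_eq_square)
      done
    moreover have "\<forall>\<^sub>F t in nhds t. bump n t = exp (- 1 / t) / t ^ n"
      using eventually_nhds_in_open[of "{0<..}" t] 1
      by (auto simp: bump_def elim: eventually_mono)
    ultimately show ?thesis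
      by (subst DERIV_cong_ev[OF refl _ refl]) auto
  next
    case 2
    have "\<forall>\<^sub>F t in nhds t. bump n t = 0"
      using eventually_nhds_in_open[of "{..<0}" t] 2
      by (auto simp: bump_def elim: eventually_mono)
    then show ?thesis
      using 2 by (subst DERIV_cong_ev[OF refl _ refl]) (auto simp: bump_def)
  next
    case 3
    \<comment> \<open>The difference quotient at 0 is \<open>bump (Suc n) h\<close> on the right and
      0 on the left.\<close>
    have "((\<lambda>h. (bump n (0 + h) - bump n 0) / h) \<longlongrightarrow> 0) (at 0)"
    proof (rule filterlim_split_at)
      show "((\<lambda>h. (bump n (0 + h) - bump n 0) / h) \<longlongrightarrow> 0) (at_left 0)"
        by (rule Lim_transform_eventually[OF tendsto_const])
          (auto simp: bump_def eventually_at_left_field intro!: exI[of _ "-1"])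
      show "((\<lambda>h. (bump n (0 + h) - bump n 0) / h) \<longlongrightarrow> 0) (at_right 0)"
        by (rule Lim_transform_eventually[OF bump_tendsto_0[of "Suc n"]])
          (auto simp: bump_def eventually_at_right_field intro!: exI[of _ 1])
    qed
    then show ?thesis
      using 3 by (simp add: DERIV_def bump_def)
  qed
qed

lemma bump_nonneg: "0 \<le> bump n t"
  by (auto simp: bump_def)

lemma bump_0_le_1: "bump 0 t \<le> 1"
  by (auto simp: bump_def)

text \<open>With s = 1/t this is s^2 <= 2 e^s, read off from the quadratic term of the exponential
  series. Since \<open>bump 2\<close> is the derivative of \<open>bump 0\<close>, it bounds the
  slope of the outer cutoff.\<close>

lemma bump_2_le_2: "bump 2 t \<le> 2"
proof (cases "t > 0")
  case True
  have "1 + 1/t + (1/t)\<^sup>2 / 2 \<le> exp (1/t)"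
    using True by (intro exp_lower_Taylor_quadratic) auto
  then have "(1/t)\<^sup>2 \<le> 2 * exp (1/t)"
    using True by (smt (verit) divide_pos_pos field_sum_of_halves)
  then show ?thesis
    using True by (simp add: bump_def exp_minus field_simps)
qed (auto simp: bump_def)

lemma has_derivative_norm_square:
  "((\<lambda>x::'a::real_inner. (norm x)\<^sup>2) has_derivative (\<lambda>h. 2 * (x \<bullet> h))) (at x)"
  unfolding power2_norm_eq_inner by (auto intro!: derivative_eq_intros simp: inner_commute)

lemma smooth_bump: "smooth (\<lambda>x::real^'n. bump n (\<alpha> + \<beta> * (norm x)\<^sup>2))"
proof -
  let ?s = "\<lambda>x::real^'n. \<alpha> + \<beta> * (norm x)\<^sup>2"
  let ?X = "{\<lambda>x. c x * bump n (?s x) | c n. smooth c}"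
  have s: "smooth ?s"
  proof -
    have "(\<lambda>x::real^'n. (norm x)\<^sup>2) = (\<lambda>x. \<Sum>i\<in>UNIV. x $ i * x $ i)"
      by (auto simp: power2_norm_eq_inner inner_vec_def)
    moreover have "smooth (\<lambda>x::real^'n. \<Sum>i\<in>A. x $ i * x $ i)" for A
      by (induction A rule: infinite_finite_induct) 
        (auto intro!: smooth_const smooth_add smooth_mult smooth_nth)
    ultimately show ?thesis
      by (auto intro!: smooth_add smooth_mult smooth_const)
  qed
  have "\<exists>D. (\<forall>x. (f has_derivative D x) (at x)) \<and>
      (\<forall>i. \<exists>c f'. smooth c \<and> f' \<in> ?X \<and> (\<lambda>x. D x (axis i 1)) = (\<lambda>x. c x * f' x))"
    if f: "f \<in> ?X" for f
  proof -
    obtain c n where c: "smooth c" "f = (\<lambda>x. c x * bump n (?s x))"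
      using f by blast
    define D where "D x h = c x * (2 * \<beta> * (x \<bullet> h) * (bump (n + 2) (?s x) - real n * bump (n + 1) (?s x)))
        + frechet_derivative c (at x) h * bump n (?s x)" for x h
    have "(f has_derivative D x) (at x)" for x
    proof -
      have "(?s has_derivative (\<lambda>h. \<beta> * (2 * (x \<bullet> h)))) (at x)"
        by (auto intro!: derivative_eq_intros has_derivative_norm_square)
      from has_derivative_compose[OF this has_field_derivative_imp_has_derivative[OF bump_has_derivative]]
      have "((\<lambda>x. bump n (?s x)) has_derivative
          (\<lambda>h. 2 * \<beta> * (x \<bullet> h) * (bump (n + 2) (?s x) - real n * bump (n + 1) (?s x)))) (at x)"
        by (simp add: algebra_simps)
      from has_derivative_mult[OF smooth_has_derivative[OF c(1)] this] show ?thesis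
        unfolding c(2) D_def .
    qed
    moreover have "\<exists>c' f'. smooth c' \<and> f' \<in> ?X \<and> (\<lambda>x. D x (axis i 1)) = (\<lambda>x. c' x * f' x)" for i
    proof (intro exI conjI)
      \<comment> \<open>The terms with index n and n + 1 are raised to n + 2 by
        \<open>bump_Suc\<close>; this is the common coefficient.\<close>
      let ?c = "\<lambda>x. c x * (2 * \<beta> * x $ i * (1 + (- real n) * ?s x))
        + partial_deriv i c x * (?s x * ?s x)"
      show "smooth (\<lambda>x. 1)" by (rule smooth_const)
      show "(\<lambda>x. ?c x * bump (n + 2) (?s x)) \<in> ?X"
        using c(1) s by (auto intro!: exI[of _ ?c] smooth_add smooth_mult smooth_const smooth_nth smooth_partial_deriv)
      show "(\<lambda>x. D x (axis i 1)) = (\<lambda>x. 1 * (?c x * bump (n + 2) (?s x)))"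
      proof
        fix x
        have "bump (n + 1) (?s x) = ?s x * bump (n + 2) (?s x)"
          "bump n (?s x) = ?s x * (?s x * bump (n + 2) (?s x))"
          using bump_Suc[of n] bump_Suc[of "Suc n"] by simp_all
        then show "D x (axis i 1) = 1 * (?c x * bump (n + 2) (?s x))"
          unfolding D_def by (simp add: partial_deriv_def inner_axis algebra_simps)
      qed
    qed
    ultimately show ?thesis by blast
  qed
  moreover have "(\<lambda>x. 1 * bump n (?s x)) \<in> ?X"
    using smooth_const[of 1] by (intro CollectI exI conjI) auto
  ultimately show ?thesis
    using smooth_coinduct[of "\<lambda>x. 1 * bump n (?s x)" ?X] by auto
qed

section \<open>The function rho and its minimum\<close>

text \<open>The reciprocal of r^(N-1) e^(r^2/2), the density of the measure m_N in the radial
  variable up to the area of the unit sphere.\<close>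

definition weight :: "nat \<Rightarrow> real \<Rightarrow> real" where
  "weight N r = r powr (1 - real N) * exp (- r\<^sup>2 / 2)"

definition tail_mass :: "nat \<Rightarrow> real \<Rightarrow> real" where
  "tail_mass N r = (LBINT t:{r<..}. weight N t)"

text \<open>The logarithmic derivative of the radial density r^(N-1) e^(r^2/2): a radial field
  h(|x|) x/|x| has weighted divergence h' + \<open>drift\<close> h.\<close>

definition drift :: "nat \<Rightarrow> real \<Rightarrow> real" where
  "drift N r = r + (real N - 1) / r"

lemma rho_eq: "rho N r = weight N r / tail_mass N r"
  by (simp add: rho_def weight_def tail_mass_def)

lemma weight_pos: "0 < r \<Longrightarrow> 0 < weight N r"
  by (simp add: weight_def)

lemma weight_nonneg: "0 \<le> weight N r"
  by (simp add: weight_def)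

lemma weight_has_derivative:
  assumes "0 < r"
  shows "(weight N has_real_derivative - drift N r * weight N r) (at r)"
proof -
  have "((\<lambda>r. r powr (1 - real N) * exp (- r\<^sup>2 / 2)) has_real_derivative
      (1 - real N) * r powr (1 - real N - 1) * exp (- r\<^sup>2 / 2) +
      r powr (1 - real N) * (exp (- r\<^sup>2 / 2) * (- r))) (at r)"
    using assms by (auto intro!: derivative_eq_intros has_real_derivative_powr')
  moreover have "(1 - real N) * r powr (1 - real N - 1) * exp (- r\<^sup>2 / 2) +
      r powr (1 - real N) * (exp (- r\<^sup>2 / 2) * (- r)) = - drift N r * weight N r"
  proof -
    have "r powr (1 - real N - 1) = r powr (1 - real N) / r"
      using assms powr_diff[of r "1 - real N" 1] by simp
    then show ?thesis
      using assms by (simp only: weight_def drift_def) (simp add: field_simps)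
  qed
  ultimately show ?thesis
    unfolding weight_def[abs_def] by simp
qed

lemma weight_measurable [measurable]: "weight N \<in> borel_measurable borel"
  unfolding weight_def[abs_def] by measurable

lemma has_integral_gauss_tail:
  "has_bochner_integral lborel (\<lambda>t. t * exp (- t\<^sup>2 / 2) * indicator {a..} t) (exp (- a\<^sup>2 / 2))"
  if "0 \<le> a" for a :: real
proof (rule has_bochner_integral_nn_integral)
  have "(\<integral>\<^sup>+t. ennreal (t * exp (- t\<^sup>2 / 2)) * indicator {a..} t \<partial>lborel) = 0 - (- exp (- a\<^sup>2 / 2))"
  proof (rule nn_integral_FTC_atLeast)
    show "((\<lambda>t::real. - exp (- t\<^sup>2 / 2)) \<longlongrightarrow> 0) at_top" by real_asymp
  qed (use that in \<open>auto intro!: derivative_eq_intros\<close>)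
  then show "(\<integral>\<^sup>+t. ennreal (t * exp (- t\<^sup>2 / 2) * indicator {a..} t) \<partial>lborel) = ennreal (exp (- a\<^sup>2 / 2))"
    by (simp add: ennreal_mult'' ennreal_indicator)
qed (use that in \<open>auto simp: indicator_def\<close>)

text \<open>Writing t^(1-N) = t t^(-N) and freezing t^(-N) at the left end a leaves t e^(-t^2/2), an
  exact derivative. The majorant therefore has an explicit integral over the tail.\<close>

lemma weight_le_linear:
  assumes "0 < a" "a \<le> t"
  shows "weight N t \<le> a powr (- real N) * (t * exp (- t\<^sup>2 / 2))"
proof -
  have "t powr (1 - real N) = t * t powr (- real N)"
    using assms by (simp add: powr_diff powr_minus field_simps)
  moreover have "t powr (- real N) \<le> a powr (- real N)"
    using assms by (intro powr_mono2') auto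
  ultimately show ?thesis
    using assms unfolding weight_def
    by (simp add: mult.assoc mult.left_commute[of _ t] mult_left_mono mult_right_mono)
qed

lemma weight_set_integrable:
  assumes "0 < a" shows "set_integrable lborel {a<..} (weight N)"
  unfolding set_integrable_def
proof (rule Bochner_Integration.integrable_bound)
  show "integrable lborel (\<lambda>t. a powr (- real N) * (t * exp (- t\<^sup>2 / 2) * indicator {a..} t))"
    using has_integral_gauss_tail[of a] assms
    by (intro integrable_mult_right) (auto simp: has_bochner_integral_iff)
  show "AE t in lborel. norm (indicator {a<..} t *\<^sub>R weight N t)
      \<le> norm (a powr (- real N) * (t * exp (- t\<^sup>2 / 2) * indicator {a..} t))"
    using weight_le_linear[OF assms] assms
    by (auto simp: indicator_def abs_mult weight_nonneg mult.assoc)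
qed measurable

lemma tail_mass_nonneg: "0 \<le> tail_mass N r"
  unfolding tail_mass_def set_lebesgue_integral_def
  by (intro Bochner_Integration.integral_nonneg) (simp add: weight_nonneg)

text \<open>A Mills ratio bound, equivalent to \<rho>(a) >= a: the majorant of
  \<open>weight_le_linear\<close> integrates exactly to the right-hand side.\<close>

lemma tail_mass_le:
  assumes "0 < a" shows "tail_mass N a \<le> weight N a / a"
proof -
  have "tail_mass N a \<le> (\<integral>t. a powr (- real N) * (t * exp (- t\<^sup>2 / 2) * indicator {a..} t) \<partial>lborel)"
    unfolding tail_mass_def set_lebesgue_integral_def
  proof (rule integral_mono)
    show "integrable lborel (\<lambda>t. a powr (- real N) * (t * exp (- t\<^sup>2 / 2) * indicator {a..} t))"
      using has_integral_gauss_tail[of a] assms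
      by (intro integrable_mult_right) (auto simp: has_bochner_integral_iff)
    show "integrable lborel (\<lambda>t. indicator {a<..} t *\<^sub>R weight N t)"
      using weight_set_integrable[OF assms] by (simp add: set_integrable_def)
  qed (use weight_le_linear[OF assms] assms in \<open>auto simp: indicator_def mult.assoc\<close>)
  also have "\<dots> = a powr (- real N) * exp (- a\<^sup>2 / 2)"
    using has_bochner_integral_integral_eq[OF has_integral_gauss_tail[of a]] assms by simp
  also have "\<dots> = weight N a / a"
    using assms by (simp add: weight_def powr_diff powr_minus field_simps)
  finally show ?thesis .
qed

lemma weight_continuous_on: "A \<subseteq> {0<..} \<Longrightarrow> continuous_on A (weight N)"
  unfolding weight_def[abs_def] by (auto intro!: continuous_intros)

lemma tail_mass_split:
  assumes "0 < a" "a \<le> r"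
  shows "tail_mass N a = integral {a..r} (weight N) + tail_mass N r"
proof -
  have i: "set_integrable lborel {a..r} (weight N)"
    using assms by (intro borel_integrable_atLeastAtMost' weight_continuous_on) auto
  have "tail_mass N a = (LBINT t:{a<..r} \<union> {r<..}. weight N t)"
    unfolding tail_mass_def using assms by (intro arg_cong2[where f="set_lebesgue_integral lborel"]) auto
  also have "\<dots> = (LBINT t:{a<..r}. weight N t) + tail_mass N r"
    unfolding tail_mass_def
    using assms by (intro set_integral_Un weight_set_integrable set_integrable_subset[OF i]) auto
  also have "(LBINT t:{a<..r}. weight N t) = (LBINT t:{a..r}. weight N t)"
    unfolding set_lebesgue_integral_def
    by (intro integral_cong_AE) (auto intro: AE_mp[OF AE_lborel_singleton[of a]] simp: indicator_def)
  also have "\<dots> = integral {a..r} (weight N)"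
    using set_borel_integral_eq_integral(2)[OF i] .
  finally show ?thesis .
qed

lemma tail_mass_has_derivative:
  assumes "0 < r"
  shows "(tail_mass N has_real_derivative - weight N r) (at r)"
proof -
  \<comment> \<open>A fixed positive base point to the left of r: near r the tail integral is a
    constant minus an integral over a compact interval, where the fundamental theorem
    applies.\<close>
  let ?a = "r / 2"
  have "((\<lambda>x. integral {?a..x} (weight N)) has_real_derivative weight N r) (at r within {?a..2*r})"
    using assms by (intro integral_has_real_derivative weight_continuous_on) auto
  then have "((\<lambda>x. integral {?a..x} (weight N)) has_real_derivative weight N r) (at r)"
    using assms by (subst (asm) at_within_interior) (auto simp: interior_atLeastAtMost_real)
  then have "((\<lambda>x. tail_mass N ?a - integral {?a..x} (weight N)) has_real_derivative - weight N r) (at r)"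
    by (auto intro!: derivative_eq_intros)
  moreover have "\<forall>\<^sub>F x in nhds r. tail_mass N x = tail_mass N ?a - integral {?a..x} (weight N)"
  proof -
    have "tail_mass N x = tail_mass N ?a - integral {?a..x} (weight N)" if "x \<in> {?a<..}" for x
      using that assms tail_mass_split[of ?a x N] by simp
    moreover have "\<forall>\<^sub>F x in nhds r. x \<in> {?a<..}"
      using assms by (intro eventually_nhds_in_open) auto
    ultimately show ?thesis by (auto elim: eventually_mono)
  qed
  ultimately show ?thesis
    by (subst DERIV_cong_ev[OF refl _ refl]) auto
qed

lemma tail_mass_strict_antimono:
  assumes "0 < a" "a < b" shows "tail_mass N b < tail_mass N a"
proof (rule DERIV_neg_imp_decreasing[OF assms(2)])
  fix x assume "a \<le> x"
  then show "\<exists>y. (tail_mass N has_real_derivative y) (at x) \<and> y < 0"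
    using assms tail_mass_has_derivative[of x N] weight_pos[of x N] by fastforce
qed

lemma tail_mass_pos: "0 < r \<Longrightarrow> 0 < tail_mass N r"
  using tail_mass_strict_antimono[of r "r + 1" N] tail_mass_nonneg[of N "r + 1"] by linarith

text \<open>For N >= 2 and t <= 1 the integrand is at least e^(-1/2)/t, so the divergence at the
  origin is at least logarithmic. This is where the dimension enters: for N = 1 the tail mass stays
  bounded.\<close>

lemma tail_mass_unbounded:
  assumes "2 \<le> N" shows "\<exists>r>0. M < tail_mass N r"
proof -
  \<comment> \<open>Solves e^(-1/2) ln (1/r) = |M| + 1, the value of the minorant's integral over
    [r, 1].\<close>
  define r where "r = exp (- ((\<bar>M\<bar> + 1) * exp (1/2)))"
  have r: "0 < r" "r \<le> 1" by (auto simp: r_def)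
  have "((\<lambda>t. exp (- 1/2) / t) has_integral exp (-1/2) * ln 1 - exp (-1/2) * ln r) {r..1}"
  proof (rule fundamental_theorem_of_calculus[OF r(2)])
    fix t assume "t \<in> {r..1}"
    then have "0 < t" using r by auto
    then have "((\<lambda>t. exp (- 1/2) * ln t) has_real_derivative exp (-1/2) / t) (at t within {r..1})"
      by (auto intro!: derivative_eq_intros)
    then show "((\<lambda>t. exp (- 1/2) * ln t) has_vector_derivative exp (-1/2) / t) (at t within {r..1})"
      by (rule has_real_derivative_iff_has_vector_derivative[THEN iffD1])
  qed
  moreover have "exp (-1/2) * ln 1 - exp (-1/2) * ln r = \<bar>M\<bar> + 1"
  proof -
    have "ln r = - ((\<bar>M\<bar> + 1) * exp (1/2))" by (simp add: r_def)
    then show ?thesis by (simp add: exp_minus)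
  qed
  ultimately have "integral {r..1} (\<lambda>t. exp (- 1/2) / t) = \<bar>M\<bar> + 1" "(\<lambda>t. exp (- 1/2) / t) integrable_on {r..1}"
    by (auto simp: integral_unique has_integral_integrable)
  moreover have "integral {r..1} (\<lambda>t. exp (- 1/2) / t) \<le> integral {r..1} (weight N)"
  proof (rule integral_le)
    show "weight N integrable_on {r..1}"
      using r by (intro integrable_continuous_interval weight_continuous_on) auto
    fix t assume t: "t \<in> {r..1}"
    have "t powr (-1) \<le> t powr (1 - real N)"
      using t r assms by (intro powr_mono') auto
    moreover have "exp (-1/2) \<le> exp (- t\<^sup>2/2)"
      using t r by (auto simp: power_le_one)
    ultimately show "exp (- 1/2) / t \<le> weight N t"
      using t r mult_mono[of "t powr (-1)" "t powr (1 - real N)" "exp (-1/2)" "exp (- t\<^sup>2/2)"]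
      by (simp add: weight_def powr_minus field_simps)
  qed (fact calculation(2))
  moreover have "tail_mass N r = integral {r..1} (weight N) + tail_mass N 1"
    using r by (intro tail_mass_split) auto
  ultimately have "M < tail_mass N r"
    using tail_mass_nonneg[of N 1] by linarith
  then show ?thesis using r by blast
qed

section \<open>The Riccati equation and the unique minimum of \<rho>\<close>

lemma rho_pos: "0 < r \<Longrightarrow> 0 < rho N r"
  by (simp add: rho_eq weight_pos tail_mass_pos)

text \<open>The quotient rule with \<open>weight\<close>' = - \<open>drift\<close>
  \<open>weight\<close> and \<open>tail_mass\<close>' = - \<open>weight\<close>. Read as \<rho>' +
  \<open>drift\<close> \<rho> = \<rho>^2 it computes the divergence behind the inequality; read as a
  sign condition it compares \<rho> with \<open>drift\<close> and so locates the minimum.\<close>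

lemma rho_has_derivative:
  assumes "0 < r"
  shows "(rho N has_real_derivative rho N r * (rho N r - drift N r)) (at r)"
proof -
  have W: "tail_mass N r \<noteq> 0" using tail_mass_pos[OF assms, of N] by simp
  have "((\<lambda>r. weight N r / tail_mass N r) has_real_derivative
      (- drift N r * weight N r * tail_mass N r - weight N r * - weight N r) / (tail_mass N r * tail_mass N r)) (at r)"
    using W assms by (intro DERIV_divide weight_has_derivative tail_mass_has_derivative) auto
  moreover have "(- drift N r * weight N r * tail_mass N r - weight N r * - weight N r) / (tail_mass N r * tail_mass N r)
      = rho N r * (rho N r - drift N r)"
    using W by (simp add: rho_eq field_simps)
  ultimately show ?thesis by (simp add: rho_eq[abs_def])
qed

lemma rho_continuous_on: "continuous_on {0<..} (rho N)"
  by (rule DERIV_continuous_on[where D="\<lambda>r. rho N r * (rho N r - drift N r)"])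
    (auto intro: rho_has_derivative DERIV_subset)

text \<open>The sign of \<open>\<rho>'\<close> is that of \<open>drift_gap\<close>, whose derivative is \<open>- drift' * tail_mass\<close> and so
  changes sign only once.\<close>

definition drift_gap :: "nat \<Rightarrow> real \<Rightarrow> real" where
  "drift_gap N r = weight N r - drift N r * tail_mass N r"

lemma drift_gap_eq: "0 < r \<Longrightarrow> drift_gap N r = tail_mass N r * (rho N r - drift N r)"
  using tail_mass_pos[of r N] by (simp add: drift_gap_def rho_eq field_simps)

lemma drift_gap_has_derivative:
  assumes "0 < r"
  shows "(drift_gap N has_real_derivative ((real N - 1) / r\<^sup>2 - 1) * tail_mass N r) (at r)"
proof -
  have "(drift N has_real_derivative 1 - (real N - 1) / r\<^sup>2) (at r)"
    using assms unfolding drift_def[abs_def]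
    by (auto intro!: derivative_eq_intros simp: power2_eq_square field_simps)
  from DERIV_diff[OF weight_has_derivative[OF assms, of N] DERIV_mult[OF this tail_mass_has_derivative[OF assms, of N]]]
  show ?thesis
    unfolding drift_gap_def[abs_def] by (simp add: algebra_simps)
qed

lemma drift_gap_continuous_on: "A \<subseteq> {0<..} \<Longrightarrow> continuous_on A (drift_gap N)"
  by (rule DERIV_continuous_on[where D="\<lambda>r. ((real N - 1) / r\<^sup>2 - 1) * tail_mass N r"])
    (auto intro: drift_gap_has_derivative DERIV_subset)

text \<open>Both terms are of the order of \<open>weight\<close>: for r >= 1 the drift is at most N
  r, and \<open>tail_mass_le\<close> supplies the compensating factor 1/r.\<close>

lemma drift_gap_tendsto_0: "(drift_gap N \<longlongrightarrow> 0) at_top" if N: "1 \<le> N"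
proof (rule Lim_null_comparison)
  show "\<forall>\<^sub>F r in at_top. norm (drift_gap N r) \<le> exp (- r\<^sup>2 / 2) * (1 + real N)"
    using eventually_ge_at_top[of 1]
  proof eventually_elim
    case (elim r)
    have "r powr (1 - real N) \<le> r powr 0"
      using N elim by (intro powr_mono) auto
    then have w: "weight N r \<le> exp (- r\<^sup>2/2)" using elim by (simp add: weight_def)
    have "(real N - 1) / r \<le> (real N - 1) * r"
      using elim N mult_left_mono[of "1" "r * r" "real N - 1"] mult_mono[of 1 r 1 r] by (simp add: field_simps)
    then have d: "0 \<le> drift N r" "drift N r \<le> r * real N" 
      using elim N by (auto simp: drift_def algebra_simps)
    have "drift N r * tail_mass N r \<le> (r * real N) * (weight N r / r)"
      using tail_mass_le[of r N] elim tail_mass_nonneg[of N r] d by (intro mult_mono) auto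
    then have "drift N r * tail_mass N r \<le> real N * weight N r" "0 \<le> drift N r * tail_mass N r"
      using elim d tail_mass_nonneg[of N r] by auto
    then have "norm (drift_gap N r) \<le> weight N r * (1 + real N)"
      unfolding drift_gap_def using weight_nonneg[of N r] by (simp add: algebra_simps abs_if)
    also have "\<dots> \<le> exp (- r\<^sup>2/2) * (1 + real N)"
      using w by (intro mult_right_mono) auto
    finally show ?case .
  qed
  show "((\<lambda>r. exp (- r\<^sup>2 / 2) * (1 + real N)) \<longlongrightarrow> 0) at_top"
    by real_asymp
qed

text \<open>The drift is minimal at sqrt (N - 1). Beyond this point \<open>drift_gap\<close>
  strictly decreases, and it tends to 0, so it must stay positive: a value <= 0 at r would give a
  negative value at r + 1, below which the function could not remain.\<close>

lemma drift_gap_pos: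
  assumes "1 \<le> N" "sqrt (real N - 1) \<le> r" "0 < r"
  shows "0 < drift_gap N r"
proof (rule ccontr)
  assume neg: "\<not> 0 < drift_gap N r"
  have dec: "drift_gap N y < drift_gap N x" if "r \<le> x" "x < y" for x y
  proof (rule DERIV_neg_imp_decreasing_open[OF that(2)])
    fix z assume z: "x < z" "z < y"
    have "sqrt (real N - 1) < z" using assms z that by linarith
    then have "real N - 1 < z\<^sup>2" using real_less_lsqrt real_sqrt_less_iff
      by (smt (verit) real_sqrt_abs real_sqrt_ge_zero assms(1) of_nat_1 of_nat_le_iff)
    moreover have "0 < z" using assms z that by linarith
    ultimately have "(real N - 1) / z\<^sup>2 - 1 < 0" by (simp add: field_simps)
    then show "\<exists>d. (drift_gap N has_real_derivative d) (at z) \<and> d < 0"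
      using drift_gap_has_derivative[of z N] tail_mass_pos[of z N] \<open>0 < z\<close>
      by (intro exI[of _ "((real N - 1) / z\<^sup>2 - 1) * tail_mass N z"]) (simp add: mult_neg_pos)
  next
    show "continuous_on {x..y} (drift_gap N)"
      using assms that by (intro drift_gap_continuous_on) auto
  qed
  have "\<forall>\<^sub>F x in at_top. drift_gap N (r + 1) < drift_gap N x"
    using drift_gap_tendsto_0[OF assms(1)] dec[of r "r + 1"] neg by (intro order_tendstoD(1)[of _ 0]) auto
  then obtain x where "drift_gap N (r + 1) < drift_gap N x" "r + 1 < x"
    using eventually_happens'[OF _ eventually_conj[OF _ eventually_gt_at_top[of "r + 1"]]] by force
  then show False using dec[of "r + 1" x] by simp
qed

lemma drift_gap_strict_mono:
  assumes "0 < x" "x < y" "y \<le> sqrt (real N - 1)"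
  shows "drift_gap N x < drift_gap N y"
proof (rule DERIV_pos_imp_increasing_open[OF assms(2)])
  fix z assume z: "x < z" "z < y"
  then have "0 < z" "z < sqrt (real N - 1)" using assms by auto
  then have "z\<^sup>2 < real N - 1"
    by (metis abs_of_pos real_sqrt_abs real_sqrt_less_iff)
  then have "0 < (real N - 1) / z\<^sup>2 - 1" using \<open>0 < z\<close> by (simp add: field_simps)
  then show "\<exists>d. (drift_gap N has_real_derivative d) (at z) \<and> 0 < d"
    using drift_gap_has_derivative[of z N] tail_mass_pos[of z N] \<open>0 < z\<close>
    by (intro exI[of _ "((real N - 1) / z\<^sup>2 - 1) * tail_mass N z"]) simp
next
  show "continuous_on {x..y} (drift_gap N)"
    using assms by (intro drift_gap_continuous_on) auto
qed

text \<open>Otherwise \<rho> >= \<open>drift\<close> on the whole half-line, and the Riccati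
  equation makes \<rho> nondecreasing. It would then be bounded by \<rho>(1) on (0, 1], although the
  drift blows up at the origin.\<close>

lemma drift_gap_neg_exists:
  assumes "2 \<le> N" shows "\<exists>r>0. drift_gap N r < 0"
proof (rule ccontr)
  assume "\<not> ?thesis"
  then have ge: "drift N r \<le> rho N r" if "0 < r" for r
    using drift_gap_eq[OF that, of N] tail_mass_pos[OF that, of N] that
    by (smt (verit) mult_pos_neg)
  \<comment> \<open>Chosen so that the singular part of the drift, at least 1/r for N >= 2, already
    exceeds \<rho>(1).\<close>
  define r where "r = 1 / (rho N 1 + 1)"
  have "0 < rho N 1" by (simp add: rho_pos)
  then have r: "0 < r" "r < 1" by (auto simp: r_def field_simps)
  have "rho N r \<le> rho N 1"
  proof (rule DERIV_nonneg_imp_nondecreasing[where f="rho N"])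
    fix x assume "r \<le> x"
    then have "0 < x" using r by simp
    then show "\<exists>y. (rho N has_real_derivative y) (at x) \<and> 0 \<le> y"
      using rho_has_derivative[of x N] ge[of x] rho_pos[of x N]
      by (intro exI[of _ "rho N x * (rho N x - drift N x)"]) auto
  qed (use r in auto)
  moreover have "rho N 1 + 1 \<le> drift N r"
  proof -
    have "1 / r \<le> (real N - 1) / r" using assms r by (intro divide_right_mono) auto
    moreover have "1 / r = rho N 1 + 1" by (simp add: r_def)
    ultimately show ?thesis using r by (simp add: drift_def)
  qed
  ultimately show False using ge[of r] r by simp
qed

text \<open>Up to q = sqrt (N - 1) \<open>drift_gap\<close> strictly increases and starts negative,
  and from q on it is positive; hence it changes sign exactly once, and there \<rho> turns from
  decreasing to increasing. The strict inequality for all other r is what identifies the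
  \<open>THE\<close> in \<open>rho_argmin\<close>.\<close>

lemma rho_argmin_exists:
  assumes N: "2 \<le> N"
  obtains T where "0 < T" "\<And>r. 0 < r \<Longrightarrow> r \<noteq> T \<Longrightarrow> rho N T < rho N r"
proof -
  define q where "q = sqrt (real N - 1)"
  have q: "0 < q" using N by (simp add: q_def)
  obtain r0 where r0: "0 < r0" "drift_gap N r0 < 0" using drift_gap_neg_exists[OF N] by blast
  have "0 < drift_gap N q" using drift_gap_pos[of N q] N q by (simp add: q_def)
  have "r0 < q"
    using drift_gap_pos[of N r0] N r0 by (force simp: q_def)
  have "\<exists>T. r0 \<le> T \<and> T \<le> q \<and> drift_gap N T = 0"
  proof (rule IVT')
    show "continuous_on {r0..q} (drift_gap N)"
      using r0 by (intro drift_gap_continuous_on) auto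
  qed (use r0 \<open>r0 < q\<close> \<open>0 < drift_gap N q\<close> in auto)
  then obtain T where T: "0 < T" "T \<le> q" "drift_gap N T = 0"
    using r0 by (meson less_le_trans)
  have neg: "rho N r - drift N r < 0" if "0 < r" "r < T" for r
    using drift_gap_strict_mono[of r T N] that T drift_gap_eq[of r N] tail_mass_pos[of r N]
    by (auto simp: q_def mult_less_0_iff)
  have pos: "0 < rho N r - drift N r" if "T < r" for r
  proof -
    have "0 < drift_gap N r"
    proof (cases "r \<le> q")
      case True
      then show ?thesis using drift_gap_strict_mono[of T r N] that T by (simp add: q_def)
    next
      case False
      then show ?thesis using drift_gap_pos[of N r] N that T by (simp add: q_def)
    qed
    then show ?thesis
      using drift_gap_eq[of r N] tail_mass_pos[of r N] that T by (auto simp: zero_less_mult_iff)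
  qed
  have "rho N T < rho N r" if r: "0 < r" "r \<noteq> T" for r
  proof (cases "r < T")
    case True
    obtain z where z: "r < z" "z < T" "rho N T - rho N r = (T - r) * (rho N z * (rho N z - drift N z))"
      using MVT2[OF True, of "rho N" "\<lambda>z. rho N z * (rho N z - drift N z)"] rho_has_derivative r by force
    have "(T - r) * (rho N z * (rho N z - drift N z)) < 0"
      using neg[of z] z r rho_pos[of z N] by (auto simp: mult_less_0_iff)
    then show ?thesis using z by simp
  next
    case False
    then have "T < r" using r by simp
    obtain z where z: "T < z" "z < r" "rho N r - rho N T = (r - T) * (rho N z * (rho N z - drift N z))"
      using MVT2[OF \<open>T < r\<close>, of "rho N" "\<lambda>z. rho N z * (rho N z - drift N z)"] rho_has_derivative T by force
    have "0 < (r - T) * (rho N z * (rho N z - drift N z))"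
      using pos[of z] z T rho_pos[of z N] by auto
    then show ?thesis using z by simp
  qed
  then show thesis using that[of T] T by blast
qed

lemma rho_argmin_eq:
  assumes "0 < T" "\<And>r. 0 < r \<Longrightarrow> r \<noteq> T \<Longrightarrow> rho N T < rho N r"
  shows "rho_argmin N = T"
  unfolding rho_argmin_def is_arg_min_def
  using assms by (intro the_equality) (auto, metis less_asym less_irrefl)

lemma rho_argmin_pos: "2 \<le> N \<Longrightarrow> 0 < rho_argmin N"
  using rho_argmin_exists rho_argmin_eq by metis

lemma rho_argmin_le: "2 \<le> N \<Longrightarrow> 0 < r \<Longrightarrow> rho N (rho_argmin N) \<le> rho N r"
  using rho_argmin_exists rho_argmin_eq by (metis less_imp_le order_refl)

lemma rho_trunc_bounds:
  assumes "2 \<le> N" "0 < r"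
  shows "0 < rho_trunc N r" "rho_trunc N r \<le> rho N r"
  using assms rho_pos rho_argmin_pos rho_argmin_le by (auto simp: rho_trunc_def)

section \<open>The divergence theorem for radial fields\<close>

lemma integrable_continuous_support:
  fixes f :: "'a::euclidean_space \<Rightarrow> 'b::{banach, second_countable_topology}"
  assumes "continuous_on UNIV f" "\<And>x. R < norm x \<Longrightarrow> f x = 0"
  shows "integrable lborel f"
proof -
  have "integrable lborel (\<lambda>x. indicator (cball 0 R) x *\<^sub>R f x)"
    using assms(1) by (intro borel_integrable_compact) (auto intro: continuous_on_subset)
  also have "(\<lambda>x. indicator (cball 0 R) x *\<^sub>R f x) = f"
    using assms(2) by (force simp: indicator_def not_le)
  finally show ?thesis .
qed

lemma bounded_continuous_support:
  fixes f :: "'a::euclidean_space \<Rightarrow> real"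
  assumes "continuous_on UNIV f" "\<And>x. R < norm x \<Longrightarrow> f x = 0"
  obtains B where "0 < B" "\<And>x. \<bar>f x\<bar> \<le> B"
proof -
  have "compact (f ` cball 0 R)"
    using assms(1) by (intro compact_continuous_image) (auto intro: continuous_on_subset)
  then obtain B where B: "\<And>x. x \<in> cball 0 R \<Longrightarrow> \<bar>f x\<bar> \<le> B"
    by (metis bounded_iff compact_imp_bounded image_eqI real_norm_def)
  have "\<bar>f x\<bar> \<le> max B 1" for x
    using B[of x] assms(2)[of x] by (cases "norm x \<le> R") auto
  then show thesis using that[of "max B 1"] by auto
qed

lemma integral_lborel_shift:
  fixes f :: "'a::euclidean_space \<Rightarrow> real"
  assumes "f \<in> borel_measurable borel"
  shows "(\<integral>x. f (a + x) \<partial>lborel) = (\<integral>x. f x \<partial>lborel)"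
  using integral_distr[of "(+) a" lborel borel f] assms lborel_distr_plus[of a] by simp

lemma integrable_lborel_shift:
  fixes f :: "'a::euclidean_space \<Rightarrow> real"
  assumes "integrable lborel f"
  shows "integrable lborel (\<lambda>x. f (a + x))"
  using integrable_distr_eq[of "(+) a" lborel borel f] assms lborel_distr_plus[of a] by simp

text \<open>The integral of \<open>f (x + t e)\<close> does not depend on \<open>t\<close>; differentiate at \<open>t = 0\<close>.\<close>

lemma integral_directional_derivative_eq_0:
  fixes f :: "'a::euclidean_space \<Rightarrow> real"
  assumes D: "\<And>x. (f has_derivative f' x) (at x)"
    and cont: "continuous_on UNIV (\<lambda>x. f' x e)"
    and supp: "\<And>x. R < norm x \<Longrightarrow> f x = 0"
  shows "(\<integral>x. f' x e \<partial>lborel) = 0"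
proof -
  have f_cont: "continuous_on UNIV f"
    using D has_derivative_continuous by (fastforce simp: continuous_on_eq_continuous_at)
  have f_int: "integrable lborel f"
    using f_cont supp by (rule integrable_continuous_support)
  have supp': "f' x e = 0" if "R < norm x" for x
  proof -
    have "((\<lambda>y. 0) has_derivative f' x) (at x)"
      using that supp
      by (intro has_derivative_transform_within_open[OF D[of x], of "{y. R < norm y}"])
        (auto intro!: open_Collect_less continuous_intros)
    then have "f' x = (\<lambda>h. 0)"
      using has_derivative_unique has_derivative_const by blast
    then show ?thesis by simp
  qed
  obtain B where B: "0 < B" "\<And>x. \<bar>f' x e\<bar> \<le> B"
    using bounded_continuous_support[OF cont supp'] by blast
  have line: "((\<lambda>t. f (x + t *\<^sub>R e)) has_real_derivative f' (x + t *\<^sub>R e) e) (at t)" for x t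
  proof -
    have "((\<lambda>t. x + t *\<^sub>R e) has_derivative (\<lambda>h. h *\<^sub>R e)) (at t)"
      by (auto intro!: derivative_eq_intros)
    from has_derivative_compose[OF this D]
    have "((\<lambda>t. f (x + t *\<^sub>R e)) has_derivative (\<lambda>h. f' (x + t *\<^sub>R e) (h *\<^sub>R e))) (at t)" .
    moreover have "f' (x + t *\<^sub>R e) (h *\<^sub>R e) = f' (x + t *\<^sub>R e) e * h" for h
      using has_derivative_linear[OF D] by (simp add: linear_cmul)
    ultimately show ?thesis
      by (simp add: has_field_derivative_def)
  qed
  define s where "s n x = (f (x + (1 / real (Suc n)) *\<^sub>R e) - f x) * real (Suc n)" for n x
  have "(\<lambda>n. \<integral>x. s n x \<partial>lborel) \<longlonglongrightarrow> (\<integral>x. f' x e \<partial>lborel)"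
  proof (rule integral_dominated_convergence)
    \<comment> \<open>The increments 1/(n + 1) are at most 1, so all difference quotients live in
      the ball enlarged by the length of e; the mean value theorem bounds them by B there.\<close>
    show "integrable lborel (\<lambda>x. B * indicator (cball 0 (R + norm e)) x)"
      by (intro integrable_mult_right integrable_real_indicator)
        (use emeasure_bounded_finite[of "cball 0 (R + norm e)"] in simp_all)
    show "(\<lambda>x. f' x e) \<in> borel_measurable lborel"
      using cont by (simp add: borel_measurable_continuous_onI)
    show "s n \<in> borel_measurable lborel" for n
    proof -
      have "continuous_on UNIV (s n)"
        unfolding s_def
        by (intro continuous_intros continuous_on_compose2[OF f_cont]) auto
      then show ?thesis by (simp add: borel_measurable_continuous_onI)
    qed
    show "AE x in lborel. (\<lambda>n. s n x) \<longlonglongrightarrow> f' x e"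
    proof (rule AE_I2)
      fix x
      have "((\<lambda>h. (f (x + (0 + h) *\<^sub>R e) - f (x + 0 *\<^sub>R e)) / h) \<longlongrightarrow> f' x e) (at 0)"
        using line[of x 0] unfolding DERIV_def by simp
      moreover have "filterlim (\<lambda>n. 1 / real (Suc n)) (at 0) sequentially"
        using LIMSEQ_inverse_real_of_nat unfolding filterlim_at
        by (auto simp: inverse_eq_divide simp del: of_nat_Suc)
      ultimately have "(\<lambda>n. (f (x + (0 + 1 / real (Suc n)) *\<^sub>R e) - f (x + 0 *\<^sub>R e)) / (1 / real (Suc n))) \<longlonglongrightarrow> f' x e"
        by (rule filterlim_compose)
      then show "(\<lambda>n. s n x) \<longlonglongrightarrow> f' x e"
        by (simp add: s_def[abs_def])
    qed
    show "AE x in lborel. norm (s n x) \<le> B * indicator (cball 0 (R + norm e)) x" for n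
    proof (rule AE_I2)
      fix x
      let ?t = "1 / real (Suc n)"
      have t: "0 < ?t" "?t \<le> 1" by auto
      obtain z where z: "f (x + ?t *\<^sub>R e) - f (x + 0 *\<^sub>R e) = (?t - 0) * f' (x + z *\<^sub>R e) e"
        using MVT2[OF t(1), of "\<lambda>t. f (x + t *\<^sub>R e)" "\<lambda>t. f' (x + t *\<^sub>R e) e"] line by blast
      have "\<bar>s n x\<bar> \<le> B"
        using z B(2)[of "x + z *\<^sub>R e"] by (simp add: s_def)
      moreover have "s n x = 0" if "R + norm e < norm x"
      proof -
        have "norm x \<le> norm (x + ?t *\<^sub>R e) + norm (?t *\<^sub>R e)"
          by (metis add_diff_cancel_right' norm_triangle_ineq4)
        moreover have "norm (?t *\<^sub>R e) \<le> 1 * norm e"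
          unfolding norm_scaleR using t by (intro mult_right_mono) auto
        ultimately have "R < norm (x + ?t *\<^sub>R e)" using that by linarith
        moreover have "R < norm x" using that by (smt (verit) norm_ge_zero)
        ultimately show ?thesis using supp by (simp add: s_def)
      qed
      ultimately show "norm (s n x) \<le> B * indicator (cball 0 (R + norm e)) x"
        by (auto simp: indicator_def not_le)
    qed
  qed
  moreover have "(\<integral>x. s n x \<partial>lborel) = 0" for n
  proof -
    let ?c = "(1 / real (Suc n)) *\<^sub>R e"
    have "(\<integral>x. f (?c + x) - f x \<partial>lborel) = (\<integral>x. f (?c + x) \<partial>lborel) - (\<integral>x. f x \<partial>lborel)"
      using f_int by (intro Bochner_Integration.integral_diff integrable_lborel_shift)
    also have "\<dots> = 0"
      using integral_lborel_shift[of f ?c] f_int by simp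
    finally show ?thesis by (simp add: s_def add.commute)
  qed
  ultimately have "(\<lambda>n::nat. 0::real) \<longlonglongrightarrow> (\<integral>x. f' x e \<partial>lborel)"
    by simp
  then show ?thesis by (simp add: LIMSEQ_const_iff)
qed

text \<open>The norm is not differentiable at the origin, but a profile that vanishes near 0 hides
  this. There the formula gives 0 as well, so it holds at every x without a case
  distinction.\<close>

lemma has_derivative_radial:
  fixes F F' :: "real \<Rightarrow> real" and x :: "'a::real_inner"
  assumes "\<And>r. 0 < r \<Longrightarrow> (F has_real_derivative F' r) (at r)"
    and "0 < \<delta>" "\<And>r. 0 \<le> r \<Longrightarrow> r < \<delta> \<Longrightarrow> F r = 0" "F' 0 = 0"
  shows "((\<lambda>x. F (norm x)) has_derivative (\<lambda>h. F' (norm x) * (x \<bullet> h) / norm x)) (at x)"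
proof (cases "x = 0")
  case True
  have "((\<lambda>x. F (norm x)) has_derivative (\<lambda>h. 0)) (at 0)"
    using assms(2,3)
    by (intro has_derivative_transform_within[OF has_derivative_const[of 0], of \<delta>])
      (auto simp: dist_norm)
  then show ?thesis using True by simp
next
  case False
  have "((\<lambda>x. F (norm x)) has_derivative (\<lambda>h. F' (norm x) * (h \<bullet> sgn x))) (at x)"
    using has_derivative_compose[OF has_derivative_norm[OF False]
        has_field_derivative_imp_has_derivative[OF assms(1)]] False
    by simp
  then show ?thesis
    by (simp add: sgn_div_norm inner_commute divide_inverse ac_simps)
qed

lemma continuous_on_radial:
  fixes F :: "real \<Rightarrow> real"
  assumes "continuous_on {0<..} F" "0 < \<delta>" "\<And>r. 0 \<le> r \<Longrightarrow> r < \<delta> \<Longrightarrow> F r = 0"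
  shows "continuous_on UNIV (\<lambda>x::'a::real_inner. F (norm x))"
proof -
  have "UNIV = - {0} \<union> ball (0::'a) \<delta>"
    using assms(2) by auto
  moreover have "continuous_on (- {0} \<union> ball 0 \<delta>) (\<lambda>x::'a. F (norm x))"
  proof (rule continuous_on_open_Un)
    show "continuous_on (- {0}) (\<lambda>x::'a. F (norm x))"
      by (rule continuous_on_compose2[OF assms(1)]) (auto intro!: continuous_intros)
    show "continuous_on (ball 0 \<delta>) (\<lambda>x::'a. F (norm x))"
      using assms(3) by (subst continuous_on_cong[OF refl, of _ _ "\<lambda>_. 0"]) auto
  qed auto
  ultimately show ?thesis by simp
qed

lemma sum_nth_square: "(\<Sum>i\<in>UNIV. x $ i * x $ i) = (norm (x::real^'n))\<^sup>2"
  by (simp add: power2_norm_eq_inner inner_vec_def)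

text \<open>The divergence theorem for the field \<open>Q(|x|) x / |x|\<^sup>N\<close>.\<close>

lemma integral_radial_divergence:
  fixes Q Q' :: "real \<Rightarrow> real"
  assumes Q: "\<And>r. 0 < r \<Longrightarrow> (Q has_real_derivative Q' r) (at r)"
    and cont: "continuous_on {0<..} Q'"
    and \<delta>: "0 < \<delta>" "\<And>r. 0 \<le> r \<Longrightarrow> r < \<delta> \<Longrightarrow> Q r = 0 \<and> Q' r = 0"
    and R: "\<And>r. R < r \<Longrightarrow> Q r = 0"
  shows "(\<integral>x. Q' (norm x) * norm x powr (1 - real CARD('n)) \<partial>(lborel :: (real^'n) measure)) = 0"
proof -
  let ?N = "real CARD('n)"
  \<comment> \<open>The field x/|x|^N is divergence free off the origin. In r G' + N G the terms
    with Q cancel therefore, and only Q' r^(1-N) is left.\<close>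
  define G where "G r = Q r * r powr (- ?N)" for r
  define G' where "G' r = Q' r * r powr (- ?N) + Q r * (- ?N * r powr (- ?N - 1))" for r
  have G: "(G has_real_derivative G' r) (at r)" if "0 < r" for r
    unfolding G_def[abs_def] G'_def using that
    by (auto intro!: derivative_eq_intros Q has_real_derivative_powr')
  have Q_cont: "continuous_on {0<..} Q"
    by (rule DERIV_continuous_on[where D=Q']) (auto intro: Q DERIV_subset)
  have G_rad: "((\<lambda>x. G (norm x)) has_derivative (\<lambda>h. G' (norm x) * (x \<bullet> h) / norm x)) (at x)" for x :: "real^'n"
    using G \<delta> by (intro has_derivative_radial[of G G' \<delta>]) (auto simp: G_def G'_def)
  define f' where "f' i x h = x $ i * (G' (norm x) * (x \<bullet> h) / norm x) + h $ i * G (norm x)" for i and x h :: "real^'n"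
  have nth: "((\<lambda>x. x $ i) has_derivative (\<lambda>h. h $ i)) (at x)" for i and x :: "real^'n"
    by (intro bounded_linear_imp_has_derivative bounded_linear_vec_nth)
  have D: "((\<lambda>x. x $ i * G (norm x)) has_derivative f' i x) (at x)" for i x
    unfolding f'_def by (rule has_derivative_mult[OF nth G_rad])
  have c: "continuous_on UNIV (\<lambda>x. f' i x (axis i 1))" for i
  proof -
    have "continuous_on UNIV (\<lambda>x::real^'n. x $ i * (x $ i * (G' (norm x) / norm x)) + G (norm x))"
      using \<delta> by (intro continuous_intros
        continuous_on_radial[of "\<lambda>r. G' r / r" \<delta>] continuous_on_radial[of G \<delta>])
       (auto simp: G_def[abs_def] G'_def[abs_def] intro!: continuous_intros Q_cont cont)
    then show ?thesis
      by (simp add: f'_def inner_axis ac_simps)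
  qed
  have supp: "x $ i * G (norm x) = 0" if "R < norm x" for i and x :: "real^'n"
    using R that by (simp add: G_def)
  have "(\<integral>x. f' i x (axis i 1) \<partial>lborel) = 0" for i
    by (rule integral_directional_derivative_eq_0[OF D c supp])
  moreover have int: "integrable lborel (\<lambda>x. f' i x (axis i 1))" for i
  proof (rule integrable_continuous_support[OF c, of R])
    fix x :: "real^'n" assume "R < norm x"
    then have "((\<lambda>y. 0) has_derivative f' i x) (at x)"
      using supp by (intro has_derivative_transform_within_open[OF D[of i x], of "{y. R < norm y}"])
        (auto intro!: open_Collect_less continuous_intros)
    then have "f' i x = (\<lambda>h. 0)"
      using has_derivative_unique has_derivative_const by blast
    then show "f' i x (axis i 1) = 0" by simp
  qed
  ultimately have "(\<integral>x. (\<Sum>i\<in>UNIV. f' i x (axis i 1)) \<partial>lborel) = 0"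
    by (subst Bochner_Integration.integral_sum) auto
  moreover have "(\<Sum>i\<in>UNIV. f' i x (axis i 1)) = Q' (norm x) * norm x powr (1 - ?N)" for x :: "real^'n"
  proof (cases "x = 0")
    case True
    then show ?thesis using \<delta> by (simp add: f'_def G_def)
  next
    case False
    let ?r = "norm x"
    have r: "0 < ?r" using False by simp
    have "(\<Sum>i\<in>UNIV. f' i x (axis i 1)) = (\<Sum>i\<in>UNIV. x $ i * x $ i * (G' ?r / ?r) + G ?r)"
      by (auto simp: f'_def inner_axis intro!: sum.cong)
    also have "\<dots> = ?r\<^sup>2 * (G' ?r / ?r) + ?N * G ?r"
      by (simp only: sum.distrib sum_distrib_right[symmetric] sum_nth_square) simp
    also have "\<dots> = ?r * G' ?r + ?N * G ?r"
      using r by (simp add: power2_eq_square)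
    also have "\<dots> = Q' ?r * (?r * ?r powr (- ?N)) + ?N * Q ?r * (?r powr (- ?N) - ?r * ?r powr (- ?N - 1))"
      by (simp add: G_def G'_def algebra_simps)
    also have "?r * ?r powr (- ?N) = ?r powr (1 - ?N)"
      using r powr_add[of ?r 1 "- ?N"] by simp
    also have "?r * ?r powr (- ?N - 1) = ?r powr (- ?N)"
      using r powr_add[of ?r 1 "- ?N - 1"] by simp
    finally show ?thesis by simp
  qed
  ultimately show ?thesis by simp
qed

section \<open>Continuous approximation in mean square\<close>

lemma integrable_square_mult:
  fixes f g :: "'a \<Rightarrow> real"
  assumes [measurable]: "f \<in> borel_measurable M" "g \<in> borel_measurable M"
    and "integrable M (\<lambda>x. (f x)\<^sup>2)" "integrable M (\<lambda>x. (g x)\<^sup>2)"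
  shows "integrable M (\<lambda>x. f x * g x)"
proof (rule Bochner_Integration.integrable_bound)
  show "integrable M (\<lambda>x. (f x)\<^sup>2 + (g x)\<^sup>2)"
    using assms by simp
  have "\<bar>a * b\<bar> \<le> a\<^sup>2 + b\<^sup>2" for a b :: real
    using zero_le_power2[of "\<bar>a\<bar> - \<bar>b\<bar>"] zero_le_power2[of a] zero_le_power2[of b]
    unfolding power2_diff abs_mult power2_abs by linarith
  then show "AE x in M. norm (f x * g x) \<le> norm ((f x)\<^sup>2 + (g x)\<^sup>2)"
    by auto
qed measurable

lemma integrable_mult_bounded:
  fixes f k :: "'a \<Rightarrow> real"
  assumes "integrable M f" "k \<in> borel_measurable M" "\<And>x. \<bar>k x\<bar> \<le> B"
  shows "integrable M (\<lambda>x. f x * k x)"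
proof (rule Bochner_Integration.integrable_bound)
  show "integrable M (\<lambda>x. f x * B)" using assms by simp
  have "0 \<le> B" using assms(3) abs_ge_zero order_trans by blast
  then show "AE x in M. norm (f x * k x) \<le> norm (f x * B)"
    using assms(3) by (auto simp: abs_mult intro!: mult_left_mono)
qed (use assms in measurable)

lemma integrable_const_indicator_cball:
  "integrable lborel (\<lambda>x::'a::euclidean_space. (c::real) * indicator (cball a r) x)"
  using emeasure_bounded_finite[of "cball a r"]
  by (intro integrable_mult_right integrable_real_indicator) simp_all

lemma integrable_square_on_cball:
  fixes f :: "'a::euclidean_space \<Rightarrow> real"
  assumes [measurable]: "f \<in> borel_measurable borel" and "integrable lborel (\<lambda>x. (f x)\<^sup>2)"
  shows "integrable lborel (\<lambda>x. f x * indicator (cball a r) x)"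
proof (rule integrable_square_mult)
  show "integrable lborel (\<lambda>x. (indicator (cball a r) x)\<^sup>2 :: real)"
  proof -
    have "(\<lambda>x. (indicator (cball a r) x)\<^sup>2 :: real) = (\<lambda>x. 1 * indicator (cball a r) x)"
      by (auto simp: indicator_def)
    then show ?thesis by (simp only: integrable_const_indicator_cball)
  qed
qed (use assms in \<open>auto intro!: borel_measurable_indicator\<close>)

lemma L2_approx_bounded:
  fixes f :: "'a::euclidean_space \<Rightarrow> real"
  assumes [measurable]: "f \<in> borel_measurable borel" and f: "integrable lborel (\<lambda>x. (f x)\<^sup>2)" and "0 < e"
  obtains h k where "h \<in> borel_measurable borel" "0 < k" "\<And>x. \<bar>h x\<bar> \<le> k" "\<And>x. k < norm x \<Longrightarrow> h x = 0"
    "integrable lborel (\<lambda>x. (f x - h x)\<^sup>2)" "(\<integral>x. (f x - h x)\<^sup>2 \<partial>lborel) < e"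
proof -
  \<comment> \<open>Truncation in value and in space at the same level, so that one parameter k
    serves for both bounds. The error never exceeds f in absolute value, which gives dominated
    convergence.\<close>
  define h where "h n x = indicator (cball 0 (real (Suc n))) x * max (- real (Suc n)) (min (real (Suc n)) (f x))" for n x
  have [measurable]: "h n \<in> borel_measurable borel" for n
    unfolding h_def
    by (intro borel_measurable_times borel_measurable_indicator borel_measurable_max
        borel_measurable_min borel_measurable_const assms) simp
  have le: "(f x - h n x)\<^sup>2 \<le> (f x)\<^sup>2" for n x
  proof -
    have "\<bar>f x - h n x\<bar> \<le> \<bar>f x\<bar>"
      by (auto simp: h_def indicator_def max_def min_def)
    then show ?thesis by (metis power2_le_iff_abs_le abs_ge_zero power2_abs abs_abs)
  qed
  have int: "integrable lborel (\<lambda>x. (f x - h n x)\<^sup>2)" for n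
    using f by (rule Bochner_Integration.integrable_bound) (auto simp: le)
  have "(\<lambda>n. \<integral>x. (f x - h n x)\<^sup>2 \<partial>lborel) \<longlonglongrightarrow> (\<integral>x. 0 \<partial>(lborel :: 'a measure))"
  proof (rule integral_dominated_convergence[OF _ _ f])
    show "AE x in lborel. (\<lambda>n. (f x - h n x)\<^sup>2) \<longlonglongrightarrow> 0"
    proof (rule AE_I2)
      fix x
      obtain n0 :: nat where n0: "norm x + \<bar>f x\<bar> < real n0"
        using reals_Archimedean2 by blast
      have "\<forall>\<^sub>F n in sequentially. (f x - h n x)\<^sup>2 = 0"
        using eventually_ge_at_top[of n0]
      proof eventually_elim
        case (elim n)
        then have "norm x + \<bar>f x\<bar> < real (Suc n)" using n0 by linarith
        then have "norm x \<le> real (Suc n)" "\<bar>f x\<bar> \<le> real (Suc n)"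
          using norm_ge_zero[of x] abs_ge_zero[of "f x"] by linarith+
        then show ?case
          by (simp add: h_def indicator_def)
      qed
      then show "(\<lambda>n. (f x - h n x)\<^sup>2) \<longlonglongrightarrow> 0"
        by (rule tendsto_eventually)
    qed
  qed (use f le in auto)
  then have "\<forall>\<^sub>F n in sequentially. (\<integral>x. (f x - h n x)\<^sup>2 \<partial>lborel) < e"
    using \<open>0 < e\<close> by (intro order_tendstoD(2)) auto
  then obtain n where n: "(\<integral>x. (f x - h n x)\<^sup>2 \<partial>lborel) < e"
    using eventually_happens'[OF sequentially_bot] by blast
  show thesis
  proof (rule that[OF _ _ _ _ int n])
    show "\<bar>h n x\<bar> \<le> real (Suc n)" for x
      by (auto simp: h_def indicator_def)
    show "h n x = 0" if "real (Suc n) < norm x" for x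
      using that by (simp add: h_def indicator_def)
  qed auto
qed

text \<open>Measurability provides continuous functions that converge to h almost everywhere, but
  without any bound. Clamping them to [-k, k] and multiplying by \<open>cut\<close> makes them
  dominated and leaves the limit unchanged, since h itself obeys both restrictions.\<close>

lemma L2_approx_continuous_bounded:
  fixes h :: "'a::euclidean_space \<Rightarrow> real"
  assumes [measurable]: "h \<in> borel_measurable borel" and "0 < k" and h: "\<And>x. \<bar>h x\<bar> \<le> k" "\<And>x. k < norm x \<Longrightarrow> h x = 0"
    and "0 < e"
  obtains c where "continuous_on UNIV c" "\<And>x. k + 1 < norm x \<Longrightarrow> c x = 0"
    "integrable lborel (\<lambda>x. (h x - c x)\<^sup>2)" "(\<integral>x. (h x - c x)\<^sup>2 \<partial>lborel) < e"
proof -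
  have "h measurable_on UNIV"
    by (subst measurable_on_iff_borel_measurable) (auto simp: lebesgue_on_UNIV_eq measurable_completion)
  then obtain N g where N: "negligible N" and g: "\<And>n. continuous_on UNIV (g n)"
      "\<And>x. x \<notin> N \<Longrightarrow> (\<lambda>n. g n x) \<longlonglongrightarrow> h x"
    unfolding measurable_on_def by auto
  define cut where "cut x = max 0 (min 1 (k + 1 - norm x))" for x :: 'a
  have cut: "0 \<le> cut x" "cut x \<le> 1" "norm x \<le> k \<Longrightarrow> cut x = 1" "k + 1 < norm x \<Longrightarrow> cut x = 0" for x
    by (auto simp: cut_def)
  define c where "c n x = cut x * max (- k) (min k (g n x))" for n x
  have c_cont: "continuous_on UNIV (c n)" for n
    unfolding c_def cut_def by (intro continuous_intros g)
  then have [measurable]: "c n \<in> borel_measurable borel" for n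
    by (rule borel_measurable_continuous_onI)
  have c_bound: "\<bar>c n x\<bar> \<le> k" for n x
  proof -
    have "\<bar>cut x\<bar> * \<bar>max (- k) (min k (g n x))\<bar> \<le> 1 * k"
      using cut[of x] \<open>0 < k\<close> by (intro mult_mono) auto
    then show ?thesis by (simp add: c_def abs_mult)
  qed
  have le: "(h x - c n x)\<^sup>2 \<le> (2 * k)\<^sup>2 * indicator (cball 0 (k + 1)) x" for n x
  proof (cases "norm x \<le> k + 1")
    case True
    have *: "\<bar>h x - c n x\<bar> \<le> 2 * k"
      using h(1)[of x] c_bound[of n x] by linarith
    then show ?thesis
      using True power_mono[OF * abs_ge_zero, of 2] by (simp add: indicator_def)
  next
    case False
    then show ?thesis using h(2)[of x] cut(4)[of x] by (simp add: c_def)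
  qed
  have int: "integrable lborel (\<lambda>x. (h x - c n x)\<^sup>2)" for n
    by (rule Bochner_Integration.integrable_bound[OF integrable_const_indicator_cball[of "(2 * k)\<^sup>2" 0 "k + 1"]])
      (use le in \<open>auto simp: abs_mult\<close>)
  have "(\<lambda>n. \<integral>x. (h x - c n x)\<^sup>2 \<partial>lborel) \<longlonglongrightarrow> (\<integral>x. 0 \<partial>(lborel :: 'a measure))"
  proof (rule integral_dominated_convergence[OF _ _ integrable_const_indicator_cball[of "(2 * k)\<^sup>2" 0 "k + 1"]])
    have "AE x in lborel. x \<notin> N"
    proof -
      have "AE x in lebesgue. x \<notin> N"
        using N by (simp add: negligible_iff_null_sets AE_not_in)
      then show ?thesis by (simp add: AE_completion_iff)
    qed
    then show "AE x in lborel. (\<lambda>n. (h x - c n x)\<^sup>2) \<longlonglongrightarrow> 0"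
    proof eventually_elim
      case (elim x)
      have "(\<lambda>n. (h x - c n x)\<^sup>2) \<longlonglongrightarrow> (h x - cut x * max (- k) (min k (h x)))\<^sup>2"
        unfolding c_def by (intro tendsto_intros g(2) elim)
      moreover have "cut x * max (- k) (min k (h x)) = h x"
        using h[of x] cut(3)[of x] by (cases "norm x \<le> k") auto
      ultimately show ?case by simp
    qed
  qed (use le in auto)
  then have "\<forall>\<^sub>F n in sequentially. (\<integral>x. (h x - c n x)\<^sup>2 \<partial>lborel) < e"
    using \<open>0 < e\<close> by (intro order_tendstoD(2)) auto
  then obtain n where n: "(\<integral>x. (h x - c n x)\<^sup>2 \<partial>lborel) < e"
    using eventually_happens'[OF sequentially_bot] by blast
  show thesis
    by (rule that[OF c_cont _ int n]) (simp add: c_def cut)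
qed

lemma L2_approx_continuous:
  fixes f :: "'a::euclidean_space \<Rightarrow> real"
  assumes [measurable]: "f \<in> borel_measurable borel" and f: "integrable lborel (\<lambda>x. (f x)\<^sup>2)" and "0 < e"
  obtains c R where "continuous_on UNIV c" "\<And>x. R < norm x \<Longrightarrow> c x = 0"
    "integrable lborel (\<lambda>x. (f x - c x)\<^sup>2)" "(\<integral>x. (f x - c x)\<^sup>2 \<partial>lborel) < e"
proof -
  have e: "0 < e / 4" using \<open>0 < e\<close> by simp
  obtain h k where h: "h \<in> borel_measurable borel" "0 < k" "\<And>x. \<bar>h x\<bar> \<le> k" "\<And>x. k < norm x \<Longrightarrow> h x = 0"
    "integrable lborel (\<lambda>x. (f x - h x)\<^sup>2)" "(\<integral>x. (f x - h x)\<^sup>2 \<partial>lborel) < e / 4"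
    using L2_approx_bounded[OF assms(1,2) e] by blast
  obtain c where c: "continuous_on UNIV c" "\<And>x. k + 1 < norm x \<Longrightarrow> c x = 0"
    "integrable lborel (\<lambda>x. (h x - c x)\<^sup>2)" "(\<integral>x. (h x - c x)\<^sup>2 \<partial>lborel) < e / 4"
    using L2_approx_continuous_bounded[OF h(1-4) e] by blast
  have [measurable]: "c \<in> borel_measurable borel" "h \<in> borel_measurable borel"
    using c(1) h(1) by (auto intro: borel_measurable_continuous_onI)
  have le: "(f x - c x)\<^sup>2 \<le> 2 * (f x - h x)\<^sup>2 + 2 * (h x - c x)\<^sup>2" for x
    using zero_le_power2[of "(f x - h x) - (h x - c x)"] by (simp add: power2_eq_square algebra_simps)
  have i: "integrable lborel (\<lambda>x. 2 * (f x - h x)\<^sup>2 + 2 * (h x - c x)\<^sup>2)"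
    using h c by simp
  have int: "integrable lborel (\<lambda>x. (f x - c x)\<^sup>2)"
    by (rule Bochner_Integration.integrable_bound[OF i]) (use le in auto)
  have "(\<integral>x. (f x - c x)\<^sup>2 \<partial>lborel) \<le> (\<integral>x. 2 * (f x - h x)\<^sup>2 + 2 * (h x - c x)\<^sup>2 \<partial>lborel)"
    by (rule integral_mono[OF int i le])
  also have "\<dots> < e" using h(5,6) c(3,4) by simp
  finally show thesis using that c(1,2) int by blast
qed

lemma tendsto_integral_shift_continuous:
  fixes f c w :: "'a::euclidean_space \<Rightarrow> real"
  assumes f [measurable]: "f \<in> borel_measurable borel" and f2: "integrable lborel (\<lambda>x. (f x)\<^sup>2)"
    and c: "continuous_on UNIV c" "\<And>x. R < norm x \<Longrightarrow> c x = 0"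
    and w: "continuous_on UNIV w" "\<And>x. \<bar>w x\<bar> \<le> B"
  shows "((\<lambda>z. \<integral>x. f x * c (x + z) * w (x + (1/2) *\<^sub>R z) \<partial>lborel) \<longlongrightarrow>
    (\<integral>x. f x * c x * w x \<partial>lborel)) (at 0)"
proof -
  obtain M where M: "0 < M" "\<And>x. \<bar>c x\<bar> \<le> M"
    using bounded_continuous_support[OF c] by blast
  have "0 \<le> B" using w(2) abs_ge_zero order_trans by blast
  have [measurable]: "c \<in> borel_measurable borel" "w \<in> borel_measurable borel"
    using c(1) w(1) by (auto intro: borel_measurable_continuous_onI)
  \<comment> \<open>Restricting to shifts of length at most 1 confines every shifted support to the
    ball of radius R + 1, which gives one dominating function for all z.\<close>
  have "((\<lambda>z. \<integral>x. f x * c (x + z) * w (x + (1/2) *\<^sub>R z) \<partial>lborel) \<longlongrightarrow>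
    (\<integral>x. f x * c x * w x \<partial>lborel)) (at 0 within cball 0 1)"
    unfolding tendsto_at_iff_sequentially comp_def
  proof (intro allI impI)
    fix X :: "nat \<Rightarrow> 'a" assume X: "\<forall>i. X i \<in> cball 0 1 - {0}" "X \<longlonglongrightarrow> 0"
    show "(\<lambda>n. \<integral>x. f x * c (x + X n) * w (x + (1/2) *\<^sub>R X n) \<partial>lborel) \<longlonglongrightarrow> (\<integral>x. f x * c x * w x \<partial>lborel)"
    proof (rule integral_dominated_convergence)
      show "integrable lborel (\<lambda>x. (M * B) * \<bar>f x * indicator (cball 0 (R + 1)) x\<bar>)"
        by (intro integrable_mult_right integrable_abs integrable_square_on_cball f f2)
      show "AE x in lborel. (\<lambda>n. f x * c (x + X n) * w (x + (1/2) *\<^sub>R X n)) \<longlonglongrightarrow> f x * c x * w x"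
      proof (rule AE_I2)
        fix x
        have "(\<lambda>n. x + X n) \<longlonglongrightarrow> x + 0" "(\<lambda>n. x + (1/2) *\<^sub>R X n) \<longlonglongrightarrow> x + (1/2) *\<^sub>R 0"
          by (intro tendsto_intros X(2))+
        then have "(\<lambda>n. c (x + X n)) \<longlonglongrightarrow> c x" "(\<lambda>n. w (x + (1/2) *\<^sub>R X n)) \<longlonglongrightarrow> w x"
          using continuous_on_tendsto_compose[OF c(1)] continuous_on_tendsto_compose[OF w(1)] by auto
        then show "(\<lambda>n. f x * c (x + X n) * w (x + (1/2) *\<^sub>R X n)) \<longlonglongrightarrow> f x * c x * w x"
          by (intro tendsto_intros)
      qed
      show "AE x in lborel. norm (f x * c (x + X n) * w (x + (1/2) *\<^sub>R X n)) \<le> (M * B) * \<bar>f x * indicator (cball 0 (R + 1)) x\<bar>" for n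
      proof (rule AE_I2)
        fix x
        show "norm (f x * c (x + X n) * w (x + (1/2) *\<^sub>R X n)) \<le> (M * B) * \<bar>f x * indicator (cball 0 (R + 1)) x\<bar>"
        proof (cases "norm x \<le> R + 1")
          case True
          have "\<bar>c (x + X n)\<bar> * \<bar>w (x + (1/2) *\<^sub>R X n)\<bar> \<le> M * B"
            using M w(2) \<open>0 \<le> B\<close> by (intro mult_mono) auto
          then have "\<bar>f x\<bar> * (\<bar>c (x + X n)\<bar> * \<bar>w (x + (1/2) *\<^sub>R X n)\<bar>) \<le> \<bar>f x\<bar> * (M * B)"
            by (intro mult_left_mono) auto
          then show ?thesis using True by (simp add: abs_mult indicator_def ac_simps)
        next
          case False
          have "norm (X n) \<le> 1" using X(1) by (auto simp: dist_norm)
          moreover have "norm x \<le> norm (x + X n) + norm (X n)"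
            by (metis add_diff_cancel_right' norm_triangle_ineq4)
          ultimately have "c (x + X n) = 0" using False by (intro c(2)) auto
          then show ?thesis using M(1) \<open>0 \<le> B\<close> by simp
        qed
      qed
    qed measurable
  qed
  then show ?thesis
    by (subst (asm) at_within_interior) auto
qed

text \<open>Continuity of translations in mean square, tested against f and with a weight at the
  midpoint of x and x + z. Replacing g by a continuous c of compact support costs an error that is
  uniform in z, because Lebesgue measure is translation invariant.\<close>

lemma tendsto_integral_shift:
  fixes f g w :: "'a::euclidean_space \<Rightarrow> real"
  assumes f [measurable]: "f \<in> borel_measurable borel" and f2: "integrable lborel (\<lambda>x. (f x)\<^sup>2)"
    and g [measurable]: "g \<in> borel_measurable borel" and g2: "integrable lborel (\<lambda>x. (g x)\<^sup>2)"
    and w: "continuous_on UNIV w" "0 < B" "\<And>x. \<bar>w x\<bar> \<le> B"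
  shows "((\<lambda>z. \<integral>x. f x * g (x + z) * w (x + (1/2) *\<^sub>R z) \<partial>lborel) \<longlongrightarrow>
    (\<integral>x. f x * g x * w x \<partial>lborel)) (at 0)"
proof (rule tendstoI)
  fix e :: real assume "0 < e"
  define A where "A = (\<integral>x. (f x)\<^sup>2 \<partial>lborel)"
  have A: "0 \<le> A" unfolding A_def by (intro Bochner_Integration.integral_nonneg) auto
  \<comment> \<open>The parameter of Young's inequality 2ab <= t a^2 + b^2/t. With mean square error
    below t^2 the total is at most (B/2)(t A + t) = e/4. Taking A + 1 keeps the denominator positive
    when f vanishes almost everywhere.\<close>
  define t where "t = e / (2 * B * (A + 1))"
  have t: "0 < t" using \<open>0 < e\<close> w(2) A by (simp add: t_def)
  obtain c R where c: "continuous_on UNIV c" "\<And>x. R < norm x \<Longrightarrow> c x = 0"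
    "integrable lborel (\<lambda>x. (g x - c x)\<^sup>2)" "(\<integral>x. (g x - c x)\<^sup>2 \<partial>lborel) < t\<^sup>2"
    using L2_approx_continuous[OF g g2, of "t\<^sup>2"] t by auto
  have [measurable]: "c \<in> borel_measurable borel" "w \<in> borel_measurable borel"
    using c(1) w(1) by (auto intro: borel_measurable_continuous_onI)
  have c2: "integrable lborel (\<lambda>x. (c x)\<^sup>2)"
    using c(1,2) by (intro integrable_continuous_support[of _ R]) (auto intro: continuous_intros)
  define H where "H h z = (\<integral>x. f x * h (x + z) * w (x + (1/2) *\<^sub>R z) \<partial>lborel)" for h z
  have int: "integrable lborel (\<lambda>x. f x * h (x + z) * w (x + (1/2) *\<^sub>R z))"
    if [measurable]: "h \<in> borel_measurable borel" and "integrable lborel (\<lambda>x. (h x)\<^sup>2)" for h z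
  proof (rule integrable_mult_bounded[OF integrable_square_mult[OF _ _ f2]])
    show "integrable lborel (\<lambda>x. (h (x + z))\<^sup>2)"
      using integrable_lborel_shift[OF that(2), of z] by (simp add: add.commute)
  qed (use w(3) in auto)
  have small: "\<bar>H g z - H c z\<bar> \<le> e / 4" for z
  proof -
    have s: "integrable lborel (\<lambda>x. (g (x + z) - c (x + z))\<^sup>2)"
      using integrable_lborel_shift[OF c(3), of z] by (simp add: add.commute)
    have i: "integrable lborel (\<lambda>x. B / 2 * (t * (f x)\<^sup>2 + (g (x + z) - c (x + z))\<^sup>2 / t))"
      using f2 s by simp
    have i2: "integrable lborel (\<lambda>x. f x * g (x + z) * w (x + (1/2) *\<^sub>R z) - f x * c (x + z) * w (x + (1/2) *\<^sub>R z))"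
      using int[OF g g2] int[OF _ c2] by (intro Bochner_Integration.integrable_diff) auto
    let ?d = "\<lambda>x. f x * g (x + z) * w (x + (1/2) *\<^sub>R z) - f x * c (x + z) * w (x + (1/2) *\<^sub>R z)"
    have "H g z - H c z = (\<integral>x. ?d x \<partial>lborel)"
      unfolding H_def using int[OF g g2] int[OF _ c2]
      by (intro Bochner_Integration.integral_diff[symmetric]) auto
    then have "\<bar>H g z - H c z\<bar> \<le> (\<integral>x. \<bar>?d x\<bar> \<partial>lborel)"
      by (simp only: integral_abs_bound)
    also have "\<dots> \<le> (\<integral>x. B / 2 * (t * (f x)\<^sup>2 + (g (x + z) - c (x + z))\<^sup>2 / t) \<partial>lborel)"
    proof (rule integral_mono[OF integrable_abs[OF i2] i])
      fix x
      let ?a = "f x" and ?b = "g (x + z) - c (x + z)"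
      have "0 \<le> (t * \<bar>?a\<bar> - \<bar>?b\<bar>)\<^sup>2 / t" using t by simp
      then have ab: "2 * (\<bar>?a\<bar> * \<bar>?b\<bar>) \<le> t * ?a\<^sup>2 + ?b\<^sup>2 / t"
        using t unfolding power2_diff power_mult_distrib power2_abs
        by (simp add: add_divide_distrib diff_divide_distrib power2_eq_square)
      have "\<bar>f x * g (x + z) * w (x + (1/2) *\<^sub>R z) - f x * c (x + z) * w (x + (1/2) *\<^sub>R z)\<bar>
          = \<bar>?a\<bar> * \<bar>?b\<bar> * \<bar>w (x + (1/2) *\<^sub>R z)\<bar>"
        by (simp add: abs_mult[symmetric] algebra_simps)
      also have "\<dots> \<le> \<bar>?a\<bar> * \<bar>?b\<bar> * B"
        using w(3) by (intro mult_left_mono) auto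
      also have "\<dots> = B / 2 * (2 * (\<bar>?a\<bar> * \<bar>?b\<bar>))" by simp
      also have "\<dots> \<le> B / 2 * (t * ?a\<^sup>2 + ?b\<^sup>2 / t)"
        using ab w(2) by (intro mult_left_mono) auto
      finally show "\<bar>f x * g (x + z) * w (x + (1/2) *\<^sub>R z) - f x * c (x + z) * w (x + (1/2) *\<^sub>R z)\<bar>
          \<le> B / 2 * (t * ?a\<^sup>2 + ?b\<^sup>2 / t)" .
    qed
    also have "\<dots> = B / 2 * (t * A + (\<integral>x. (g (x + z) - c (x + z))\<^sup>2 \<partial>lborel) / t)"
      using f2 s by (simp add: A_def)
    also have "(\<integral>x. (g (x + z) - c (x + z))\<^sup>2 \<partial>lborel) = (\<integral>x. (g x - c x)\<^sup>2 \<partial>lborel)"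
      using integral_lborel_shift[of "\<lambda>x. (g x - c x)\<^sup>2" z] by (simp add: add.commute)
    also have "B / 2 * (t * A + (\<integral>x. (g x - c x)\<^sup>2 \<partial>lborel) / t) \<le> B / 2 * (t * A + t\<^sup>2 / t)"
      using c(4) t w(2) by (intro mult_left_mono add_left_mono divide_right_mono) auto
    also have "\<dots> = t * (2 * B * (A + 1)) / 4"
      using t by (simp add: power2_eq_square algebra_simps)
    also have "\<dots> = e / 4"
      using w(2) A by (simp add: t_def)
    finally show ?thesis .
  qed
  have "(H c \<longlongrightarrow> H c 0) (at 0)"
    unfolding H_def using tendsto_integral_shift_continuous[OF f f2 c(1,2) w(1,3)] by simp
  then have "\<forall>\<^sub>F z in at 0. dist (H c z) (H c 0) < e / 2"
    using \<open>0 < e\<close> by (intro tendstoD) auto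
  then have "\<forall>\<^sub>F z in at 0. dist (H g z) (H g 0) < e"
  proof eventually_elim
    case (elim z)
    then show ?case
      using small[of z] small[of 0] unfolding dist_real_def by linarith
  qed
  then show "\<forall>\<^sub>F z in at 0. dist (\<integral>x. f x * g (x + z) * w (x + (1/2) *\<^sub>R z) \<partial>lborel)
      (\<integral>x. f x * g x * w x \<partial>lborel) < e"
    by (simp add: H_def)
qed

section \<open>Double integrals with compactly supported kernels\<close>

lemma integrable_pair_mult:
  fixes f g :: "'a::euclidean_space \<Rightarrow> real"
  assumes f: "integrable lborel f" and g: "integrable lborel g"
  shows "integrable (lborel \<Otimes>\<^sub>M lborel) (\<lambda>(x, y). f x * g y)"
proof (rule lborel_pair.Fubini_integrable)
  have [measurable]: "f \<in> borel_measurable borel" "g \<in> borel_measurable borel"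
    using f g by auto
  show "(\<lambda>(x, y). f x * g y) \<in> borel_measurable (lborel \<Otimes>\<^sub>M lborel)"
    by measurable
qed (use f g in \<open>simp_all add: abs_mult\<close>)

text \<open>On the support of K both arguments stay in one ball, where square integrable functions
  are integrable. A product of two such functions dominates the integrand, so Fubini becomes
  available.\<close>

lemma integrable_pair_kernel:
  fixes f g :: "'a::euclidean_space \<Rightarrow> real" and K :: "'a \<times> 'a \<Rightarrow> real"
  assumes f [measurable]: "f \<in> borel_measurable borel" and f2: "integrable lborel (\<lambda>x. (f x)\<^sup>2)"
    and g [measurable]: "g \<in> borel_measurable borel" and g2: "integrable lborel (\<lambda>x. (g x)\<^sup>2)"
    and K: "continuous_on UNIV K" "\<And>x y. \<bar>K (x, y)\<bar> \<le> B" "\<And>x y. R < norm x \<or> R < norm y \<Longrightarrow> K (x, y) = 0"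
  shows "integrable (lborel \<Otimes>\<^sub>M lborel) (\<lambda>(x, y). f x * g y * K (x, y))"
proof (rule Bochner_Integration.integrable_bound)
  let ?p = "\<lambda>x. \<bar>f x * indicator (cball 0 R) x\<bar>" and ?q = "\<lambda>x. \<bar>g x * indicator (cball 0 R) x\<bar>"
  have [measurable]: "K \<in> borel_measurable (borel \<Otimes>\<^sub>M borel)"
    using borel_measurable_continuous_onI[OF K(1)] by (simp add: borel_prod)
  show "integrable (lborel \<Otimes>\<^sub>M lborel) (\<lambda>z. B * (case z of (x, y) \<Rightarrow> ?p x * ?q y))"
    by (intro integrable_mult_right integrable_pair_mult integrable_abs integrable_square_on_cball f f2 g g2)
  show "(\<lambda>(x, y). f x * g y * K (x, y)) \<in> borel_measurable (lborel \<Otimes>\<^sub>M lborel)"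
    by measurable
  show "AE z in lborel \<Otimes>\<^sub>M lborel. norm (case z of (x, y) \<Rightarrow> f x * g y * K (x, y))
      \<le> norm (B * (case z of (x, y) \<Rightarrow> ?p x * ?q y))"
  proof (rule AE_I2, clarify)
    fix x y
    have "0 \<le> B" using K(2) abs_ge_zero order_trans by blast
    show "norm (f x * g y * K (x, y)) \<le> norm (B * (?p x * ?q y))"
    proof (cases "R < norm x \<or> R < norm y")
      case True
      then show ?thesis using K(3) by auto
    next
      case False
      have "\<bar>f x * g y\<bar> * \<bar>K (x, y)\<bar> \<le> \<bar>f x * g y\<bar> * B"
        using K(2) by (intro mult_left_mono) auto
      then show ?thesis using False \<open>0 \<le> B\<close> by (simp add: abs_mult indicator_def not_less ac_simps)
    qed
  qed
qed

text \<open>The substitution y = x + z is a translation in the inner integral for each fixed x, so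
  Fubini and translation invariance suffice.\<close>

lemma shear_lborel:
  fixes F :: "'a::euclidean_space \<times> 'a \<Rightarrow> real"
  assumes F: "integrable (lborel \<Otimes>\<^sub>M lborel) F"
  shows integrable_shear: "integrable (lborel \<Otimes>\<^sub>M lborel) (\<lambda>(x, z). F (x, x + z))"
    and integral_shear: "(\<integral>p. (case p of (x, z) \<Rightarrow> F (x, x + z)) \<partial>(lborel \<Otimes>\<^sub>M lborel)) = integral\<^sup>L (lborel \<Otimes>\<^sub>M lborel) F"
proof -
  have FM [measurable]: "F \<in> borel_measurable (borel \<Otimes>\<^sub>M borel)"
    using borel_measurable_integrable[OF F] by (simp cong: measurable_cong_sets sets_pair_measure_cong)
  have Fx: "(\<lambda>y. F (x, y)) \<in> borel_measurable borel" for x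
    by measurable
  show *: "integrable (lborel \<Otimes>\<^sub>M lborel) (\<lambda>(x, z). F (x, x + z))"
  proof (rule lborel_pair.Fubini_integrable)
    show "(\<lambda>(x, z). F (x, x + z)) \<in> borel_measurable (lborel \<Otimes>\<^sub>M lborel)"
      by measurable
    have "(\<integral>z. norm (F (x, x + z)) \<partial>lborel) = (\<integral>y. norm (F (x, y)) \<partial>lborel)" for x
      using integral_lborel_shift[of "\<lambda>y. norm (F (x, y))" x] Fx by simp
    then show "integrable lborel (\<lambda>x. \<integral>z. norm (case (x, z) of (x, z) \<Rightarrow> F (x, x + z)) \<partial>lborel)"
      using lborel_pair.integrable_fst'[OF integrable_norm[OF F]] by simp
    show "AE x in lborel. integrable lborel (\<lambda>z. case (x, z) of (x, z) \<Rightarrow> F (x, x + z))"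
      using lborel_pair.AE_integrable_fst'[OF F]
    proof eventually_elim
      case (elim x)
      then show ?case using integrable_lborel_shift[OF elim, of x] by simp
    qed
  qed
  have "(\<integral>p. (case p of (x, z) \<Rightarrow> F (x, x + z)) \<partial>(lborel \<Otimes>\<^sub>M lborel)) = (\<integral>x. (\<integral>z. F (x, x + z) \<partial>lborel) \<partial>lborel)"
    using lborel_pair.integral_fst'[OF *] by simp
  also have "\<dots> = (\<integral>x. (\<integral>y. F (x, y) \<partial>lborel) \<partial>lborel)"
    using integral_lborel_shift[OF Fx] by simp
  also have "\<dots> = integral\<^sup>L (lborel \<Otimes>\<^sub>M lborel) F"
    using lborel_pair.integral_fst'[OF F] .
  finally show "(\<integral>p. (case p of (x, z) \<Rightarrow> F (x, x + z)) \<partial>(lborel \<Otimes>\<^sub>M lborel)) = integral\<^sup>L (lborel \<Otimes>\<^sub>M lborel) F" .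
qed

section \<open>The weak derivative of a square\<close>

lemma test_functionI:
  assumes "smooth \<phi>" "\<And>x. R < norm x \<Longrightarrow> \<phi> x = 0"
  shows "test_function \<phi>"
proof -
  have "{x. \<phi> x \<noteq> 0} \<subseteq> cball 0 R"
    using assms(2) by (force simp: not_le)
  then have "compact (closure {x. \<phi> x \<noteq> 0})"
    using bounded_cball bounded_subset compact_closure by blast
  then show ?thesis using assms(1) by (simp add: test_function_def smooth_def)
qed

lemma test_functionE:
  assumes "test_function \<phi>"
  obtains R where "smooth \<phi>" "\<And>x. R < norm x \<Longrightarrow> \<phi> x = 0"
proof -
  have "bounded (closure {x. \<phi> x \<noteq> 0})"
    using assms compact_imp_bounded unfolding test_function_def by blast
  then obtain R where "\<And>x. x \<in> closure {x. \<phi> x \<noteq> 0} \<Longrightarrow> norm x \<le> R"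
    unfolding bounded_iff by blast
  then have "R < norm x \<Longrightarrow> \<phi> x = 0" for x
    using closure_subset[of "{x. \<phi> x \<noteq> 0}"] by force
  then show thesis using that assms by (auto simp: test_function_def smooth_def)
qed

lemma partial_deriv_support:
  assumes "smooth \<phi>" "\<And>x. R < norm x \<Longrightarrow> \<phi> x = 0" "R < norm x"
  shows "partial_deriv i \<phi> x = 0"
proof -
  have "((\<lambda>y. 0) has_derivative frechet_derivative \<phi> (at x)) (at x)"
    using assms
    by (intro has_derivative_transform_within_open[OF smooth_has_derivative[OF assms(1)], of "{y. R < norm y}"])
      (auto intro!: open_Collect_less continuous_intros)
  then have "frechet_derivative \<phi> (at x) = (\<lambda>h. 0)"
    using has_derivative_unique has_derivative_const by blast
  then show ?thesis by (simp add: partial_deriv_def)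
qed

lemma partial_deriv_mult:
  assumes "smooth f" "smooth g"
  shows "partial_deriv i (\<lambda>x. f x * g x) x = f x * partial_deriv i g x + partial_deriv i f x * g x"
  using partial_deriv_eq[OF has_derivative_mult[OF smooth_has_derivative[OF assms(1)] smooth_has_derivative[OF assms(2)]]]
  by (simp add: partial_deriv_def)

lemma partial_deriv_affine:
  assumes "smooth f"
  shows "partial_deriv i (\<lambda>x. f (c *\<^sub>R x + v)) x = c * partial_deriv i f (c *\<^sub>R x + v)"
proof -
  have "((\<lambda>x. c *\<^sub>R x + v) has_derivative (*\<^sub>R) c) (at x)"
    by (auto intro!: derivative_eq_intros)
  from has_derivative_compose[OF this smooth_has_derivative[OF assms]]
  have "partial_deriv i (\<lambda>x. f (c *\<^sub>R x + v)) x = frechet_derivative f (at (c *\<^sub>R x + v)) (c *\<^sub>R axis i 1)"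
    by (rule partial_deriv_eq)
  also have "\<dots> = c * partial_deriv i f (c *\<^sub>R x + v)"
    using has_derivative_linear[OF smooth_has_derivative[OF assms]] by (simp add: linear_cmul partial_deriv_def)
  finally show ?thesis .
qed

text \<open>The cutoff \<open>a\<close> controls the midpoint of x and y, and \<open>b\<close> their
  difference. The arguments are spelled as \<open>c *\<^sub>R x + v\<close> to agree with
  \<open>smooth_affine\<close> and \<open>partial_deriv_affine\<close>.\<close>

lemma integrable_difference_kernel:
  fixes f g a b :: "'a::euclidean_space \<Rightarrow> real"
  assumes "f \<in> borel_measurable borel" "integrable lborel (\<lambda>x. (f x)\<^sup>2)"
    and "g \<in> borel_measurable borel" "integrable lborel (\<lambda>x. (g x)\<^sup>2)"
    and a: "continuous_on UNIV a" "\<And>x. R < norm x \<Longrightarrow> a x = 0"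
    and b: "continuous_on UNIV b" "\<And>x. S < norm x \<Longrightarrow> b x = 0"
    and \<epsilon>: "0 < \<epsilon>"
  shows "integrable (lborel \<Otimes>\<^sub>M lborel) (\<lambda>(x, y). f x * g y *
    (a ((1/2) *\<^sub>R x + (1/2) *\<^sub>R y) * b ((1/\<epsilon>) *\<^sub>R x + (- (1/\<epsilon>)) *\<^sub>R y)))"
proof -
  let ?K = "\<lambda>p. a ((1/2) *\<^sub>R fst p + (1/2) *\<^sub>R snd p) * b ((1/\<epsilon>) *\<^sub>R fst p + (- (1/\<epsilon>)) *\<^sub>R snd p)"
  obtain A where A: "0 < A" "\<And>x. \<bar>a x\<bar> \<le> A" using bounded_continuous_support[OF a] by blast
  obtain B where B: "0 < B" "\<And>x. \<bar>b x\<bar> \<le> B" using bounded_continuous_support[OF b] by blast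
  have "integrable (lborel \<Otimes>\<^sub>M lborel) (\<lambda>(x, y). f x * g y * ?K (x, y))"
  proof (rule integrable_pair_kernel[OF assms(1-4)])
    show "continuous_on UNIV ?K"
      by (intro continuous_intros continuous_on_compose2[OF a(1)] continuous_on_compose2[OF b(1)]) auto
    show "\<bar>?K (x, y)\<bar> \<le> A * B" for x y
      unfolding abs_mult using A B by (intro mult_mono) auto
    \<comment> \<open>Each of x and y is the midpoint plus or minus half the difference, and half
      the difference has length at most \<epsilon> S/2 on the support of \<open>b\<close>.\<close>
    show "?K (x, y) = 0" if "R + \<epsilon> * S / 2 < norm x \<or> R + \<epsilon> * S / 2 < norm y" for x y
    proof (rule ccontr)
      assume "?K (x, y) \<noteq> 0"
      then have m: "norm ((1/2) *\<^sub>R x + (1/2) *\<^sub>R y) \<le> R" and d: "norm ((1/\<epsilon>) *\<^sub>R x + (- (1/\<epsilon>)) *\<^sub>R y) \<le> S"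
        using a(2) b(2) by (force simp: not_less[symmetric])+
      have "norm ((\<epsilon>/2) *\<^sub>R ((1/\<epsilon>) *\<^sub>R x + (- (1/\<epsilon>)) *\<^sub>R y)) \<le> (\<epsilon>/2) * S"
        unfolding norm_scaleR using d \<epsilon> by (intro mult_mono) auto
      moreover have "(\<epsilon>/2) *\<^sub>R ((1/\<epsilon>) *\<^sub>R x + (- (1/\<epsilon>)) *\<^sub>R y) = (1/2) *\<^sub>R x - (1/2) *\<^sub>R y"
        using \<epsilon> by (simp add: scaleR_right_distrib scaleR_right_diff_distrib)
      ultimately have "norm ((1/2) *\<^sub>R x - (1/2) *\<^sub>R y) \<le> (\<epsilon>/2) * S"
        by (simp only:)
      then have d': "norm ((1/2) *\<^sub>R x - (1/2) *\<^sub>R y) \<le> \<epsilon> * S / 2"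
        by simp
      have "x = ((1/2) *\<^sub>R x + (1/2) *\<^sub>R y) + ((1/2) *\<^sub>R x - (1/2) *\<^sub>R y)"
        "y = ((1/2) *\<^sub>R x + (1/2) *\<^sub>R y) - ((1/2) *\<^sub>R x - (1/2) *\<^sub>R y)"
        by (simp_all add: scaleR_left_distrib[symmetric])
      then have "norm x \<le> R + \<epsilon> * S / 2" "norm y \<le> R + \<epsilon> * S / 2"
        using m d' by (smt (verit) norm_triangle_ineq norm_triangle_ineq4)+
      then show False using that by auto
    qed
  qed
  then show ?thesis by simp
qed

text \<open>In the variables x and z = y - x the kernel factors: \<open>b\<close> depends on z
  alone, and the rest is a correlation H(z). The double integral becomes an average of H near 0;
  evenness of \<open>b\<close> absorbs the sign of x - y = - z.\<close>

lemma integral_difference_kernel: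
  fixes f g a b :: "'a::euclidean_space \<Rightarrow> real"
  assumes "f \<in> borel_measurable borel" "integrable lborel (\<lambda>x. (f x)\<^sup>2)"
    and "g \<in> borel_measurable borel" "integrable lborel (\<lambda>x. (g x)\<^sup>2)"
    and a: "continuous_on UNIV a" "\<And>x. R < norm x \<Longrightarrow> a x = 0"
    and b: "continuous_on UNIV b" "\<And>x. S < norm x \<Longrightarrow> b x = 0"
    and \<epsilon>: "0 < \<epsilon>" and even: "\<And>x. b (- x) = b x"
  defines "H \<equiv> \<lambda>z. \<integral>x. f x * g (x + z) * a (x + (1/2) *\<^sub>R z) \<partial>lborel"
  shows "integrable lborel (\<lambda>z. b ((1/\<epsilon>) *\<^sub>R z) * H z)"
    and "(\<integral>(x, y). f x * g y * (a ((1/2) *\<^sub>R x + (1/2) *\<^sub>R y) *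
        b ((1/\<epsilon>) *\<^sub>R x + (- (1/\<epsilon>)) *\<^sub>R y)) \<partial>(lborel \<Otimes>\<^sub>M lborel)) = (\<integral>z. b ((1/\<epsilon>) *\<^sub>R z) * H z \<partial>lborel)"
proof -
  let ?F = "\<lambda>(x, y). f x * g y * (a ((1/2) *\<^sub>R x + (1/2) *\<^sub>R y) * b ((1/\<epsilon>) *\<^sub>R x + (- (1/\<epsilon>)) *\<^sub>R y))"
  have F: "integrable (lborel \<Otimes>\<^sub>M lborel) ?F"
    by (rule integrable_difference_kernel[OF assms(1-9)])
  have eq: "?F (x, x + z) = b ((1/\<epsilon>) *\<^sub>R z) * (f x * g (x + z) * a (x + (1/2) *\<^sub>R z))" for x z
  proof -
    have "(1/2) *\<^sub>R x + (1/2) *\<^sub>R (x + z) = x + (1/2) *\<^sub>R z"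
      by (simp add: scaleR_right_distrib add.assoc[symmetric] scaleR_left_distrib[symmetric])
    moreover have "(1/\<epsilon>) *\<^sub>R x + (- (1/\<epsilon>)) *\<^sub>R (x + z) = - ((1/\<epsilon>) *\<^sub>R z)"
      by (simp add: scaleR_right_distrib)
    ultimately show ?thesis by (simp add: even)
  qed
  have F': "integrable (lborel \<Otimes>\<^sub>M lborel) (\<lambda>(x, z). b ((1/\<epsilon>) *\<^sub>R z) * (f x * g (x + z) * a (x + (1/2) *\<^sub>R z)))"
    using integrable_shear[OF F] by (simp only: eq)
  show "integrable lborel (\<lambda>z. b ((1/\<epsilon>) *\<^sub>R z) * H z)"
    using lborel_pair.integrable_snd[OF F'] by (simp add: H_def)
  have "(\<integral>p. ?F p \<partial>(lborel \<Otimes>\<^sub>M lborel)) = (\<integral>(x, z). b ((1/\<epsilon>) *\<^sub>R z) * (f x * g (x + z) * a (x + (1/2) *\<^sub>R z)) \<partial>(lborel \<Otimes>\<^sub>M lborel))"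
    unfolding integral_shear[OF F, symmetric] by (simp only: eq)
  also have "\<dots> = (\<integral>z. b ((1/\<epsilon>) *\<^sub>R z) * H z \<partial>lborel)"
    using lborel_pair.integral_snd[OF F'] by (simp add: H_def)
  finally show "(\<integral>p. ?F p \<partial>(lborel \<Otimes>\<^sub>M lborel)) = (\<integral>z. b ((1/\<epsilon>) *\<^sub>R z) * H z \<partial>lborel)" .
qed

lemma integral_pos_continuous:
  fixes f :: "'a::euclidean_space \<Rightarrow> real"
  assumes "integrable lborel f" "continuous_on UNIV f" "\<And>x. 0 \<le> f x" "0 < f a"
  shows "0 < (\<integral>x. f x \<partial>lborel)"
proof (rule ccontr)
  assume "\<not> ?thesis"
  moreover have "0 \<le> (\<integral>x. f x \<partial>lborel)" using assms(3) by simp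
  ultimately have "(\<integral>x. f x \<partial>lborel) = 0" by linarith
  then have "AE x in lborel. f x = 0"
    using integral_nonneg_eq_0_iff_AE[OF assms(1)] assms(3) by simp
  then have "AE x in lborel. x \<notin> {x. 0 < f x}"
    by (auto elim: eventually_mono)
  moreover have o: "open {x. 0 < f x}"
    using assms(2) by (intro open_Collect_less continuous_intros) auto
  ultimately have "{x. 0 < f x} \<in> null_sets lborel"
    using AE_iff_null_sets[of "{x. 0 < f x}" lborel] borel_open[OF o] by simp
  then have "negligible {x. 0 < f x}"
    by (simp add: negligible_iff_null_sets null_sets_completionI)
  then show False using open_not_negligible[OF o] assms(4) by auto
qed

text \<open>\<open>\<partial>\<^sub>i(u\<^sup>2) = 2 u \<partial>\<^sub>i u\<close> in the weak sense. Test the weak derivative with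
  \<open>x \<mapsto> v((x + y)/2) \<eta>((x - y)/\<epsilon>)\<close>, multiply by \<open>u(y)\<close> and integrate over \<open>y\<close>: the term with
  \<open>\<partial>\<^sub>i\<eta>\<close> is antisymmetric in \<open>x\<close> and \<open>y\<close> and drops out. Then \<open>\<epsilon>\<close> tends to \<open>0\<close>.\<close>

lemma integral_square_weak_derivative:
  fixes u g :: "real^'n \<Rightarrow> real"
  assumes u: "u \<in> borel_measurable borel" "integrable lborel (\<lambda>x. (u x)\<^sup>2)"
    and g: "g \<in> borel_measurable borel" "integrable lborel (\<lambda>x. (g x)\<^sup>2)"
    and weak: "\<And>\<phi>. test_function \<phi> \<Longrightarrow>
      (\<integral>x. u x * partial_deriv i \<phi> x \<partial>lborel) = - (\<integral>x. g x * \<phi> x \<partial>lborel)"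
    and v: "test_function v"
  shows "(\<integral>x. (u x)\<^sup>2 * partial_deriv i v x \<partial>lborel) = - 2 * (\<integral>x. u x * g x * v x \<partial>lborel)"
proof -
  obtain R where v: "smooth v" and vR: "\<And>x. R < norm x \<Longrightarrow> v x = 0"
    using test_functionE[OF v] by blast
  define \<eta> :: "real^'n \<Rightarrow> real" where "\<eta> x = bump 0 (1 + (- 1) * (norm x)\<^sup>2)" for x
  have \<eta>: "smooth \<eta>" unfolding \<eta>_def by (rule smooth_bump)
  have \<eta>1: "\<eta> x = 0" if "1 < norm x" for x
    using one_le_power[OF less_imp_le[OF that], of 2] by (simp add: \<eta>_def bump_def)
  have \<eta>_even: "\<eta> (- x) = \<eta> x" for x by (simp add: \<eta>_def)
  let ?dv = "partial_deriv i v" and ?d\<eta> = "partial_deriv i \<eta>"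
  have d\<eta>_odd: "?d\<eta> (- x) = - ?d\<eta> x" for x
    using partial_deriv_affine[OF \<eta>, of i "-1" 0 x] by (simp add: \<eta>_even)
  note dv = smooth_partial_deriv[OF v, of i] and d\<eta> = smooth_partial_deriv[OF \<eta>, of i]
  note vc = smooth_continuous_on[OF v, of UNIV] and \<eta>c = smooth_continuous_on[OF \<eta>, of UNIV]
    and dvc = smooth_continuous_on[OF dv, of UNIV] and d\<eta>c = smooth_continuous_on[OF d\<eta>, of UNIV]
  have dvR: "?dv x = 0" if "R < norm x" for x
    by (rule partial_deriv_support[OF v vR that])
  have d\<eta>1: "?d\<eta> x = 0" if "1 < norm x" for x
    by (rule partial_deriv_support[OF \<eta> \<eta>1 that])
  \<comment> \<open>The claim amounts to H(0) = 0. Averages of H against \<eta>(z/\<epsilon>) vanish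
    for every \<epsilon>, and H is continuous at 0.\<close>
  define H where "H z = (1/2) * (\<integral>x. u x * u (x + z) * ?dv (x + (1/2) *\<^sub>R z) \<partial>lborel)
      + (\<integral>x. g x * u (x + z) * v (x + (1/2) *\<^sub>R z) \<partial>lborel)" for z
  have zero: "(\<integral>z. \<eta> ((1/\<epsilon>) *\<^sub>R z) * H z \<partial>lborel) = 0" "integrable lborel (\<lambda>z. \<eta> ((1/\<epsilon>) *\<^sub>R z) * H z)"
    if \<epsilon>: "0 < \<epsilon>" for \<epsilon>
  proof -
    let ?m = "\<lambda>x y. (1/2) *\<^sub>R x + (1/2) *\<^sub>R y" and ?d = "\<lambda>x y. (1/\<epsilon>) *\<^sub>R x + (- (1/\<epsilon>)) *\<^sub>R y"
    let ?L = "lborel \<Otimes>\<^sub>M lborel :: ((real^'n) \<times> (real^'n)) measure"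
    define F1 where "F1 = (\<lambda>(x, y). u x * u y * (?dv (?m x y) * \<eta> (?d x y)))"
    define F2 where "F2 = (\<lambda>(x, y). u x * u y * (v (?m x y) * ?d\<eta> (?d x y)))"
    define F3 where "F3 = (\<lambda>(x, y). g x * u y * (v (?m x y) * \<eta> (?d x y)))"
    have F1: "integrable ?L F1" unfolding F1_def
      by (rule integrable_difference_kernel[OF u u dvc dvR \<eta>c \<eta>1 \<epsilon>])
    have F2: "integrable ?L F2" unfolding F2_def
      by (rule integrable_difference_kernel[OF u u vc vR d\<eta>c d\<eta>1 \<epsilon>])
    have F3: "integrable ?L F3" unfolding F3_def
      by (rule integrable_difference_kernel[OF g u vc vR \<eta>c \<eta>1 \<epsilon>])
    have F2_swap: "F2 (y, x) = - F2 (x, y)" for x y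
    proof -
      have "?d y x = - ?d x y" by simp
      then have "?d\<eta> (?d y x) = - ?d\<eta> (?d x y)" by (simp only: d\<eta>_odd)
      moreover have "?m y x = ?m x y" by (rule add.commute)
      ultimately show ?thesis unfolding F2_def prod.case by (simp only:) simp
    qed
    have "(\<integral>(x, y). F2 (y, x) \<partial>?L) = integral\<^sup>L ?L F2"
      by (rule lborel_pair.integral_product_swap) (use F2 in auto)
    moreover have "(\<lambda>(x, y). F2 (y, x)) = (\<lambda>p. - F2 p)"
    proof
      show "(case p of (x, y) \<Rightarrow> F2 (y, x)) = - F2 p" for p
        using F2_swap[of "snd p" "fst p"] by (simp add: case_prod_unfold)
    qed
    ultimately have F2_0: "integral\<^sup>L ?L F2 = 0" by simp
    \<comment> \<open>For fixed y this is the weak identity for the product test function,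
      multiplied by u(y). The factors 1/2 and 1/\<epsilon> come from the chain rule.\<close>
    have slice: "(\<integral>x. (1/2) * F1 (x, y) + (1/\<epsilon>) * F2 (x, y) \<partial>lborel) = - (\<integral>x. F3 (x, y) \<partial>lborel)" for y
    proof -
      let ?v = "\<lambda>x. v ((1/2) *\<^sub>R x + (1/2) *\<^sub>R y)" and ?\<eta> = "\<lambda>x. \<eta> ((1/\<epsilon>) *\<^sub>R x + (- (1/\<epsilon>)) *\<^sub>R y)"
      have s: "smooth ?v" "smooth ?\<eta>" by (rule smooth_affine[OF v], rule smooth_affine[OF \<eta>])
      have pd: "partial_deriv i (\<lambda>x. ?v x * ?\<eta> x) x = (1/2) * (?dv (?m x y) * \<eta> (?d x y)) + (1/\<epsilon>) * (v (?m x y) * ?d\<eta> (?d x y))" for x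
        unfolding partial_deriv_mult[OF s] partial_deriv_affine[OF v] partial_deriv_affine[OF \<eta>] by simp
      have e1: "u y * (u x * partial_deriv i (\<lambda>x. ?v x * ?\<eta> x) x) = (1/2) * F1 (x, y) + (1/\<epsilon>) * F2 (x, y)"
        and e2: "u y * (g x * (?v x * ?\<eta> x)) = F3 (x, y)" for x
        unfolding pd F1_def F2_def F3_def prod.case by (simp_all only: distrib_left ac_simps)
      have "test_function (\<lambda>x. ?v x * ?\<eta> x)"
      proof (rule test_functionI[OF smooth_mult[OF s], of "norm y + \<epsilon>"])
        fix x :: "real^'n" assume x: "norm y + \<epsilon> < norm x"
        have "norm x \<le> norm (x - y) + norm y" by (metis diff_add_cancel norm_triangle_ineq)
        then have "\<epsilon> < norm (x - y)" using x by linarith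
        then have "1 < norm ((1/\<epsilon>) *\<^sub>R (x - y))" using \<epsilon> by simp
        then have "\<eta> ((1/\<epsilon>) *\<^sub>R (x - y)) = 0" by (rule \<eta>1)
        then show "?v x * ?\<eta> x = 0" by (simp add: algebra_simps)
      qed
      note tf = weak[OF this]
      have "(\<integral>x. u y * (u x * partial_deriv i (\<lambda>x. ?v x * ?\<eta> x) x) \<partial>lborel) = - (\<integral>x. u y * (g x * (?v x * ?\<eta> x)) \<partial>lborel)"
        unfolding integral_mult_right_zero tf by (simp only: mult_minus_right)
      then show ?thesis by (simp only: e1 e2)
    qed
    have F12: "integrable ?L (\<lambda>p. (1/2) * F1 p + (1/\<epsilon>) * F2 p)" using F1 F2 by simp
    have "(\<integral>p. (1/2) * F1 p + (1/\<epsilon>) * F2 p \<partial>?L) = (\<integral>y. (\<integral>x. (1/2) * F1 (x, y) + (1/\<epsilon>) * F2 (x, y) \<partial>lborel) \<partial>lborel)"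
      using lborel_pair.integral_snd[of "\<lambda>x y. (1/2) * F1 (x, y) + (1/\<epsilon>) * F2 (x, y)"] F12
      by (simp add: case_prod_unfold)
    also have "\<dots> = - (\<integral>y. (\<integral>x. F3 (x, y) \<partial>lborel) \<partial>lborel)"
      by (simp only: slice integral_minus)
    also have "\<dots> = - integral\<^sup>L ?L F3"
      using lborel_pair.integral_snd[of "\<lambda>x y. F3 (x, y)"] F3 by (simp add: case_prod_unfold)
    finally have sum: "(1/2) * integral\<^sup>L ?L F1 + integral\<^sup>L ?L F3 = 0"
      using F1 F2 F2_0 by simp
    have I1: "integrable lborel (\<lambda>z. \<eta> ((1/\<epsilon>) *\<^sub>R z) * (\<integral>x. u x * u (x + z) * ?dv (x + (1/2) *\<^sub>R z) \<partial>lborel))"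
      by (rule integral_difference_kernel(1)[OF u u dvc dvR \<eta>c \<eta>1 \<epsilon> \<eta>_even])
    have I1': "integral\<^sup>L ?L F1 = (\<integral>z. \<eta> ((1/\<epsilon>) *\<^sub>R z) * (\<integral>x. u x * u (x + z) * ?dv (x + (1/2) *\<^sub>R z) \<partial>lborel) \<partial>lborel)"
      unfolding F1_def by (rule integral_difference_kernel(2)[OF u u dvc dvR \<eta>c \<eta>1 \<epsilon> \<eta>_even])
    have I3: "integrable lborel (\<lambda>z. \<eta> ((1/\<epsilon>) *\<^sub>R z) * (\<integral>x. g x * u (x + z) * v (x + (1/2) *\<^sub>R z) \<partial>lborel))"
      by (rule integral_difference_kernel(1)[OF g u vc vR \<eta>c \<eta>1 \<epsilon> \<eta>_even])
    have I3': "integral\<^sup>L ?L F3 = (\<integral>z. \<eta> ((1/\<epsilon>) *\<^sub>R z) * (\<integral>x. g x * u (x + z) * v (x + (1/2) *\<^sub>R z) \<partial>lborel) \<partial>lborel)"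
      unfolding F3_def by (rule integral_difference_kernel(2)[OF g u vc vR \<eta>c \<eta>1 \<epsilon> \<eta>_even])
    have eq: "\<eta> ((1/\<epsilon>) *\<^sub>R z) * H z = (1/2) * (\<eta> ((1/\<epsilon>) *\<^sub>R z) * (\<integral>x. u x * u (x + z) * ?dv (x + (1/2) *\<^sub>R z) \<partial>lborel))
        + \<eta> ((1/\<epsilon>) *\<^sub>R z) * (\<integral>x. g x * u (x + z) * v (x + (1/2) *\<^sub>R z) \<partial>lborel)" for z
      unfolding H_def by (simp only: distrib_left mult.left_commute)
    show "integrable lborel (\<lambda>z. \<eta> ((1/\<epsilon>) *\<^sub>R z) * H z)"
      unfolding eq using I1 I3 by (intro Bochner_Integration.integrable_add integrable_mult_right)
    show "(\<integral>z. \<eta> ((1/\<epsilon>) *\<^sub>R z) * H z \<partial>lborel) = 0"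
      unfolding eq using I1 I3 sum[unfolded I1' I3'] by simp
  qed
  obtain Bv where Bv: "0 < Bv" "\<And>x. \<bar>v x\<bar> \<le> Bv" using bounded_continuous_support[OF vc vR] by blast
  obtain Bd where Bd: "0 < Bd" "\<And>x. \<bar>?dv x\<bar> \<le> Bd" using bounded_continuous_support[OF dvc dvR] by blast
  let ?H0 = "(1/2) * (\<integral>x. u x * u x * ?dv x \<partial>lborel) + (\<integral>x. g x * u x * v x \<partial>lborel)"
  have "(H \<longlongrightarrow> ?H0) (at 0)"
    unfolding H_def[abs_def]
    by (intro tendsto_intros tendsto_integral_shift[OF u u dvc Bd] tendsto_integral_shift[OF g u vc Bv])
  moreover have "H 0 = ?H0" by (simp add: H_def)
  ultimately have H: "(H \<longlongrightarrow> H 0) (at 0)" by simp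
  have "H 0 = 0"
  proof (rule ccontr)
    assume "H 0 \<noteq> 0"
    \<comment> \<open>On a small punctured ball H stays within |H(0)|/2 of H(0). Its average against
      a nonnegative \<eta>(z/\<epsilon>) of positive integral supported there could then not be
      0.\<close>
    define c where "c = \<bar>H 0\<bar> / 2"
    have c: "0 < c" using \<open>H 0 \<noteq> 0\<close> by (simp add: c_def)
    obtain \<epsilon> where \<epsilon>: "0 < \<epsilon>" "\<And>z. z \<noteq> 0 \<Longrightarrow> norm z < \<epsilon> \<Longrightarrow> \<bar>H z - H 0\<bar> < c"
      using tendstoD[OF H c] unfolding eventually_at by (auto simp: dist_real_def dist_norm)
    let ?\<eta> = "\<lambda>z. \<eta> ((1/\<epsilon>) *\<^sub>R z)"
    have \<eta>'c: "continuous_on UNIV ?\<eta>"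
      by (intro continuous_on_compose2[OF \<eta>c] continuous_intros) auto
    have \<eta>'0: "?\<eta> z = 0" if "\<epsilon> \<le> norm z" for z
    proof -
      have "1 \<le> norm ((1/\<epsilon>) *\<^sub>R z)" using that \<epsilon>(1) by simp
      then have "1 \<le> (norm ((1/\<epsilon>) *\<^sub>R z))\<^sup>2" by (rule one_le_power)
      then show ?thesis by (simp add: \<eta>_def bump_def)
    qed
    have i: "integrable lborel ?\<eta>"
      using \<eta>'c \<eta>'0 by (intro integrable_continuous_support[of _ \<epsilon>]) auto
    have pos: "0 < (\<integral>z. ?\<eta> z \<partial>lborel)"
      by (rule integral_pos_continuous[OF i \<eta>'c, of 0]) (auto simp: \<eta>_def bump_def)
    let ?d = "\<lambda>z. ?\<eta> z * H 0 - ?\<eta> z * H z"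
    have eq: "(\<integral>z. ?\<eta> z \<partial>lborel) * H 0 = (\<integral>z. ?d z \<partial>lborel)"
      using zero[OF \<epsilon>(1)] i by simp
    have d: "integrable lborel ?d"
      using zero[OF \<epsilon>(1)] i by (intro Bochner_Integration.integrable_diff integrable_mult_left)
    have "\<bar>(\<integral>z. ?\<eta> z \<partial>lborel) * H 0\<bar> \<le> (\<integral>z. \<bar>?d z\<bar> \<partial>lborel)"
      unfolding eq by (rule integral_abs_bound)
    also have "\<dots> \<le> (\<integral>z. ?\<eta> z * c \<partial>lborel)"
    proof (rule integral_mono[OF integrable_abs[OF d] integrable_mult_left[OF i]])
      fix z
      have "\<bar>H 0 - H z\<bar> \<le> c" if "norm z < \<epsilon>"
        using \<epsilon>(2)[of z] that c by (cases "z = 0") (auto simp: abs_minus_commute)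
      then have "\<bar>?\<eta> z\<bar> * \<bar>H 0 - H z\<bar> \<le> \<bar>?\<eta> z\<bar> * c"
        using \<eta>'0[of z] by (cases "norm z < \<epsilon>") (auto intro: mult_left_mono)
      moreover have "\<bar>?\<eta> z\<bar> = ?\<eta> z" by (simp add: \<eta>_def bump_nonneg)
      ultimately show "\<bar>?d z\<bar> \<le> ?\<eta> z * c"
        by (metis abs_mult right_diff_distrib)
    qed
    also have "\<dots> = (\<integral>z. ?\<eta> z \<partial>lborel) * c" by simp
    finally have "(\<integral>z. ?\<eta> z \<partial>lborel) * \<bar>H 0\<bar> \<le> (\<integral>z. ?\<eta> z \<partial>lborel) * c"
      using pos by (simp only: abs_mult abs_of_pos)
    then show False using pos c by (simp add: c_def)
  qed
  then show ?thesis by (simp add: H_def power2_eq_square mult.commute mult.left_commute)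
qed

section \<open>The inequality\<close>

text \<open>An algebra of functions on \<open>(0, \<infinity>)\<close> that contains \<open>\<rho>\<close> and is closed under differentiation.\<close>

inductive_set rho_algebra :: "nat \<Rightarrow> (real \<Rightarrow> real) set" for N where
  const: "(\<lambda>r. c) \<in> rho_algebra N"
| id: "(\<lambda>r. r) \<in> rho_algebra N"
| inverse: "inverse \<in> rho_algebra N"
| exp: "(\<lambda>r. exp (r\<^sup>2 / 2)) \<in> rho_algebra N"
| rho: "rho N \<in> rho_algebra N"
| add: "p \<in> rho_algebra N \<Longrightarrow> q \<in> rho_algebra N \<Longrightarrow> (\<lambda>r. p r + q r) \<in> rho_algebra N"
| mult: "p \<in> rho_algebra N \<Longrightarrow> q \<in> rho_algebra N \<Longrightarrow> (\<lambda>r. p r * q r) \<in> rho_algebra N"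

lemma rho_algebra_derivative:
  "p \<in> rho_algebra N \<Longrightarrow> \<exists>p'\<in>rho_algebra N. \<forall>r>0. (p has_real_derivative p' r) (at r)"
proof (induction rule: rho_algebra.induct)
  case (const c)
  show ?case by (intro bexI[of _ "\<lambda>r. 0"] rho_algebra.const) auto
next
  case id
  show ?case by (intro bexI[of _ "\<lambda>r. 1"] rho_algebra.const) auto
next
  case inverse
  show ?case
  proof (rule bexI[of _ "\<lambda>r. (- 1) * (inverse r * inverse r)"])
    show "(\<lambda>r. (- 1) * (inverse r * inverse r)) \<in> rho_algebra N"
      by (intro rho_algebra.intros)
  qed (auto intro!: derivative_eq_intros simp: power2_eq_square field_simps)
next
  case exp
  show ?case
    by (rule bexI[of _ "\<lambda>r. r * exp (r\<^sup>2 / 2)"])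
      (auto intro!: rho_algebra.intros derivative_eq_intros)
next
  case rho
  \<comment> \<open>The Riccati equation makes \<rho>' a polynomial in \<rho>, r and 1/r; this is
    what closes the algebra.\<close>
  have "(rho N has_real_derivative rho N r * (rho N r + (- 1) * (r + (real N - 1) * inverse r))) (at r)" if "0 < r" for r
    by (rule DERIV_cong[OF rho_has_derivative[OF that]]) (simp add: drift_def divide_inverse)
  then show ?case
  proof (intro bexI[of _ "\<lambda>r. rho N r * (rho N r + (- 1) * (r + (real N - 1) * inverse r))"])
    show "(\<lambda>r. rho N r * (rho N r + (- 1) * (r + (real N - 1) * inverse r))) \<in> rho_algebra N"
      by (intro rho_algebra.intros)
  qed blast
next
  case (add p q)
  then obtain p' q' where "p' \<in> rho_algebra N" "q' \<in> rho_algebra N"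
    "\<And>r. 0 < r \<Longrightarrow> (p has_real_derivative p' r) (at r)" "\<And>r. 0 < r \<Longrightarrow> (q has_real_derivative q' r) (at r)"
    by blast
  then show ?case
    by (intro bexI[of _ "\<lambda>r. p' r + q' r"]) (auto intro: rho_algebra.add DERIV_add)
next
  case (mult p q)
  then obtain p' q' where "p' \<in> rho_algebra N" "q' \<in> rho_algebra N"
    "\<And>r. 0 < r \<Longrightarrow> (p has_real_derivative p' r) (at r)" "\<And>r. 0 < r \<Longrightarrow> (q has_real_derivative q' r) (at r)"
    by blast
  then show ?case
    using mult.hyps by (intro bexI[of _ "\<lambda>r. p' r * q r + q' r * p r"])
      (auto intro: rho_algebra.intros DERIV_mult)
qed

section \<open>Smooth radial cutoffs\<close>

lemma bump_inner_zero:
  assumes \<beta>: "0 < \<beta>" and r: "0 \<le> r" "r < 1 / sqrt \<beta>"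
  shows "bump n (- 1 + \<beta> * r\<^sup>2) = 0"
proof -
  have "r * sqrt \<beta> < 1" using r \<beta> by (simp add: field_simps)
  then have "(r * sqrt \<beta>)\<^sup>2 < 1" using r \<beta> by (simp add: power_less_one_iff)
  then have "\<beta> * r\<^sup>2 < 1" using \<beta> by (simp add: power_mult_distrib mult.commute)
  then show ?thesis by (simp add: bump_def)
qed

text \<open>Members of the algebra may be singular at the origin, but the bump vanishes for |x| <
  1/sqrt \<beta>. A partial derivative is x_i times a function of the same kind, since the algebra
  is closed under differentiation and under division by r; this is the shape that
  \<open>smooth_coinduct\<close> asks for.\<close>

lemma smooth_bump_radial:
  assumes p: "p \<in> rho_algebra N" and \<beta>: "0 < \<beta>"
  shows "smooth (\<lambda>x::real^'n. bump n (- 1 + \<beta> * (norm x)\<^sup>2) * p (norm x))"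
proof -
  let ?s = "\<lambda>r::real. - 1 + \<beta> * r\<^sup>2"
  let ?X = "{\<lambda>x::real^'n. bump n (?s (norm x)) * p (norm x) | n p. p \<in> rho_algebra N}"
  note zero = bump_inner_zero[OF \<beta>]
  have "\<exists>D. (\<forall>x. (f has_derivative D x) (at x)) \<and>
      (\<forall>i. \<exists>c f'. smooth c \<and> f' \<in> ?X \<and> (\<lambda>x. D x (axis i 1)) = (\<lambda>x. c x * f' x))"
    if f: "f \<in> ?X" for f
  proof -
    obtain n p where p: "p \<in> rho_algebra N" and f: "f = (\<lambda>x. bump n (?s (norm x)) * p (norm x))"
      using f by blast
    obtain p' where p': "p' \<in> rho_algebra N" "\<And>r. 0 < r \<Longrightarrow> (p has_real_derivative p' r) (at r)"
      using rho_algebra_derivative[OF p] by blast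
    define q where "q r = (1 + (- real n) * (- 1 + \<beta> * (r * r))) * (2 * \<beta> * r) * p r
        + (- 1 + \<beta> * (r * r)) * (- 1 + \<beta> * (r * r)) * p' r" for r
    have q: "(\<lambda>r. q r * inverse r) \<in> rho_algebra N"
      unfolding q_def by (intro rho_algebra.intros p p'(1))
    have b: "bump (n + 1) t = t * bump (n + 2) t" "bump n t = t * t * bump (n + 2) t" for t
      using bump_Suc[of n t] bump_Suc[of "Suc n" t] by simp_all
    have D: "((\<lambda>r. bump n (?s r) * p r) has_real_derivative bump (n + 2) (?s r) * q r) (at r)" if "0 < r" for r
    proof -
      have "(?s has_real_derivative 2 * \<beta> * r) (at r)"
        by (auto intro!: derivative_eq_intros)
      from DERIV_mult[OF DERIV_chain2[OF bump_has_derivative this] p'(2)[OF that]]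
      have "((\<lambda>r. bump n (?s r) * p r) has_real_derivative
          (bump (n + 2) (?s r) - real n * bump (n + 1) (?s r)) * (2 * \<beta> * r) * p r + p' r * bump n (?s r)) (at r)" .
      moreover have "(bump (n + 2) (?s r) - real n * bump (n + 1) (?s r)) * (2 * \<beta> * r) * p r + p' r * bump n (?s r)
          = bump (n + 2) (?s r) * q r"
        unfolding b q_def by (simp add: algebra_simps power2_eq_square)
      ultimately show ?thesis by simp
    qed
    have rad: "(f has_derivative (\<lambda>h. (bump (n + 2) (?s (norm x)) * q (norm x)) * (x \<bullet> h) / norm x)) (at x)" for x
      unfolding f
      by (rule has_derivative_radial[of "\<lambda>r. bump n (?s r) * p r" "\<lambda>r. bump (n + 2) (?s r) * q r" "1 / sqrt \<beta>"])
        (use D zero \<beta> in \<open>auto simp: bump_def\<close>)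
    show ?thesis
    proof (intro exI conjI allI)
      show "(f has_derivative (\<lambda>h. (bump (n + 2) (?s (norm x)) * q (norm x)) * (x \<bullet> h) / norm x)) (at x)" for x
        by (rule rad)
      fix i
      show "smooth (\<lambda>x. x $ i)" by (rule smooth_nth)
      show "(\<lambda>x::real^'n. bump (n + 2) (?s (norm x)) * (q (norm x) * inverse (norm x))) \<in> ?X"
        by (rule CollectI, rule exI[of _ "n + 2"], rule exI[of _ "\<lambda>r. q r * inverse r"]) (simp add: q)
      show "(\<lambda>x. (bump (n + 2) (?s (norm x)) * q (norm x)) * (x \<bullet> axis i 1) / norm x)
          = (\<lambda>x. x $ i * (bump (n + 2) (?s (norm x)) * (q (norm x) * inverse (norm x))))"
        by (simp add: inner_axis divide_inverse ac_simps)
    qed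
  qed
  moreover have "(\<lambda>x::real^'n. bump n (?s (norm x)) * p (norm x)) \<in> ?X"
    by (rule CollectI, rule exI[of _ n], rule exI[of _ p]) (simp add: p)
  ultimately show ?thesis
    using smooth_coinduct[of "\<lambda>x::real^'n. bump n (?s (norm x)) * p (norm x)" ?X] by simp
qed

text \<open>Zero up to r = 1/sqrt \<beta>, then increasing, with limit 1 as \<beta> grows at fixed r
  > 0. It has no plateau: monotonicity and pointwise convergence are the properties
  exploited.\<close>

definition inner_cutoff :: "real \<Rightarrow> real \<Rightarrow> real" where
  "inner_cutoff \<beta> r = bump 0 (- 1 + \<beta> * r\<^sup>2)"

text \<open>The factor \<open>exp 1\<close> normalises the value at r = 0 to 1, because
  \<open>bump 0 1\<close> is e^(-1).\<close>

definition outer_cutoff :: "real \<Rightarrow> real \<Rightarrow> real" where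
  "outer_cutoff R r = exp 1 * bump 0 (1 + (- (1 / R\<^sup>2)) * r\<^sup>2)"

lemma inner_cutoff_bounds: "0 \<le> inner_cutoff \<beta> r" "inner_cutoff \<beta> r \<le> 1"
  by (simp_all add: inner_cutoff_def bump_nonneg bump_0_le_1)

lemma inner_cutoff_zero: "0 < \<beta> \<Longrightarrow> 0 \<le> r \<Longrightarrow> r < 1 / sqrt \<beta> \<Longrightarrow> inner_cutoff \<beta> r = 0"
  unfolding inner_cutoff_def by (rule bump_inner_zero)

lemma inner_cutoff_deriv:
  "(inner_cutoff \<beta> has_real_derivative bump 2 (- 1 + \<beta> * r\<^sup>2) * (2 * \<beta> * r)) (at r)"
proof -
  have "((\<lambda>r. - 1 + \<beta> * r\<^sup>2) has_real_derivative 2 * \<beta> * r) (at r)"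
    by (auto intro!: derivative_eq_intros)
  from DERIV_chain2[OF bump_has_derivative[of 0] this] show ?thesis
    by (simp add: inner_cutoff_def[abs_def] numeral_2_eq_2)
qed

lemma outer_cutoff_deriv:
  "(outer_cutoff R has_real_derivative
     exp 1 * (bump 2 (1 + (- (1 / R\<^sup>2)) * r\<^sup>2) * (2 * (- (1 / R\<^sup>2)) * r))) (at r)"
proof -
  have "((\<lambda>r. 1 + a * r\<^sup>2) has_real_derivative 2 * a * r) (at r)" for a
    by (auto intro!: derivative_eq_intros)
  from DERIV_cmult[OF DERIV_chain2[OF bump_has_derivative[of 0] this[of "- (1 / R\<^sup>2)"]], of "exp 1"] show ?thesis
    by (simp add: outer_cutoff_def[abs_def] numeral_2_eq_2)
qed

lemma outer_cutoff_bounds: "0 \<le> outer_cutoff R r" "outer_cutoff R r \<le> 1"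
proof -
  show "0 \<le> outer_cutoff R r" by (simp add: outer_cutoff_def bump_nonneg)
  let ?t = "1 + (- (1 / R\<^sup>2)) * r\<^sup>2"
  show "outer_cutoff R r \<le> 1"
  proof (cases "0 < ?t")
    case True
    have "?t \<le> 1" by simp
    then have "1 \<le> 1 / ?t" using True by (simp add: le_divide_eq)
    then have "exp (1 + (- 1 / ?t)) \<le> exp 0" by (subst exp_le_cancel_iff) simp
    then show ?thesis using True unfolding exp_add by (simp add: outer_cutoff_def bump_def)
  qed (simp add: outer_cutoff_def bump_def)
qed

lemma outer_cutoff_zero: "0 < R \<Longrightarrow> R < r \<Longrightarrow> outer_cutoff R r = 0"
proof -
  assume R: "0 < R" "R < r"
  then have "R\<^sup>2 < r\<^sup>2" by (intro power_strict_mono) auto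
  then have "1 < r\<^sup>2 / R\<^sup>2" using R by simp
  then show ?thesis by (simp add: outer_cutoff_def bump_def)
qed

text \<open>For r < R the slope is at most e times 2 (the bound of \<open>bump 2\<close>) times
  2r/R^2, hence of order 1/R; from R on it vanishes. The decay in R makes the error of the outer
  cutoff disappear in the limit.\<close>

lemma outer_cutoff_deriv_bound:
  assumes "0 < R" "0 < r"
  shows "\<bar>exp 1 * (bump 2 (1 + (- (1 / R\<^sup>2)) * r\<^sup>2) * (2 * (- (1 / R\<^sup>2)) * r))\<bar> \<le> 4 * exp 1 / R"
proof (cases "r < R")
  case True
  have "bump 2 (1 + (- (1 / R\<^sup>2)) * r\<^sup>2) * (2 * (1 / R\<^sup>2) * r) \<le> 2 * (2 * (1 / R\<^sup>2) * R)"
    using True assms by (intro mult_mono bump_2_le_2 mult_left_mono) auto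
  also have "\<dots> = 4 / R" using assms by (simp add: power2_eq_square)
  finally have "exp 1 * (bump 2 (1 + (- (1 / R\<^sup>2)) * r\<^sup>2) * (2 * (1 / R\<^sup>2) * r)) \<le> exp 1 * (4 / R)"
    by (intro mult_left_mono) auto
  then show ?thesis using assms bump_nonneg[of 2 "1 + (- (1 / R\<^sup>2)) * r\<^sup>2"]
    by (simp add: abs_mult mult.commute)
next
  case False
  then have "R\<^sup>2 \<le> r\<^sup>2" using assms by (intro power_mono) auto
  then have "1 \<le> r\<^sup>2 / R\<^sup>2" using assms by (simp add: le_divide_eq)
  moreover have eq: "1 + (- (1 / R\<^sup>2)) * r\<^sup>2 = 1 - r\<^sup>2 / R\<^sup>2" by simp
  ultimately have "bump 2 (1 + (- (1 / R\<^sup>2)) * r\<^sup>2) = 0"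
    unfolding eq bump_def by (subst if_not_P) linarith+
  then show ?thesis using assms by simp
qed

text \<open>Choosing \<open>h = \<rho> \<phi>\<close> in \<open>|\<nabla>u + h u x / (2|x|)|\<^sup>2 \<ge> 0\<close>; here \<open>c\<close>, \<open>c'\<close> are the values of the inner
  cutoff and its derivative, \<open>s\<close>, \<open>s'\<close> those of the outer one, and \<open>\<phi> = c s\<^sup>2\<close>. Since \<open>c' \<ge> 0\<close>, the inner
  cutoff costs nothing.\<close>

lemma cutoff_pointwise_bound:
  fixes \<rho> c c' s s' e k :: real
  assumes "0 \<le> \<rho>" "0 \<le> c" "c \<le> 1" "0 \<le> c'" "0 \<le> s" "s \<le> 1" "\<bar>s'\<bar> \<le> k" "0 < e"
  shows "(1/4 - e) * (\<rho>\<^sup>2 * (c * s\<^sup>2)) - k\<^sup>2 / (4 * e) \<le>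
    1/2 * (\<rho>\<^sup>2 * (c * s\<^sup>2) + \<rho> * (c' * s\<^sup>2 + 2 * c * s * s')) - 1/4 * (\<rho> * (c * s\<^sup>2))\<^sup>2"
proof -
  let ?f = "c * s\<^sup>2"
  have s2: "s\<^sup>2 \<le> 1" using assms by (simp add: power_le_one)
  have f: "0 \<le> ?f" "?f \<le> 1" using assms s2 by (auto intro: mult_le_one)
  have "?f\<^sup>2 \<le> ?f" using f by (simp add: power2_eq_square mult_left_le)
  then have 1: "(\<rho> * ?f)\<^sup>2 \<le> \<rho>\<^sup>2 * ?f"
    unfolding power_mult_distrib[of \<rho>] by (intro mult_left_mono) auto
  have 2: "0 \<le> \<rho> * (c' * s\<^sup>2)" using assms by simp
  \<comment> \<open>Young's inequality: the cross term with s' is split into a share e of the main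
    term and a remainder of order k^2/e.\<close>
  have "0 \<le> (2 * e * (\<rho> * c * s) - \<bar>s'\<bar>)\<^sup>2 / (4 * e)" using assms by simp
  also have "\<dots> = e * (\<rho> * c * s)\<^sup>2 - \<rho> * c * s * \<bar>s'\<bar> + \<bar>s'\<bar>\<^sup>2 / (4 * e)"
    using assms by (simp add: power2_diff field_simps power2_eq_square)
  finally have "\<rho> * c * s * \<bar>s'\<bar> \<le> e * (\<rho> * c * s)\<^sup>2 + \<bar>s'\<bar>\<^sup>2 / (4 * e)" by simp
  moreover have "\<bar>s'\<bar>\<^sup>2 / (4 * e) \<le> k\<^sup>2 / (4 * e)"
    using assms by (intro divide_right_mono power_mono) auto
  moreover have "e * (\<rho> * c * s)\<^sup>2 \<le> e * (\<rho>\<^sup>2 * ?f)"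
  proof (intro mult_left_mono)
    have "c\<^sup>2 \<le> c" using assms by (simp add: power2_eq_square mult_left_le)
    then have "\<rho>\<^sup>2 * (c\<^sup>2 * s\<^sup>2) \<le> \<rho>\<^sup>2 * (c * s\<^sup>2)" by (intro mult_left_mono mult_right_mono) auto
    then show "(\<rho> * c * s)\<^sup>2 \<le> \<rho>\<^sup>2 * ?f" by (simp add: power_mult_distrib)
  qed (use assms in simp)
  moreover have "- (\<rho> * c * s * \<bar>s'\<bar>) \<le> \<rho> * c * s * s'"
    using assms by (simp add: abs_real_def)
  ultimately show ?thesis using 1 2 by (simp add: algebra_simps)
qed

lemma smooth_cutoff:
  assumes "p \<in> rho_algebra N" "0 < \<beta>"
  shows "smooth (\<lambda>x::real^'n. inner_cutoff \<beta> (norm x) * p (norm x) * (outer_cutoff R (norm x))\<^sup>2)"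
proof -
  have o: "smooth (\<lambda>x::real^'n. outer_cutoff R (norm x))"
    unfolding outer_cutoff_def by (rule smooth_mult[OF smooth_const smooth_bump])
  have "smooth (\<lambda>x::real^'n. inner_cutoff \<beta> (norm x) * p (norm x))"
    unfolding inner_cutoff_def by (rule smooth_bump_radial[OF assms])
  from smooth_mult[OF this smooth_mult[OF o o]] show ?thesis
    unfolding power2_eq_square .
qed

text \<open>The cutoffs cost e in the constant and a remainder of order 1/(R^2 e) times the weighted
  mass of u. With e = 1/R both losses vanish as R grows. The weight E is written into the integrands
  because weak gradients refer to Lebesgue measure.\<close>

lemma hardy_cutoff:
  fixes u :: "real^'n \<Rightarrow> real" and g :: "'n \<Rightarrow> real^'n \<Rightarrow> real"
  defines "E \<equiv> \<lambda>x::real^'n. exp ((norm x)\<^sup>2 / 2)"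
  assumes u [measurable]: "u \<in> borel_measurable borel" and uE: "integrable lborel (\<lambda>x. (u x)\<^sup>2 * E x)"
    and g [measurable]: "\<And>i. g i \<in> borel_measurable borel" and gE: "\<And>i. integrable lborel (\<lambda>x. (g i x)\<^sup>2 * E x)"
    and weak: "\<And>i \<phi>. test_function \<phi> \<Longrightarrow>
      (\<integral>x. u x * partial_deriv i \<phi> x \<partial>lborel) = - (\<integral>x. g i x * \<phi> x \<partial>lborel)"
    and \<beta>: "0 < \<beta>" and R: "0 < R" and e: "0 < e"
  defines "T \<equiv> \<lambda>x. inner_cutoff \<beta> (norm x) *
    (rho CARD('n) (norm x) * rho CARD('n) (norm x) * exp ((norm x)\<^sup>2 / 2)) * (outer_cutoff R (norm x))\<^sup>2"
  shows "continuous_on UNIV T" "integrable lborel (\<lambda>x. (u x)\<^sup>2 * T x)"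
    and "(1/4 - e) * (\<integral>x. (u x)\<^sup>2 * T x \<partial>lborel) \<le>
      (\<Sum>i\<in>UNIV. \<integral>x. (g i x)\<^sup>2 * E x \<partial>lborel) + (4 * exp 1 / R)\<^sup>2 / (4 * e) * (\<integral>x. (u x)\<^sup>2 * E x \<partial>lborel)"
proof -
  define N where "N = CARD('n)"
  have E1: "1 \<le> E x" for x by (simp add: E_def)
  have E_cont: "continuous_on UNIV E" unfolding E_def by (intro continuous_intros) auto
  then have [measurable]: "E \<in> borel_measurable borel" by (rule borel_measurable_continuous_onI)
  have le: "f\<^sup>2 \<le> f\<^sup>2 * E x" for f x using mult_left_mono[OF E1, of "f\<^sup>2" x] by simp
  have u2: "integrable lborel (\<lambda>x. (u x)\<^sup>2)"
    using uE by (rule Bochner_Integration.integrable_bound) (use le in \<open>auto simp: E_def\<close>)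
  have g2: "integrable lborel (\<lambda>x. (g i x)\<^sup>2)" for i
    using gE[of i] by (rule Bochner_Integration.integrable_bound) (use le in \<open>auto simp: E_def\<close>)
  let ?c = "inner_cutoff \<beta>" and ?s = "outer_cutoff R"
  let ?c' = "\<lambda>r. bump 2 (- 1 + \<beta> * r\<^sup>2) * (2 * \<beta> * r)"
  let ?s' = "\<lambda>r. exp 1 * (bump 2 (1 + (- (1 / R\<^sup>2)) * r\<^sup>2) * (2 * (- (1 / R\<^sup>2)) * r))"
  have "smooth T"
    unfolding T_def by (intro smooth_cutoff[where N="CARD('n)"] rho_algebra.intros \<beta>)
  then show T_cont: "continuous_on UNIV T" by (rule smooth_continuous_on)
  then have [measurable]: "T \<in> borel_measurable borel" by (rule borel_measurable_continuous_onI)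
  obtain BT where BT: "\<And>x. \<bar>T x\<bar> \<le> BT"
    by (rule bounded_continuous_support[OF T_cont, of R]) (use R in \<open>auto simp: T_def outer_cutoff_zero\<close>)
  show uT: "integrable lborel (\<lambda>x. (u x)\<^sup>2 * T x)"
    by (rule integrable_mult_bounded[OF u2 _ BT]) measurable
  \<comment> \<open>The outer cutoff enters squared, so that its contribution 2 c s s' to the
    derivative keeps a factor s that can be absorbed by the main term.\<close>
  define \<phi> where "\<phi> r = ?c r * (?s r)\<^sup>2" for r
  define \<phi>' where "\<phi>' r = ?c' r * (?s r)\<^sup>2 + 2 * ?c r * ?s r * ?s' r" for r
  have \<phi>: "(\<phi> has_real_derivative \<phi>' r) (at r)" for r
    unfolding \<phi>_def[abs_def] \<phi>'_def
    by (rule DERIV_cong[OF DERIV_mult[OF inner_cutoff_deriv DERIV_power[OF outer_cutoff_deriv]]])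
      (simp add: numeral_2_eq_2)
  define h where "h r = rho N r * \<phi> r" for r
  define h' where "h' r = rho N r * (rho N r - drift N r) * \<phi> r + \<phi>' r * rho N r" for r
  have h: "(h has_real_derivative h' r) (at r)" if "0 < r" for r
    unfolding h_def[abs_def] h'_def by (rule DERIV_mult[OF rho_has_derivative[OF that] \<phi>])
  \<comment> \<open>The field V = G(|x|) x is h(|x|) x/|x| times the weight E. Its plain divergence
    is therefore E times the weighted one, in which \<open>drift\<close> cancels by the Riccati
    equation.\<close>
  define G where "G r = h r * (exp (r\<^sup>2 / 2) * inverse r)" for r
  define G' where "G' r = h' r * (exp (r\<^sup>2 / 2) * inverse r) +
      (exp (r\<^sup>2 / 2) * r * inverse r + exp (r\<^sup>2 / 2) * (- (inverse r * inverse r))) * h r" for r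
  have G: "(G has_real_derivative G' r) (at r)" if "0 < r" for r
  proof -
    have "((\<lambda>r. exp (r\<^sup>2 / 2) * inverse r) has_real_derivative
        exp (r\<^sup>2 / 2) * r * inverse r + exp (r\<^sup>2 / 2) * (- (inverse r * inverse r))) (at r)"
      using that by (auto intro!: derivative_eq_intros)
    from DERIV_mult[OF h[OF that] this] show ?thesis
      unfolding G_def[abs_def] G'_def .
  qed
  have zero: "\<phi> r = 0" if "0 \<le> r" "r < 1 / sqrt \<beta>" for r
    using that \<beta> by (simp add: \<phi>_def inner_cutoff_zero)
  have \<phi>'0: "\<phi>' 0 = 0" by (simp add: \<phi>'_def)
  have \<phi>0: "\<phi> 0 = 0" using zero[of 0] \<beta> by simp
  define V where "V i x = x $ i * G (norm x)" for i and x :: "real^'n"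
  have "smooth (V i)" for i
  proof -
    have "V i = (\<lambda>x. x $ i * (?c (norm x) * (rho N (norm x) * (exp ((norm x)\<^sup>2 / 2) * inverse (norm x))) * (?s (norm x))\<^sup>2))"
      by (auto simp: V_def G_def h_def \<phi>_def)
    then show ?thesis
      using smooth_mult[OF smooth_nth smooth_cutoff[OF _ \<beta>, of "\<lambda>r. rho N r * (exp (r\<^sup>2 / 2) * inverse r)" N R]]
      by (simp add: rho_algebra.intros)
  qed
  moreover have V0: "V i x = 0" if "R < norm x" for i x
    using that R by (simp add: V_def G_def h_def \<phi>_def outer_cutoff_zero)
  ultimately have V: "test_function (V i)" and V_smooth: "smooth (V i)" for i
    using test_functionI[of "V i" R] by auto
  have pV: "partial_deriv i (V i) x = x $ i * x $ i * (G' (norm x) / norm x) + G (norm x)" for i x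
  proof -
    have "((\<lambda>x. x $ i) has_derivative (\<lambda>h. h $ i)) (at x)"
      by (intro bounded_linear_imp_has_derivative bounded_linear_vec_nth)
    moreover have "((\<lambda>x. G (norm x)) has_derivative (\<lambda>h. G' (norm x) * (x \<bullet> h) / norm x)) (at x)"
      by (rule has_derivative_radial[of G G' "1 / sqrt \<beta>"])
        (use G zero \<beta> \<phi>'0 \<phi>0 in \<open>auto simp: G_def G'_def h_def h'_def\<close>)
    ultimately have "(V i has_derivative (\<lambda>h. x $ i * (G' (norm x) * (x \<bullet> h) / norm x) + h $ i * G (norm x))) (at x)"
      unfolding V_def[abs_def] by (rule has_derivative_mult)
    from partial_deriv_eq[OF this, of i] show ?thesis by (simp add: inner_axis ac_simps)
  qed
  have div: "(\<Sum>i\<in>UNIV. partial_deriv i (V i) x) =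
      E x * ((rho N (norm x))\<^sup>2 * \<phi> (norm x) + rho N (norm x) * \<phi>' (norm x))" if "x \<noteq> 0" for x
  proof -
    let ?r = "norm x"
    have r: "0 < ?r" using that by simp
    have "(\<Sum>i\<in>UNIV. partial_deriv i (V i) x) = ?r\<^sup>2 * (G' ?r / ?r) + real N * G ?r"
      unfolding pV by (simp only: sum.distrib sum_distrib_right[symmetric] sum_nth_square) (simp add: N_def)
    also have "\<dots> = ?r * G' ?r + real N * G ?r"
      using r by (simp add: power2_eq_square)
    also have "\<dots> = E x * (h' ?r + (?r + (real N - 1) / ?r) * h ?r)"
      using r unfolding G_def G'_def E_def by (simp add: field_simps)
    also have "h' ?r + (?r + (real N - 1) / ?r) * h ?r = (rho N ?r)\<^sup>2 * \<phi> ?r + rho N ?r * \<phi>' ?r"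
      unfolding h_def h'_def drift_def by (simp add: algebra_simps power2_eq_square)
    finally show ?thesis .
  qed
  \<comment> \<open>A null term: by \<open>integral_square_weak_derivative\<close> its integral is
    0. Adding it performs the integration by parts, so that all remaining estimates are
    pointwise.\<close>
  define P where "P i x = u x * g i x * V i x + 1/2 * ((u x)\<^sup>2 * partial_deriv i (V i) x)" for i x
  have P: "integrable lborel (P i)" "(\<integral>x. P i x \<partial>lborel) = 0" for i
  proof -
    have Vc: "continuous_on UNIV (V i)" "continuous_on UNIV (partial_deriv i (V i))"
      using V_smooth[of i] by (auto intro: smooth_continuous_on smooth_partial_deriv)
    then have [measurable]: "V i \<in> borel_measurable borel" "partial_deriv i (V i) \<in> borel_measurable borel"
      by (auto intro: borel_measurable_continuous_onI)
    obtain B1 where "\<And>x. \<bar>V i x\<bar> \<le> B1"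
      by (rule bounded_continuous_support[OF Vc(1), of R]) (auto simp: V0)
    then have i1: "integrable lborel (\<lambda>x. u x * g i x * V i x)"
      by (intro integrable_mult_bounded[where B=B1] integrable_square_mult u2 g2) auto
    obtain B2 where "\<And>x. \<bar>partial_deriv i (V i) x\<bar> \<le> B2"
      by (rule bounded_continuous_support[OF Vc(2), of R])
        (auto intro: partial_deriv_support[OF V_smooth V0])
    then have i2: "integrable lborel (\<lambda>x. (u x)\<^sup>2 * partial_deriv i (V i) x)"
      by (intro integrable_mult_bounded[where B=B2] u2) auto
    show "integrable lborel (P i)"
      unfolding P_def[abs_def] using i1 i2 by simp
    show "(\<integral>x. P i x \<partial>lborel) = 0"
      using integral_square_weak_derivative[of u "g i" i "V i", OF u u2 g g2 weak V] i1 i2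
      by (simp add: P_def)
  qed
  let ?K = "(4 * exp 1 / R)\<^sup>2 / (4 * e)"
  \<comment> \<open>For x away from 0 this is E |g + h u x/(2|x|)|^2 >= 0 expanded, with the u^2
    terms estimated by \<open>cutoff_pointwise_bound\<close>. At x = 0 the cutoff removes V and
    T.\<close>
  have nonneg: "0 \<le> (\<Sum>i\<in>UNIV. (g i x)\<^sup>2 * E x) + (\<Sum>i\<in>UNIV. P i x) - (1/4 - e) * ((u x)\<^sup>2 * T x) + ?K * ((u x)\<^sup>2 * E x)" for x
  proof (cases "x = 0")
    case True
    have "P i x = 0" for i
      using True \<phi>0 by (simp add: P_def pV V_def G_def h_def)
    moreover have "T x = 0"
      using True \<beta> by (simp add: T_def inner_cutoff_zero)
    ultimately show ?thesis
      using e E1[of x] by (simp add: sum_nonneg)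
  next
    case False
    let ?r = "norm x"
    have r: "0 < ?r" using False by simp
    let ?h = "h ?r"
    have E0: "0 \<le> E x" using E1[of x] by linarith
    have "0 \<le> E x * (\<Sum>i\<in>UNIV. (g i x + 1/2 * u x * ?h * (x $ i / ?r))\<^sup>2)"
      using E0 by (intro mult_nonneg_nonneg sum_nonneg) auto
    also have "(\<Sum>i\<in>UNIV. (g i x + 1/2 * u x * ?h * (x $ i / ?r))\<^sup>2)
        = (\<Sum>i\<in>UNIV. (g i x)\<^sup>2 + u x * g i x * (x $ i * (?h / ?r)) + x $ i * x $ i * (1/4 * (u x)\<^sup>2 * ?h\<^sup>2 / ?r\<^sup>2))"
      by (intro sum.cong) (auto simp: power2_eq_square algebra_simps add_divide_distrib)
    also have "\<dots> = (\<Sum>i\<in>UNIV. (g i x)\<^sup>2) + (\<Sum>i\<in>UNIV. u x * g i x * (x $ i * (?h / ?r))) + 1/4 * (u x)\<^sup>2 * ?h\<^sup>2"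
      using r by (simp only: sum.distrib sum_distrib_right[symmetric] sum_nth_square) simp
    finally have 1: "0 \<le> E x * (\<Sum>i\<in>UNIV. (g i x)\<^sup>2) + E x * (\<Sum>i\<in>UNIV. u x * g i x * (x $ i * (?h / ?r)))
        + (u x)\<^sup>2 * E x * (1/4 * ?h\<^sup>2)"
      by (simp add: distrib_left ac_simps)
    have Vx: "E x * (\<Sum>i\<in>UNIV. u x * g i x * (x $ i * (?h / ?r))) = (\<Sum>i\<in>UNIV. u x * g i x * V i x)"
      unfolding sum_distrib_left
      by (rule sum.cong) (simp_all only: V_def G_def E_def divide_inverse ac_simps)
    have "(1/4 - e) * ((rho N ?r)\<^sup>2 * \<phi> ?r) - ?K \<le>
        1/2 * ((rho N ?r)\<^sup>2 * \<phi> ?r + rho N ?r * \<phi>' ?r) - 1/4 * ?h\<^sup>2"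
      unfolding \<phi>_def \<phi>'_def h_def
    proof (rule cutoff_pointwise_bound)
      show "\<bar>?s' ?r\<bar> \<le> 4 * exp 1 / R" by (rule outer_cutoff_deriv_bound[OF R r])
      show "0 \<le> ?c' ?r" using \<beta> by (simp add: bump_nonneg)
    qed (use e rho_pos[OF r, of N] in \<open>auto simp: inner_cutoff_bounds outer_cutoff_bounds\<close>)
    then have "1/4 * ?h\<^sup>2 \<le> 1/2 * ((rho N ?r)\<^sup>2 * \<phi> ?r + rho N ?r * \<phi>' ?r) - (1/4 - e) * ((rho N ?r)\<^sup>2 * \<phi> ?r) + ?K"
      by linarith
    then have "(u x)\<^sup>2 * E x * (1/4 * ?h\<^sup>2) \<le> (u x)\<^sup>2 * E x *
        (1/2 * ((rho N ?r)\<^sup>2 * \<phi> ?r + rho N ?r * \<phi>' ?r) - (1/4 - e) * ((rho N ?r)\<^sup>2 * \<phi> ?r) + ?K)"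
      by (rule mult_left_mono) (use E0 in simp)
    also have "\<dots> = 1/2 * ((u x)\<^sup>2 * (\<Sum>i\<in>UNIV. partial_deriv i (V i) x)) - (1/4 - e) * ((u x)\<^sup>2 * T x) + ?K * ((u x)\<^sup>2 * E x)"
    proof -
      have "T x = E x * ((rho N ?r)\<^sup>2 * \<phi> ?r)"
        by (simp add: T_def E_def N_def \<phi>_def power2_eq_square)
      then show ?thesis unfolding div[OF False] by (simp only:) (simp add: algebra_simps)
    qed
    finally have 2: "(u x)\<^sup>2 * E x * (1/4 * ?h\<^sup>2) \<le> 1/2 * ((u x)\<^sup>2 * (\<Sum>i\<in>UNIV. partial_deriv i (V i) x))
        - (1/4 - e) * ((u x)\<^sup>2 * T x) + ?K * ((u x)\<^sup>2 * E x)" .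
    have 3: "(\<Sum>i\<in>UNIV. P i x) = (\<Sum>i\<in>UNIV. u x * g i x * V i x) + 1/2 * ((u x)\<^sup>2 * (\<Sum>i\<in>UNIV. partial_deriv i (V i) x))"
      unfolding P_def sum.distrib by (simp only: sum_distrib_left)
    have 4: "(\<Sum>i\<in>UNIV. (g i x)\<^sup>2 * E x) = E x * (\<Sum>i\<in>UNIV. (g i x)\<^sup>2)"
      by (simp add: sum_distrib_left mult.commute)
    show ?thesis using 1 2 unfolding 3 4 Vx by linarith
  qed
  have iS: "integrable lborel (\<lambda>x. \<Sum>i\<in>UNIV. (g i x)\<^sup>2 * E x)" "integrable lborel (\<lambda>x. \<Sum>i\<in>UNIV. P i x)"
    using gE P(1) by (auto intro: Bochner_Integration.integrable_sum)
  have "0 \<le> (\<integral>x. (\<Sum>i\<in>UNIV. (g i x)\<^sup>2 * E x) + (\<Sum>i\<in>UNIV. P i x) - (1/4 - e) * ((u x)\<^sup>2 * T x) + ?K * ((u x)\<^sup>2 * E x) \<partial>lborel)"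
    by (rule Bochner_Integration.integral_nonneg[OF nonneg])
  also have "\<dots> = (\<integral>x. (\<Sum>i\<in>UNIV. (g i x)\<^sup>2 * E x) \<partial>lborel) + (\<integral>x. (\<Sum>i\<in>UNIV. P i x) \<partial>lborel)
      - (1/4 - e) * (\<integral>x. (u x)\<^sup>2 * T x \<partial>lborel) + ?K * (\<integral>x. (u x)\<^sup>2 * E x \<partial>lborel)"
    using iS uT uE by simp
  also have "(\<integral>x. (\<Sum>i\<in>UNIV. P i x) \<partial>lborel) = 0"
    using P by (simp add: Bochner_Integration.integral_sum)
  also have "(\<integral>x. (\<Sum>i\<in>UNIV. (g i x)\<^sup>2 * E x) \<partial>lborel) = (\<Sum>i\<in>UNIV. \<integral>x. (g i x)\<^sup>2 * E x \<partial>lborel)"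
    using gE by (simp add: Bochner_Integration.integral_sum)
  finally show "(1/4 - e) * (\<integral>x. (u x)\<^sup>2 * T x \<partial>lborel) \<le>
      (\<Sum>i\<in>UNIV. \<integral>x. (g i x)\<^sup>2 * E x \<partial>lborel) + ?K * (\<integral>x. (u x)\<^sup>2 * E x \<partial>lborel)"
    by simp
qed

lemma rho_borel_measurable [measurable]:
  "(\<lambda>x::'a::euclidean_space. rho N (norm x)) \<in> borel_measurable borel"
proof (rule borel_measurable_continuous_countable_exceptions[of "{0}"])
  have "continuous_on {0<..} (rho N)"
    by (rule rho_continuous_on)
  then show "continuous_on (- {0}) (\<lambda>x::'a. rho N (norm x))"
    by (rule continuous_on_compose2) (auto intro!: continuous_intros)
qed simp

lemma rho_trunc_borel_measurable [measurable]:
  "(\<lambda>x::'a::euclidean_space. rho_trunc N (norm x)) \<in> borel_measurable borel"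
  unfolding rho_trunc_def by measurable

lemma bump_0_tendsto_1: "(bump 0 \<longlongrightarrow> 1) at_top"
proof -
  have "((\<lambda>t::real. exp (- 1 / t)) \<longlongrightarrow> 1) at_top" by real_asymp
  then show ?thesis
  proof (rule Lim_transform_eventually)
    show "\<forall>\<^sub>F t::real in at_top. exp (- 1 / t) = bump 0 t"
      using eventually_gt_at_top[of 0] by eventually_elim (simp add: bump_def)
  qed
qed

lemma inner_cutoff_tendsto:
  assumes "0 < r" shows "(\<lambda>n. inner_cutoff (real n + 5) r) \<longlonglongrightarrow> 1"
  unfolding inner_cutoff_def
proof (rule filterlim_compose[OF bump_0_tendsto_1])
  show "filterlim (\<lambda>n. - 1 + (real n + 5) * r\<^sup>2) at_top sequentially"
    using assms by real_asymp
qed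

lemma outer_cutoff_tendsto: "(\<lambda>n. outer_cutoff (real n + 5) r) \<longlonglongrightarrow> 1"
proof -
  have "(\<lambda>n. 1 + (- (1 / (real n + 5)\<^sup>2)) * r\<^sup>2) \<longlonglongrightarrow> 1"
    by real_asymp
  then have "(\<lambda>n. bump 0 (1 + (- (1 / (real n + 5)\<^sup>2)) * r\<^sup>2)) \<longlonglongrightarrow> bump 0 1"
    using isCont_tendsto_compose[OF DERIV_isCont[OF bump_has_derivative]] by blast
  from tendsto_mult[OF tendsto_const[of "exp 1"] this] show ?thesis
    by (simp add: outer_cutoff_def bump_def exp_minus)
qed

text \<open>All parameters are tied to one index: \<beta> = R = n + 5 and e = 1/(n + 5). The limit
  is taken by Fatou's lemma with values in [0, \<infinity>], since finiteness of the left-hand side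
  is part of what is being shown.\<close>

lemma hardy_rho:
  fixes u :: "real^'n \<Rightarrow> real" and g :: "'n \<Rightarrow> real^'n \<Rightarrow> real"
  defines "E \<equiv> \<lambda>x::real^'n. exp ((norm x)\<^sup>2 / 2)"
  assumes u [measurable]: "u \<in> borel_measurable borel" and uE: "integrable lborel (\<lambda>x. (u x)\<^sup>2 * E x)"
    and g [measurable]: "\<And>i. g i \<in> borel_measurable borel" and gE: "\<And>i. integrable lborel (\<lambda>x. (g i x)\<^sup>2 * E x)"
    and weak: "\<And>i \<phi>. test_function \<phi> \<Longrightarrow>
      (\<integral>x. u x * partial_deriv i \<phi> x \<partial>lborel) = - (\<integral>x. g i x * \<phi> x \<partial>lborel)"
  shows "(\<integral>\<^sup>+x. ennreal (1/4 * ((u x)\<^sup>2 * (rho CARD('n) (norm x))\<^sup>2 * E x)) \<partial>lborel) \<le>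
    ennreal (\<Sum>i\<in>UNIV. \<integral>x. (g i x)\<^sup>2 * E x \<partial>lborel)"
proof -
  let ?N = "CARD('n)"
  define T where "T n x = inner_cutoff (real n + 5) (norm x) *
    (rho ?N (norm x) * rho ?N (norm x) * exp ((norm x)\<^sup>2 / 2)) * (outer_cutoff (real n + 5) (norm x))\<^sup>2" for n and x :: "real^'n"
  define A where "A = (\<Sum>i\<in>UNIV. \<integral>x. (g i x)\<^sup>2 * E x \<partial>lborel)"
  define B where "B = (\<integral>x. (u x)\<^sup>2 * E x \<partial>lborel)"
  define f where "f n x = (1/4 - 1 / (real n + 5)) * ((u x)\<^sup>2 * T n x)" for n x
  \<comment> \<open>The offset 5 keeps e = 1/(n + 5) below 1/4 from n = 0 on.\<close>
  have coef: "0 \<le> 1/4 - 1 / (real n + 5)" for n by (simp add: field_simps)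
  have T_cont: "continuous_on UNIV (T n)" for n
    unfolding T_def by (rule hardy_cutoff(1)[where e=1, OF u uE[unfolded E_def] g gE[unfolded E_def] weak]) auto
  then have [measurable]: "T n \<in> borel_measurable borel" for n by (rule borel_measurable_continuous_onI)
  have uT: "integrable lborel (\<lambda>x. (u x)\<^sup>2 * T n x)" for n
    unfolding T_def by (rule hardy_cutoff(2)[where e=1, OF u uE[unfolded E_def] g gE[unfolded E_def] weak]) auto
  have main: "(1/4 - 1 / (real n + 5)) * (\<integral>x. (u x)\<^sup>2 * T n x \<partial>lborel) \<le>
      A + (4 * exp 1 / (real n + 5))\<^sup>2 / (4 * (1 / (real n + 5))) * B" for n
    unfolding T_def A_def B_def E_def
    by (rule hardy_cutoff(3)[OF u uE[unfolded E_def] g gE[unfolded E_def] weak]) auto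
  have T0: "0 \<le> T n x" for n x
    unfolding T_def
    by (rule mult_nonneg_nonneg[OF mult_nonneg_nonneg[OF inner_cutoff_bounds(1)
            mult_nonneg_nonneg[OF zero_le_square]]]) auto
  have int: "(\<integral>\<^sup>+x. ennreal (f n x) \<partial>lborel) \<le> ennreal (A + (4 * exp 1 / (real n + 5))\<^sup>2 / (4 * (1 / (real n + 5))) * B)" for n
  proof -
    have "(\<integral>\<^sup>+x. ennreal (f n x) \<partial>lborel) = ennreal (\<integral>x. f n x \<partial>lborel)"
      unfolding f_def using uT coef T0 by (intro nn_integral_eq_integral) auto
    also have "\<dots> \<le> ennreal (A + (4 * exp 1 / (real n + 5))\<^sup>2 / (4 * (1 / (real n + 5))) * B)"
      using main[of n] unfolding f_def by (intro ennreal_leI) simp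
    finally show ?thesis .
  qed
  have lim: "(\<lambda>n. ennreal (f n x)) \<longlonglongrightarrow> ennreal (1/4 * ((u x)\<^sup>2 * (rho ?N (norm x))\<^sup>2 * E x))" if "x \<noteq> 0" for x
  proof -
    have "(\<lambda>n. 1/4 - 1 / (real n + 5)) \<longlonglongrightarrow> 1/4" by real_asymp
    moreover have "(\<lambda>n. T n x) \<longlonglongrightarrow> 1 * (rho ?N (norm x) * rho ?N (norm x) * exp ((norm x)\<^sup>2 / 2)) * 1\<^sup>2"
      unfolding T_def using that by (intro tendsto_intros inner_cutoff_tendsto outer_cutoff_tendsto) auto
    ultimately have "(\<lambda>n. f n x) \<longlonglongrightarrow> 1/4 * ((u x)\<^sup>2 * (1 * (rho ?N (norm x) * rho ?N (norm x) * exp ((norm x)\<^sup>2 / 2)) * 1\<^sup>2))"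
      unfolding f_def by (intro tendsto_intros)
    also have "1/4 * ((u x)\<^sup>2 * (1 * (rho ?N (norm x) * rho ?N (norm x) * exp ((norm x)\<^sup>2 / 2)) * 1\<^sup>2)) =
        1/4 * ((u x)\<^sup>2 * (rho ?N (norm x))\<^sup>2 * E x)"
      by (simp add: E_def power2_eq_square)
    finally show ?thesis by (rule tendsto_ennrealI)
  qed
  have "(\<integral>\<^sup>+x. ennreal (1/4 * ((u x)\<^sup>2 * (rho ?N (norm x))\<^sup>2 * E x)) \<partial>lborel) \<le>
      (\<integral>\<^sup>+x. liminf (\<lambda>n. ennreal (f n x)) \<partial>lborel)"
  proof (rule nn_integral_mono_AE)
    show "AE x in lborel. ennreal (1/4 * ((u x)\<^sup>2 * (rho ?N (norm x))\<^sup>2 * E x)) \<le> liminf (\<lambda>n. ennreal (f n x))"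
      using AE_lborel_singleton[of 0]
    proof eventually_elim
      case (elim x)
      then show ?case using lim_imp_Liminf[OF _ lim[OF elim]] by simp
    qed
  qed
  also have "\<dots> \<le> liminf (\<lambda>n. \<integral>\<^sup>+x. ennreal (f n x) \<partial>lborel)"
    unfolding f_def by (rule nn_integral_liminf) measurable
  also have "\<dots> \<le> liminf (\<lambda>n. ennreal (A + (4 * exp 1 / (real n + 5))\<^sup>2 / (4 * (1 / (real n + 5))) * B))"
    by (intro Liminf_mono always_eventually allI int)
  also have "\<dots> = ennreal A"
  proof -
    have "(\<lambda>n. (4 * exp 1 / (real n + 5))\<^sup>2 / (4 * (1 / (real n + 5)))) \<longlonglongrightarrow> 0" by real_asymp
    then have "(\<lambda>n. A + (4 * exp 1 / (real n + 5))\<^sup>2 / (4 * (1 / (real n + 5))) * B) \<longlonglongrightarrow> A + 0 * B"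
      by (intro tendsto_intros)
    then have "(\<lambda>n. ennreal (A + (4 * exp 1 / (real n + 5))\<^sup>2 / (4 * (1 / (real n + 5))) * B)) \<longlonglongrightarrow> ennreal A"
      by (intro tendsto_ennrealI) simp
    then show ?thesis by (intro lim_imp_Liminf) auto
  qed
  finally show ?thesis by (simp add: A_def)
qed

section \<open>Transfer to Lebesgue measurable functions and to the weighted measure\<close>

lemma locally_integrable_measurable:
  fixes f :: "real^'n \<Rightarrow> 'b::{banach, second_countable_topology}"
  assumes "locally_integrable f"
  shows "f \<in> borel_measurable lebesgue"
proof (rule borel_measurable_LIMSEQ_metric[where f="\<lambda>n x. indicator (cball 0 (real n)) x *\<^sub>R f x"])
  show "(\<lambda>x. indicator (cball 0 (real n)) x *\<^sub>R f x) \<in> borel_measurable lebesgue" for n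
  proof -
    have "set_integrable lebesgue (cball 0 (real n)) f"
      by (rule assms[unfolded locally_integrable_def, rule_format, OF compact_cball])
    then show ?thesis unfolding set_integrable_def by (rule borel_measurable_integrable)
  qed
  show "(\<lambda>n. indicator (cball 0 (real n)) x *\<^sub>R f x) \<longlonglongrightarrow> f x" for x
  proof (rule tendsto_eventually)
    obtain m :: nat where "norm x \<le> real m" using real_arch_simple by blast
    then show "\<forall>\<^sub>F n in sequentially. indicator (cball 0 (real n)) x *\<^sub>R f x = f x"
      by (intro eventually_sequentiallyI[of m]) simp
  qed
qed

lemma nn_integral_gauss_measure:
  fixes f :: "real^'n \<Rightarrow> ennreal"
  assumes "f \<in> borel_measurable lebesgue"
  shows "(\<integral>\<^sup>+x. f x \<partial>gauss_measure) = (\<integral>\<^sup>+x. ennreal (exp ((norm x)\<^sup>2 / 2)) * f x \<partial>lborel)"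
proof -
  have "(\<lambda>x::real^'n. ennreal (exp ((norm x)\<^sup>2 / 2))) \<in> borel_measurable lebesgue"
    by (rule measurable_completion) simp
  then show ?thesis
    unfolding gauss_measure_def using assms by (simp add: nn_integral_density nn_integral_completion)
qed

lemma integrable_gauss_measure:
  fixes f :: "real^'n \<Rightarrow> real"
  assumes "f \<in> borel_measurable lebesgue"
  shows "integrable gauss_measure f \<longleftrightarrow> integrable lebesgue (\<lambda>x. f x * exp ((norm x)\<^sup>2 / 2))"
proof -
  have "(\<lambda>x::real^'n. exp ((norm x)\<^sup>2 / 2)) \<in> borel_measurable lebesgue"
    by (rule measurable_completion) simp
  then show ?thesis
    unfolding gauss_measure_def using assms by (subst integrable_density) (simp_all add: mult.commute)
qed

lemma gauss_borel_measurable_iff: "f \<in> borel_measurable gauss_measure \<longleftrightarrow> f \<in> borel_measurable lebesgue"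
  by (simp add: gauss_measure_def cong: measurable_cong_sets)

text \<open>Here g is any weak gradient of u, possibly of infinite energy, in which case the bound
  is trivial. Otherwise u and each component of g are replaced by Borel functions equal almost
  everywhere, since the double integrals above live on products of \<open>lborel\<close>; the weak
  identity survives this change.\<close>

lemma hardy_weak_gradient:
  fixes u :: "real^'n \<Rightarrow> real"
  assumes N: "CARD('n) \<ge> 2" and u: "u \<in> L2 gauss_measure" and g: "has_weak_gradient u g"
  shows "ennreal (1/4) * (\<integral>\<^sup>+x. ennreal ((u x)\<^sup>2 * (rho_trunc CARD('n) (norm x))\<^sup>2) \<partial>gauss_measure)
    \<le> (\<integral>\<^sup>+x. ennreal ((norm (g x))\<^sup>2) \<partial>gauss_measure)"
proof (cases "(\<integral>\<^sup>+x. ennreal ((norm (g x))\<^sup>2) \<partial>gauss_measure) = \<infinity>")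
  case False
  define E where "E x = exp ((norm x)\<^sup>2 / 2)" for x :: "real^'n"
  have E0: "0 < E x" for x by (simp add: E_def)
  have [measurable]: "E \<in> borel_measurable borel" unfolding E_def[abs_def] by measurable
  have u_meas: "u \<in> borel_measurable lebesgue"
    using u by (simp add: L2_def gauss_borel_measurable_iff)
  have g_meas: "g \<in> borel_measurable lebesgue"
    using g unfolding has_weak_gradient_def by (blast intro: locally_integrable_measurable)
  have gi_meas: "(\<lambda>x. g x $ i) \<in> borel_measurable lebesgue" for i
    by (rule measurable_compose[OF g_meas]) (intro borel_measurable_continuous_onI continuous_intros)
  obtain u' where u' [measurable]: "u' \<in> borel_measurable lborel" and uu': "AE x in lborel. u x = u' x"
    using completion_ex_borel_measurable_real[OF u_meas] by blast
  have "\<exists>h. h \<in> borel_measurable lborel \<and> (AE x in lborel. g x $ i = h x)" for i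
    using completion_ex_borel_measurable_real[OF gi_meas] by blast
  then obtain g' where g' [measurable]: "\<And>i. g' i \<in> borel_measurable lborel" and gg': "\<And>i. AE x in lborel. g x $ i = g' i x"
    by metis
  have weak: "(\<integral>x. u' x * partial_deriv i \<phi> x \<partial>lborel) = - (\<integral>x. g' i x * \<phi> x \<partial>lborel)"
    if \<phi>: "test_function \<phi>" for i \<phi>
  proof -
    have s: "smooth \<phi>" using \<phi> by (rule test_functionE)
    have [measurable]: "\<phi> \<in> borel_measurable borel" "partial_deriv i \<phi> \<in> borel_measurable borel"
      by (intro borel_measurable_continuous_onI smooth_continuous_on smooth_partial_deriv s)+
    have l: "\<phi> \<in> borel_measurable lebesgue" "partial_deriv i \<phi> \<in> borel_measurable lebesgue"
      "u' \<in> borel_measurable lebesgue" "g' i \<in> borel_measurable lebesgue"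
      by (rule measurable_completion; simp)+
    have "(\<integral>x. u' x * partial_deriv i \<phi> x \<partial>lborel) = (\<integral>x. u' x * partial_deriv i \<phi> x \<partial>lebesgue)"
      by (rule integral_completion[symmetric]) measurable
    also have "\<dots> = (\<integral>x. u x * partial_deriv i \<phi> x \<partial>lebesgue)"
    proof (rule integral_cong_AE)
      show "AE x in lebesgue. u' x * partial_deriv i \<phi> x = u x * partial_deriv i \<phi> x"
        using AE_completion[OF uu'] by eventually_elim simp
    qed (intro borel_measurable_times l u_meas)+
    also have "\<dots> = - (\<integral>x. g x $ i * \<phi> x \<partial>lebesgue)"
      using g \<phi> by (simp add: has_weak_gradient_def)
    also have "(\<integral>x. g x $ i * \<phi> x \<partial>lebesgue) = (\<integral>x. g' i x * \<phi> x \<partial>lebesgue)"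
    proof (rule integral_cong_AE)
      show "AE x in lebesgue. g x $ i * \<phi> x = g' i x * \<phi> x"
        using AE_completion[OF gg'[of i]] by eventually_elim simp
    qed (intro borel_measurable_times l gi_meas)+
    also have "\<dots> = (\<integral>x. g' i x * \<phi> x \<partial>lborel)"
      by (rule integral_completion) measurable
    finally show ?thesis .
  qed
  have uE: "integrable lborel (\<lambda>x. (u' x)\<^sup>2 * E x)"
  proof -
    have "integrable gauss_measure (\<lambda>x. (u x)\<^sup>2)"
      using u by (simp add: L2_def)
    then have "integrable lebesgue (\<lambda>x. (u x)\<^sup>2 * E x)"
      unfolding E_def using u_meas by (subst (asm) integrable_gauss_measure) auto
    then have "integrable lebesgue (\<lambda>x. (u' x)\<^sup>2 * E x)"
    proof (rule integrable_cong_AE_imp)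
      show "(\<lambda>x. (u' x)\<^sup>2 * E x) \<in> borel_measurable lebesgue"
        by (rule measurable_completion) simp
      show "AE x in lebesgue. (u x)\<^sup>2 * E x = (u' x)\<^sup>2 * E x"
        using AE_completion[OF uu'] by eventually_elim simp
    qed
    then show ?thesis by (subst (asm) integrable_completion) auto
  qed
  have G: "(\<integral>\<^sup>+x. ennreal ((norm (g x))\<^sup>2) \<partial>gauss_measure) = (\<integral>\<^sup>+x. ennreal (\<Sum>i\<in>UNIV. (g' i x)\<^sup>2 * E x) \<partial>lborel)"
  proof -
    have m: "(\<lambda>x. ennreal ((norm (g x))\<^sup>2)) \<in> borel_measurable lebesgue"
      using g_meas by measurable
    have "AE x in lborel. \<forall>i. g x $ i = g' i x"
      using gg' by (simp add: AE_all_countable)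
    then show ?thesis
      unfolding nn_integral_gauss_measure[OF m]
    proof (intro nn_integral_cong_AE, eventually_elim)
      case (elim x)
      have "(norm (g x))\<^sup>2 = (\<Sum>i\<in>UNIV. (g' i x)\<^sup>2)"
        using elim sum_nth_square[of "g x"] by (simp add: power2_eq_square)
      then have "(\<Sum>i\<in>UNIV. (g' i x)\<^sup>2 * E x) = E x * (norm (g x))\<^sup>2"
        by (simp add: sum_distrib_left mult.commute)
      then show ?case
        by (simp add: E_def ennreal_mult)
    qed
  qed
  have gE: "integrable lborel (\<lambda>x. (g' i x)\<^sup>2 * E x)" for i
  proof (rule integrableI_bounded)
    have "(\<integral>\<^sup>+x. ennreal (norm ((g' i x)\<^sup>2 * E x)) \<partial>lborel) \<le> (\<integral>\<^sup>+x. ennreal (\<Sum>i\<in>UNIV. (g' i x)\<^sup>2 * E x) \<partial>lborel)"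
      using E0 by (intro nn_integral_mono ennreal_leI) (auto simp: abs_mult less_imp_le intro: member_le_sum)
    also have "\<dots> < \<infinity>" using False unfolding G by (simp add: less_top)
    finally show "(\<integral>\<^sup>+x. ennreal (norm ((g' i x)\<^sup>2 * E x)) \<partial>lborel) < \<infinity>" .
  qed measurable
  have um: "(\<lambda>x. ennreal ((u x)\<^sup>2 * (rho_trunc CARD('n) (norm x))\<^sup>2)) \<in> borel_measurable lebesgue"
  proof -
    have "(\<lambda>x::real^'n. rho_trunc CARD('n) (norm x)) \<in> borel_measurable lebesgue"
      by (rule measurable_completion) simp
    then show ?thesis using u_meas by measurable
  qed
  have "ennreal (1/4) * (\<integral>\<^sup>+x. ennreal ((u x)\<^sup>2 * (rho_trunc CARD('n) (norm x))\<^sup>2) \<partial>gauss_measure) =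
      (\<integral>\<^sup>+x. ennreal (1/4) * ennreal ((u x)\<^sup>2 * (rho_trunc CARD('n) (norm x))\<^sup>2) \<partial>gauss_measure)"
    by (rule nn_integral_cmult[symmetric]) (simp add: gauss_borel_measurable_iff um)
  also have "\<dots> = (\<integral>\<^sup>+x. ennreal (E x) * (ennreal (1/4) * ennreal ((u x)\<^sup>2 * (rho_trunc CARD('n) (norm x))\<^sup>2)) \<partial>lborel)"
    unfolding E_def using um by (intro nn_integral_gauss_measure borel_measurable_times_ennreal) auto
  also have "\<dots> \<le> (\<integral>\<^sup>+x. ennreal (1/4 * ((u' x)\<^sup>2 * (rho CARD('n) (norm x))\<^sup>2 * E x)) \<partial>lborel)"
  proof (rule nn_integral_mono_AE)
    show "AE x in lborel. ennreal (E x) * (ennreal (1/4) * ennreal ((u x)\<^sup>2 * (rho_trunc CARD('n) (norm x))\<^sup>2))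
        \<le> ennreal (1/4 * ((u' x)\<^sup>2 * (rho CARD('n) (norm x))\<^sup>2 * E x))"
      using uu' AE_lborel_singleton[of 0]
    proof eventually_elim
      case (elim x)
      have "(rho_trunc CARD('n) (norm x))\<^sup>2 \<le> (rho CARD('n) (norm x))\<^sup>2"
        using rho_trunc_bounds[OF N, of "norm x"] elim by (intro power_mono) auto
      then have "E x * (1/4 * ((u x)\<^sup>2 * (rho_trunc CARD('n) (norm x))\<^sup>2)) \<le> E x * (1/4 * ((u x)\<^sup>2 * (rho CARD('n) (norm x))\<^sup>2))"
        using E0[of x] by (intro mult_left_mono) auto
      also have "\<dots> = 1/4 * ((u' x)\<^sup>2 * (rho CARD('n) (norm x))\<^sup>2 * E x)"
        using elim by simp
      finally show ?case
        using E0[of x] by (simp only: ennreal_mult[symmetric] less_imp_le zero_le_power2 mult_nonneg_nonneg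
            ennreal_leI divide_nonneg_nonneg zero_le_one zero_le_numeral)
    qed
  qed
  also have "\<dots> \<le> ennreal (\<Sum>i\<in>UNIV. \<integral>x. (g' i x)\<^sup>2 * E x \<partial>lborel)"
    unfolding E_def by (rule hardy_rho) (use u' g' uE gE weak in \<open>auto simp: E_def[abs_def]\<close>)
  also have "\<dots> = ennreal (\<integral>x. (\<Sum>i\<in>UNIV. (g' i x)\<^sup>2 * E x) \<partial>lborel)"
    using gE by (simp add: Bochner_Integration.integral_sum)
  also have "\<dots> = (\<integral>\<^sup>+x. ennreal (\<Sum>i\<in>UNIV. (g' i x)\<^sup>2 * E x) \<partial>lborel)"
    using gE E0 by (intro nn_integral_eq_integral[symmetric] Bochner_Integration.integrable_sum)
      (auto intro!: sum_nonneg simp: less_imp_le)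
  finally show ?thesis unfolding G .
qed simp

section \<open>Sharpness\<close>

text \<open>From exponent 2 on the corner of the positive part is smoothed: at 0 the difference
  quotient is at most |h|^(n+1). This lets the profile be cut off at its zeros.\<close>

lemma pos_part_power_has_derivative:
  "((\<lambda>y::real. max 0 y ^ (n + 2)) has_real_derivative real (n + 2) * max 0 y ^ (n + 1)) (at y)"
proof -
  consider "0 < y" | "y < 0" | "y = 0" by linarith
  then show ?thesis
  proof cases
    case 1
    have "((\<lambda>y. y ^ (n + 2)) has_real_derivative real (n + 2) * y ^ (n + 1)) (at y)"
      by (rule DERIV_cong[OF DERIV_pow]) simp
    moreover have "\<forall>\<^sub>F z in nhds y. max 0 z ^ (n + 2) = z ^ (n + 2)"
      using eventually_nhds_in_open[of "{0<..}" y] 1 by (auto elim: eventually_mono)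
    ultimately show ?thesis using 1 by (subst DERIV_cong_ev[OF refl _ refl]) auto
  next
    case 2
    have "\<forall>\<^sub>F z in nhds y. max 0 z ^ (n + 2) = 0"
      using eventually_nhds_in_open[of "{..<0}" y] 2 by (auto elim: eventually_mono)
    from DERIV_cong_ev[OF refl this refl, THEN iffD2, OF DERIV_const] show ?thesis
      by (rule DERIV_cong) (use 2 in simp)
  next
    case 3
    have "((\<lambda>h::real. (max 0 (0 + h) ^ (n + 2) - max 0 0 ^ (n + 2)) / h) \<longlongrightarrow> 0) (at 0)"
    proof (rule Lim_null_comparison)
      show "\<forall>\<^sub>F h::real in at 0. norm ((max 0 (0 + h) ^ (n + 2) - max 0 0 ^ (n + 2)) / h) \<le> \<bar>h\<bar> ^ (n + 1)"
        by (intro always_eventually allI) (auto simp: max_def intro: mult_nonpos_nonneg)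
      have "((\<lambda>h::real. \<bar>h\<bar> ^ (n + 1)) \<longlongrightarrow> \<bar>0\<bar> ^ (n + 1)) (at 0)"
        by (intro tendsto_intros)
      then show "((\<lambda>h::real. \<bar>h\<bar> ^ (n + 1)) \<longlongrightarrow> 0) (at 0)" by simp
    qed
    then show ?thesis using 3 by (simp add: DERIV_def)
  qed
qed

text \<open>Put S = p^2 and let primes denote derivatives in \<theta>. Where p is not 0, the right
  side minus the left is \<omega>^2 S (S'' + 16 S), and S'' + 16 S = 2 - 12 p + 16 p^2 = 2 (1 -
  2p)(1 - 4p). This is nonnegative because p <= 1/4, and it is the origin of the constant 16. Where
  p = 0 both sides vanish.\<close>

lemma profile_inequality:
  fixes p \<theta> \<omega> :: real
  assumes "p = 0 \<or> p = \<theta> * (1 - \<theta>)"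
  shows "(1/2 * p\<^sup>2 + 2 * \<omega> * p * (1 - 2 * \<theta>))\<^sup>2 \<le> (1/4 + 16 * \<omega>\<^sup>2) * p ^ 4 +
    (2 * \<omega> * p ^ 3 * (1 - 2 * \<theta>) + 2 * \<omega>\<^sup>2 * (3 * p\<^sup>2 * (1 - 2 * \<theta>)\<^sup>2 - 2 * p ^ 3))"
proof -
  have p4: "p \<le> 1/4"
    using assms zero_le_power2[of "\<theta> - 1/2"] by (auto simp: power2_eq_square algebra_simps)
  have z: "p\<^sup>2 * (1 - 2 * \<theta>)\<^sup>2 = p\<^sup>2 * (1 - 4 * p)"
  proof (cases "p = 0")
    case False
    then have "(1 - 2 * \<theta>)\<^sup>2 = 1 - 4 * p"
      using assms by (simp add: power2_eq_square algebra_simps)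
    then show ?thesis by simp
  qed simp
  have "0 \<le> \<omega>\<^sup>2 * (2 * p\<^sup>2 * ((1 - 2 * p) * (1 - 4 * p)))"
    using p4 by (intro mult_nonneg_nonneg) auto
  also have "\<dots> = \<omega>\<^sup>2 * (2 * (p\<^sup>2 * (1 - 4 * p)) + 16 * p ^ 4 - 4 * p ^ 3)"
    by (simp add: power2_eq_square power3_eq_cube power4_eq_xxxx algebra_simps)
  also have "\<dots> = \<omega>\<^sup>2 * (2 * (p\<^sup>2 * (1 - 2 * \<theta>)\<^sup>2) + 16 * p ^ 4 - 4 * p ^ 3)"
    by (simp only: z)
  also have "\<dots> = (1/4 + 16 * \<omega>\<^sup>2) * p ^ 4 +
    (2 * \<omega> * p ^ 3 * (1 - 2 * \<theta>) + 2 * \<omega>\<^sup>2 * (3 * p\<^sup>2 * (1 - 2 * \<theta>)\<^sup>2 - 2 * p ^ 3)) -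
    (1/2 * p\<^sup>2 + 2 * \<omega> * p * (1 - 2 * \<theta>))\<^sup>2"
    by (simp add: power2_eq_square power3_eq_cube power4_eq_xxxx algebra_simps)
  finally show ?thesis by simp
qed

text \<open>In the variable \<open>ln W\<close> (\<open>W\<close> the tail mass) the quotient of the two sides for \<open>u = sqrt W S\<close> is
  \<open>1/4 + \<integral> S'\<^sup>2 / \<integral> S\<^sup>2\<close>, which a slowly varying \<open>S\<close> brings close to \<open>1/4\<close>. We take
  \<open>S = (\<theta> (1 - \<theta>))\<^sup>2\<close> with \<open>\<theta>\<close> affine in \<open>ln W\<close> of slope \<open>\<omega>\<close>, supported in \<open>r < T\<close>; since \<open>S'' \<ge> - 16 S\<close>,
  the required bound holds pointwise up to the divergence term \<open>Q'\<close>, and no polar coordinates are needed.\<close>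

lemma hardy_profile:
  assumes N: "2 \<le> N" and \<omega>: "0 < \<omega>"
  defines "T \<equiv> rho_argmin N"
  obtains f f' Q Q' :: "real \<Rightarrow> real" and r\<^sub>1 where "0 < r\<^sub>1"
    and "\<And>r. 0 < r \<Longrightarrow> (f has_real_derivative f' r) (at r)" "continuous_on {0<..} f'"
    and "\<And>r. 0 < r \<Longrightarrow> (Q has_real_derivative Q' r) (at r)" "continuous_on {0<..} Q'"
    and "\<And>r. r < r\<^sub>1 \<or> T \<le> r \<Longrightarrow> f r = 0 \<and> f' r = 0 \<and> Q r = 0 \<and> Q' r = 0"
    and "\<And>r. 0 < r \<Longrightarrow> (f' r)\<^sup>2 * exp (r\<^sup>2 / 2) \<le>
      (1/4 + 16 * \<omega>\<^sup>2) * ((f r)\<^sup>2 * (rho N r)\<^sup>2 * exp (r\<^sup>2 / 2)) + Q' r * r powr (1 - real N)"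
    and "\<exists>r>0. f r \<noteq> 0"
proof -
  let ?W = "tail_mass N"
  have T: "0 < T" unfolding T_def by (rule rho_argmin_pos[OF N])
  \<comment> \<open>Normalises \<theta> to vanish at T. Towards the origin \<theta> grows with ln W,
    so the band 0 < \<theta> < 1 lies inside (0, T) and is the longer in ln W the smaller \<omega>
    is.\<close>
  define L where "L = ln (?W T)"
  define \<theta> where "\<theta> r = \<omega> * (ln (?W r) - L)" for r
  define p where "p r = (if 0 < r then max 0 (\<theta> r * (1 - \<theta> r)) else 0)" for r
  define z where "z r = 1 - 2 * \<theta> r" for r
  \<comment> \<open>At W = exp(L + 1/\<omega>) the value of \<theta> is 1; to the left of r1 it
    exceeds 1 and p vanishes.\<close>
  obtain r1 where r1: "0 < r1" "exp (L + 1 / \<omega>) < ?W r1"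
    using tail_mass_unbounded[OF N] by blast
  have "?W T = exp L" using tail_mass_pos[OF T] by (simp add: L_def)
  have W_cont: "continuous_on {0<..} ?W"
    by (rule DERIV_continuous_on[where D="\<lambda>r. - weight N r"])
      (auto intro: tail_mass_has_derivative DERIV_subset)
  have \<theta>_deriv: "(\<theta> has_real_derivative - \<omega> * rho N r) (at r)" if "0 < r" for r
    unfolding \<theta>_def[abs_def]
    using that tail_mass_pos[OF that, of N] tail_mass_has_derivative[OF that, of N]
    by (auto intro!: derivative_eq_intros simp: rho_eq)
  have rho_cont: "continuous_on {0<..} (rho N)"
    by (rule rho_continuous_on)
  have \<theta>_cont: "continuous_on {0<..} \<theta>"
    by (rule DERIV_continuous_on[where D="\<lambda>r. - \<omega> * rho N r"], rule DERIV_subset[OF \<theta>_deriv]) auto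
  have p_cont: "continuous_on {0<..} p"
  proof -
    have "continuous_on {0<..} (\<lambda>r. max 0 (\<theta> r * (1 - \<theta> r)))"
      by (intro continuous_intros \<theta>_cont)
    then show ?thesis by (subst continuous_on_cong[OF refl, of _ _ "\<lambda>r. max 0 (\<theta> r * (1 - \<theta> r))"]) (auto simp: p_def)
  qed
  have p_deriv: "((\<lambda>r. p r ^ (n + 2)) has_real_derivative real (n + 2) * p r ^ (n + 1) * (- \<omega> * rho N r * z r)) (at r)"
    if r: "0 < r" for r n
  proof -
    have "((\<lambda>r. \<theta> r * (1 - \<theta> r)) has_real_derivative - \<omega> * rho N r * z r) (at r)"
      by (rule DERIV_cong[OF DERIV_mult[OF \<theta>_deriv[OF r] DERIV_diff[OF DERIV_const \<theta>_deriv[OF r]]]])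
        (simp add: z_def algebra_simps)
    from DERIV_chain2[OF pos_part_power_has_derivative this, of n]
    have "((\<lambda>r. max 0 (\<theta> r * (1 - \<theta> r)) ^ (n + 2)) has_real_derivative
        real (n + 2) * p r ^ (n + 1) * (- \<omega> * rho N r * z r)) (at r)"
      using r by (simp add: p_def)
    moreover have "\<forall>\<^sub>F y in nhds r. p y ^ (n + 2) = max 0 (\<theta> y * (1 - \<theta> y)) ^ (n + 2)"
      using eventually_nhds_in_open[of "{0<..}" r] r by (auto elim!: eventually_mono simp: p_def)
    ultimately show ?thesis by (subst DERIV_cong_ev[OF refl _ refl]) auto
  qed
  have p_zero: "p r = 0" if "r < r1 \<or> T \<le> r" for r
  proof (cases "0 < r")
    case True
    have "\<theta> r * (1 - \<theta> r) \<le> 0"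
      using that
    proof
      assume "r < r1"
      then have "exp (L + 1 / \<omega>) < ?W r"
        using tail_mass_strict_antimono[OF True, of r1 N] r1(2) by linarith
      then have "L + 1 / \<omega> < ln (?W r)"
        using tail_mass_pos[OF True, of N] by (subst exp_less_cancel_iff[symmetric]) simp
      then have "1 < \<theta> r" using \<omega> by (simp add: \<theta>_def field_simps)
      then show ?thesis by (simp add: mult_le_0_iff)
    next
      assume "T \<le> r"
      then have "?W r \<le> ?W T"
        using tail_mass_strict_antimono[OF T, of r N] by (cases "T = r") auto
      then have "ln (?W r) \<le> L"
        using tail_mass_pos[OF True, of N] unfolding L_def by simp
      then have "\<theta> r \<le> 0" using \<omega> by (simp add: \<theta>_def mult_le_0_iff)
      then show ?thesis by (simp add: mult_le_0_iff)
    qed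
    then show ?thesis by (simp add: p_def)
  qed (simp add: p_def)
  define s where "s r = sqrt (?W r)" for r
  define f where "f r = s r * p r ^ 2" for r
  define f' where "f' r = - rho N r * s r * (1/2 * p r ^ 2 + 2 * \<omega> * p r * z r)" for r
  \<comment> \<open>With S = p^2 and S' = 2 p z taken in \<theta>, this is - S^2/2 - \<omega> S S'.
    Its derivative in r, where \<theta> has slope - \<omega> \<rho>, is \<rho> (\<omega> S S' +
    \<omega>^2 (S'^2 + S S'')): the mixed term of (S/2 + \<omega> S')^2, and S'^2 traded for - S
    S''.\<close>
  define Q where "Q r = - (1/2) * p r ^ 4 + (- 2 * \<omega>) * (p r ^ 3 * z r)" for r
  define Q' where "Q' r = rho N r * (2 * \<omega> * p r ^ 3 * z r + 2 * \<omega>\<^sup>2 * (3 * p r ^ 2 * z r ^ 2 - 2 * p r ^ 3))" for r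
  have s_deriv: "(s has_real_derivative - (1/2) * rho N r * s r) (at r)" if r: "0 < r" for r
  proof -
    have W: "0 < ?W r" by (rule tail_mass_pos[OF r])
    have "(s has_real_derivative inverse (sqrt (?W r)) / 2 * - weight N r) (at r)"
      unfolding s_def[abs_def] by (rule DERIV_chain2[OF DERIV_real_sqrt[OF W] tail_mass_has_derivative[OF r]])
    moreover have "inverse (sqrt (?W r)) / 2 * - weight N r = - (1/2) * rho N r * s r"
    proof -
      have "weight N r = rho N r * ?W r" using W by (simp add: rho_eq)
      moreover have "inverse (sqrt (?W r)) * ?W r = sqrt (?W r)"
        using real_div_sqrt[of "?W r"] W by (simp add: divide_inverse mult.commute)
      ultimately show ?thesis by (simp add: s_def mult.left_commute)
    qed
    ultimately show ?thesis by simp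
  qed
  show thesis
  proof (rule that[of r1 f f' Q Q'])
    show "0 < r1" by (rule r1(1))
    show "(f has_real_derivative f' r) (at r)" if "0 < r" for r
    proof -
      have p2: "((\<lambda>r. p r ^ 2) has_real_derivative 2 * p r * (- \<omega> * rho N r * z r)) (at r)"
        using p_deriv[OF that, of 0] by (simp add: numeral_eq_Suc)
      show ?thesis
        unfolding f_def[abs_def] f'_def
        by (rule DERIV_cong[OF DERIV_mult[OF s_deriv[OF that] p2]]) (simp add: algebra_simps)
    qed
    show "continuous_on {0<..} f'"
      unfolding f'_def[abs_def] s_def z_def by (intro continuous_intros rho_cont W_cont p_cont \<theta>_cont)
    show "(Q has_real_derivative Q' r) (at r)" if "0 < r" for r
    proof -
      have zd: "(z has_real_derivative 2 * \<omega> * rho N r) (at r)"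
        unfolding z_def[abs_def] using that by (auto intro!: derivative_eq_intros \<theta>_deriv)
      have p4: "((\<lambda>r. p r ^ 4) has_real_derivative 4 * p r ^ 3 * (- \<omega> * rho N r * z r)) (at r)"
        using p_deriv[OF that, of 2] by (simp add: numeral_eq_Suc)
      have p3: "((\<lambda>r. p r ^ 3) has_real_derivative 3 * p r ^ 2 * (- \<omega> * rho N r * z r)) (at r)"
        using p_deriv[OF that, of 1] by (simp add: numeral_eq_Suc)
      show ?thesis
        unfolding Q_def[abs_def] Q'_def
        by (rule DERIV_cong[OF DERIV_add[OF DERIV_cmult[OF p4] DERIV_cmult[OF DERIV_mult[OF p3 zd]]]])
          (simp add: power2_eq_square power3_eq_cube algebra_simps)
    qed
    show "continuous_on {0<..} Q'"
      unfolding Q'_def[abs_def] z_def by (intro continuous_intros rho_cont p_cont \<theta>_cont)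
    show "f r = 0 \<and> f' r = 0 \<and> Q r = 0 \<and> Q' r = 0" if "r < r1 \<or> T \<le> r" for r
      using p_zero[OF that] by (simp add: f_def f'_def Q_def Q'_def)
    show "(f' r)\<^sup>2 * exp (r\<^sup>2 / 2) \<le>
      (1/4 + 16 * \<omega>\<^sup>2) * ((f r)\<^sup>2 * (rho N r)\<^sup>2 * exp (r\<^sup>2 / 2)) + Q' r * r powr (1 - real N)" if r: "0 < r" for r
    proof -
      \<comment> \<open>Since \<open>weight\<close> = \<rho> W, this common factor also equals
        \<rho> r^(1-N), which matches the scale of the divergence term.\<close>
      define k where "k = (rho N r)\<^sup>2 * ?W r * exp (r\<^sup>2 / 2)"
      have W: "0 < ?W r" by (rule tail_mass_pos[OF r])
      have k: "0 \<le> k" using W by (simp add: k_def)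
      have "r powr (1 - real N) = weight N r * exp (r\<^sup>2 / 2)"
        by (simp add: weight_def exp_minus)
      also have "weight N r = rho N r * ?W r" using W by (simp add: rho_eq)
      finally have rk: "rho N r * r powr (1 - real N) = k"
        by (simp add: k_def power2_eq_square)
      have s2: "s r * s r = ?W r" using W by (simp add: s_def)
      have "(f' r)\<^sup>2 * exp (r\<^sup>2 / 2) = (rho N r)\<^sup>2 * (s r * s r) * exp (r\<^sup>2 / 2) * (1/2 * p r ^ 2 + 2 * \<omega> * p r * z r)\<^sup>2"
        by (simp add: f'_def power2_eq_square ac_simps)
      also have "\<dots> = k * (1/2 * p r ^ 2 + 2 * \<omega> * p r * z r)\<^sup>2"
        by (simp add: s2 k_def)
      also have "\<dots> \<le> k * ((1/4 + 16 * \<omega>\<^sup>2) * p r ^ 4 +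
          (2 * \<omega> * p r ^ 3 * z r + 2 * \<omega>\<^sup>2 * (3 * p r ^ 2 * z r ^ 2 - 2 * p r ^ 3)))"
        unfolding z_def by (intro mult_left_mono profile_inequality k) (auto simp: p_def max_def)
      also have "\<dots> = (1/4 + 16 * \<omega>\<^sup>2) * (k * p r ^ 4) +
          k * (2 * \<omega> * p r ^ 3 * z r + 2 * \<omega>\<^sup>2 * (3 * p r ^ 2 * z r ^ 2 - 2 * p r ^ 3))"
        by (simp only: distrib_left mult.left_commute)
      also have "k * p r ^ 4 = (f r)\<^sup>2 * (rho N r)\<^sup>2 * exp (r\<^sup>2 / 2)"
        unfolding k_def f_def s2[symmetric] by (simp add: power2_eq_square power4_eq_xxxx ac_simps)
      also have "k * (2 * \<omega> * p r ^ 3 * z r + 2 * \<omega>\<^sup>2 * (3 * p r ^ 2 * z r ^ 2 - 2 * p r ^ 3)) = Q' r * r powr (1 - real N)"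
        unfolding rk[symmetric] Q'_def by (simp only: ac_simps)
      finally show ?thesis .
    qed
    show "\<exists>r>0. f r \<noteq> 0"
    proof -
      have "r1 < T"
      proof (rule ccontr)
        assume "\<not> r1 < T"
        then have "?W r1 \<le> ?W T"
          using tail_mass_strict_antimono[OF T, of r1 N] by (cases "T = r1") auto
        then have "exp (L + 1 / \<omega>) < exp L" using r1(2) \<open>?W T = exp L\<close> by linarith
        then show False using \<omega> by simp
      qed
      \<comment> \<open>The middle of the band, where \<theta> = 1/2 and p takes its maximal value
        1/4.\<close>
      have "\<exists>r\<ge>r1. r \<le> T \<and> ?W r = exp (L + 1 / (2 * \<omega>))"
      proof (rule IVT2')
        show "?W T \<le> exp (L + 1 / (2 * \<omega>))" using \<omega> \<open>?W T = exp L\<close> by simp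
        have "exp (L + 1 / (2 * \<omega>)) \<le> exp (L + 1 / \<omega>)" using \<omega> by (simp add: field_simps)
        then show "exp (L + 1 / (2 * \<omega>)) \<le> ?W r1" using r1(2) by linarith
        show "continuous_on {r1..T} ?W" by (rule continuous_on_subset[OF W_cont]) (use r1 in auto)
      qed (use \<open>r1 < T\<close> in simp)
      then obtain r where r: "r1 \<le> r" "?W r = exp (L + 1 / (2 * \<omega>))" by blast
      have "0 < r" using r r1 by linarith
      have th: "\<theta> r = 1/2" using r(2) \<omega> by (simp add: \<theta>_def)
      have "p r = 1/4" unfolding p_def th using \<open>0 < r\<close> by simp
      moreover have "s r \<noteq> 0" using tail_mass_pos[OF \<open>0 < r\<close>, of N] by (simp add: s_def)
      ultimately show ?thesis using \<open>0 < r\<close> by (auto simp: f_def)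
    qed
  qed
qed

section \<open>Compactly supported C1 functions in the weighted Sobolev space\<close>

lemma locally_integrable_continuous_support:
  fixes f :: "real^'n \<Rightarrow> 'b::euclidean_space"
  assumes "continuous_on UNIV f" "\<And>x. R < norm x \<Longrightarrow> f x = 0"
  shows "locally_integrable f"
  unfolding locally_integrable_def set_integrable_def
proof (intro allI impI)
  fix K :: "(real^'n) set" assume "compact K"
  have "integrable lebesgue f"
    using integrable_continuous_support[OF assms] borel_measurable_continuous_onI[OF assms(1)]
    by (simp add: integrable_completion)
  moreover have "K \<in> sets lebesgue"
    using \<open>compact K\<close> by (simp add: compact_imp_closed borel_closed)
  ultimately show "integrable lebesgue (\<lambda>x. indicator K x *\<^sub>R f x)"
    by (intro integrable_mult_indicator)
qed

text \<open>The directional derivative of u \<phi>, a differentiable function of compact support,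
  integrates to 0; the product rule turns this into the weak identity.\<close>

lemma has_weak_gradient_C1:
  fixes u :: "real^'n \<Rightarrow> real" and G :: "real^'n \<Rightarrow> real^'n"
  assumes D: "\<And>x. (u has_derivative (\<lambda>h. G x \<bullet> h)) (at x)" and G: "continuous_on UNIV G"
    and supp: "\<And>x. R < norm x \<Longrightarrow> u x = 0" "\<And>x. R < norm x \<Longrightarrow> G x = 0"
  shows "has_weak_gradient u G"
  unfolding has_weak_gradient_def
proof (intro conjI allI impI)
  have u: "continuous_on UNIV u"
    using D has_derivative_continuous by (fastforce simp: continuous_on_eq_continuous_at)
  show "locally_integrable u" "locally_integrable G"
    using locally_integrable_continuous_support[OF u supp(1)]
      locally_integrable_continuous_support[OF G supp(2)] by auto
  fix \<phi> :: "real^'n \<Rightarrow> real" and i assume "test_function \<phi>"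
  then have s: "smooth \<phi>" by (rule test_functionE)
  note \<phi> = smooth_continuous_on[OF s, of UNIV] smooth_continuous_on[OF smooth_partial_deriv[OF s, of i], of UNIV]
  have Gi: "continuous_on UNIV (\<lambda>x. G x $ i)" by (intro continuous_intros G)
  have i1: "integrable lborel (\<lambda>x. u x * partial_deriv i \<phi> x)"
    using supp by (intro integrable_continuous_support[of _ R] continuous_intros u \<phi>) auto
  have i2: "integrable lborel (\<lambda>x. G x $ i * \<phi> x)"
    using supp by (intro integrable_continuous_support[of _ R] continuous_on_mult Gi \<phi>) auto
  have "(\<integral>x. u x * frechet_derivative \<phi> (at x) (axis i 1) + (G x \<bullet> axis i 1) * \<phi> x \<partial>lborel) = 0"
  proof (rule integral_directional_derivative_eq_0[where R=R])
    show "((\<lambda>x. u x * \<phi> x) has_derivative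
        (\<lambda>h. u x * frechet_derivative \<phi> (at x) h + (G x \<bullet> h) * \<phi> x)) (at x)" for x
      by (rule has_derivative_mult[OF D smooth_has_derivative[OF s]])
    show "continuous_on UNIV (\<lambda>x. u x * frechet_derivative \<phi> (at x) (axis i 1) + (G x \<bullet> axis i 1) * \<phi> x)"
      using \<phi>(2) by (intro continuous_intros u G \<phi>(1)) (simp add: partial_deriv_def[abs_def])
  qed (simp add: supp)
  then have "(\<integral>x. u x * partial_deriv i \<phi> x + G x $ i * \<phi> x \<partial>lborel) = 0"
    by (simp add: partial_deriv_def inner_axis)
  then have "(\<integral>x. u x * partial_deriv i \<phi> x \<partial>lborel) = - (\<integral>x. G x $ i * \<phi> x \<partial>lborel)"
    using i1 i2 by simp
  then show "(LINT x|lebesgue. u x * partial_deriv i \<phi> x) = - (LINT x|lebesgue. G x $ i * \<phi> x)"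
    using i1 i2 by (subst (1 2) integral_completion) auto
qed

lemma L2_gauss_continuous_support:
  fixes f :: "real^'n \<Rightarrow> 'b::euclidean_space"
  assumes f: "continuous_on UNIV f" and supp: "\<And>x. R < norm x \<Longrightarrow> f x = 0"
  shows "f \<in> L2 gauss_measure"
    and "(\<integral>\<^sup>+x. ennreal ((norm (f x))\<^sup>2) \<partial>gauss_measure) = ennreal (\<integral>x. (norm (f x))\<^sup>2 * exp ((norm x)\<^sup>2 / 2) \<partial>lborel)"
    and "integrable lborel (\<lambda>x. (norm (f x))\<^sup>2 * exp ((norm x)\<^sup>2 / 2))"
proof -
  have [measurable]: "f \<in> borel_measurable borel" using f by (rule borel_measurable_continuous_onI)
  have m: "f \<in> borel_measurable lebesgue" by (rule measurable_completion) simp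
  have m2: "(\<lambda>x. (norm (f x))\<^sup>2) \<in> borel_measurable lebesgue" by (rule measurable_completion) simp
  show i: "integrable lborel (\<lambda>x. (norm (f x))\<^sup>2 * exp ((norm x)\<^sup>2 / 2))"
    using supp by (intro integrable_continuous_support[of _ R] continuous_intros f) auto
  then have "integrable gauss_measure (\<lambda>x. (norm (f x))\<^sup>2)"
    by (subst integrable_gauss_measure[OF m2], subst integrable_completion) auto
  then show "f \<in> L2 gauss_measure"
    using m by (simp add: L2_def gauss_borel_measurable_iff)
  have "(\<integral>\<^sup>+x. ennreal ((norm (f x))\<^sup>2) \<partial>gauss_measure) =
      (\<integral>\<^sup>+x. ennreal (exp ((norm x)\<^sup>2 / 2)) * ennreal ((norm (f x))\<^sup>2) \<partial>lborel)"
    using m2 by (intro nn_integral_gauss_measure) simp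
  also have "\<dots> = (\<integral>\<^sup>+x. ennreal ((norm (f x))\<^sup>2 * exp ((norm x)\<^sup>2 / 2)) \<partial>lborel)"
    by (simp add: ennreal_mult mult.commute)
  also have "\<dots> = ennreal (\<integral>x. (norm (f x))\<^sup>2 * exp ((norm x)\<^sup>2 / 2) \<partial>lborel)"
    using i by (intro nn_integral_eq_integral) auto
  finally show "(\<integral>\<^sup>+x. ennreal ((norm (f x))\<^sup>2) \<partial>gauss_measure) = ennreal (\<integral>x. (norm (f x))\<^sup>2 * exp ((norm x)\<^sup>2 / 2) \<partial>lborel)" .
qed

text \<open>Integrating the pointwise bound of \<open>hardy_profile\<close> over space removes the
  Q' term by the divergence theorem and leaves energy <= (1/4 + 16 \<omega>^2) J. As the profile
  vanishes for r >= T, J is also the integral with the truncated \<rho>.\<close>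

lemma hardy_constant_sharp:
  assumes N: "2 \<le> CARD('n::finite)" and c: "1/4 < c"
  shows "\<exists>u \<in> H1 (gauss_measure :: (real^'n) measure). \<exists>g. has_weak_gradient u g \<and>
            \<not> ((\<integral>\<^sup>+x. ennreal ((norm (g x))\<^sup>2) \<partial>gauss_measure)
              \<ge> ennreal c *
                (\<integral>\<^sup>+x. ennreal ((u x)\<^sup>2 * (rho_trunc CARD('n) (norm x))\<^sup>2) \<partial>gauss_measure))"
proof -
  let ?N = "CARD('n)"
  let ?T = "rho_argmin ?N"
  \<comment> \<open>Makes 16 \<omega>^2 equal to half of c - 1/4.\<close>
  define \<omega> where "\<omega> = sqrt ((c - 1/4) / 32)"
  have \<omega>: "0 < \<omega>" "16 * \<omega>\<^sup>2 < c - 1/4" using c by (auto simp: \<omega>_def)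
  obtain f f' Q Q' :: "real \<Rightarrow> real" and r1 where r1: "0 < r1"
    and f: "\<And>r. 0 < r \<Longrightarrow> (f has_real_derivative f' r) (at r)" "continuous_on {0<..} f'"
    and Q: "\<And>r. 0 < r \<Longrightarrow> (Q has_real_derivative Q' r) (at r)" "continuous_on {0<..} Q'"
    and supp: "\<And>r. r < r1 \<or> ?T \<le> r \<Longrightarrow> f r = 0 \<and> f' r = 0 \<and> Q r = 0 \<and> Q' r = 0"
    and le: "\<And>r. 0 < r \<Longrightarrow> (f' r)\<^sup>2 * exp (r\<^sup>2 / 2) \<le>
      (1/4 + 16 * \<omega>\<^sup>2) * ((f r)\<^sup>2 * (rho ?N r)\<^sup>2 * exp (r\<^sup>2 / 2)) + Q' r * r powr (1 - real ?N)"
    and ex: "\<exists>r>0. f r \<noteq> 0"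
    by (rule hardy_profile[OF N \<omega>(1)], rule that, assumption+)
  have lo: "f r = 0" "f' r = 0" "Q r = 0" "Q' r = 0" if "r < r1" for r
    using supp[of r] that by blast+
  have hi: "f r = 0" "f' r = 0" "Q r = 0" "Q' r = 0" if "?T \<le> r" for r
    using supp[of r] that by blast+
  define u where "u x = f (norm x)" for x :: "real^'n"
  define G where "G x = (f' (norm x) / norm x) *\<^sub>R x" for x :: "real^'n"
  define v where "v x = f (norm x) * rho ?N (norm x)" for x :: "real^'n"
  have f_cont: "continuous_on {0<..} f"
    by (rule DERIV_continuous_on[where D=f']) (auto intro: f DERIV_subset)
  have rho_cont: "continuous_on {0<..} (rho ?N)"
    by (rule rho_continuous_on)
  have u_cont: "continuous_on UNIV u"
    unfolding u_def by (rule continuous_on_radial[OF f_cont r1]) (rule lo(1))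
  have v_cont: "continuous_on UNIV v"
    unfolding v_def
    by (rule continuous_on_radial[of "\<lambda>r. f r * rho ?N r" r1])
      (auto intro!: continuous_intros f_cont rho_cont simp: r1 lo)
  have G_cont: "continuous_on UNIV G"
    unfolding G_def
    by (intro continuous_intros continuous_on_radial[of "\<lambda>r. f' r / r" r1])
      (auto intro!: continuous_intros f(2) simp: r1 lo)
  have D: "(u has_derivative (\<lambda>h. G x \<bullet> h)) (at x)" for x
  proof -
    have "((\<lambda>x. f (norm x)) has_derivative (\<lambda>h. f' (norm x) * (x \<bullet> h) / norm x)) (at x)"
      by (rule has_derivative_radial[OF f(1) r1 lo(1) lo(2)[OF r1]])
    then show ?thesis
      by (simp add: u_def[abs_def] G_def)
  qed
  have supp': "u x = 0" "G x = 0" "v x = 0" if "?T < norm x" for x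
    unfolding u_def G_def v_def using hi[of "norm x"] that by simp_all
  have weak: "has_weak_gradient u G"
    by (rule has_weak_gradient_C1[OF D G_cont supp'(1,2)])
  have u_H1: "u \<in> H1 gauss_measure"
    using L2_gauss_continuous_support(1)[OF u_cont supp'(1)] L2_gauss_continuous_support(1)[OF G_cont supp'(2)] weak
    by (auto simp: H1_def)
  have uv: "(u x)\<^sup>2 * (rho_trunc ?N (norm x))\<^sup>2 = (norm (v x))\<^sup>2" for x
  proof (cases "norm x < ?T")
    case True
    then show ?thesis by (simp add: u_def v_def rho_trunc_def power_mult_distrib)
  next
    case False
    then show ?thesis unfolding u_def v_def using hi(1)[of "norm x"] by simp
  qed
  define J where "J = (\<integral>x. (norm (v x))\<^sup>2 * exp ((norm x)\<^sup>2 / 2) \<partial>lborel)"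
  have vi: "(\<integral>\<^sup>+x. ennreal ((norm (v x))\<^sup>2) \<partial>gauss_measure) = ennreal (\<integral>x. (norm (v x))\<^sup>2 * exp ((norm x)\<^sup>2 / 2) \<partial>lborel)"
    by (rule L2_gauss_continuous_support(2)[OF v_cont supp'(3)])
  have vi': "integrable lborel (\<lambda>x. (norm (v x))\<^sup>2 * exp ((norm x)\<^sup>2 / 2))"
    by (rule L2_gauss_continuous_support(3)[OF v_cont supp'(3)])
  have Gi: "(\<integral>\<^sup>+x. ennreal ((norm (G x))\<^sup>2) \<partial>gauss_measure) = ennreal (\<integral>x. (norm (G x))\<^sup>2 * exp ((norm x)\<^sup>2 / 2) \<partial>lborel)"
    by (rule L2_gauss_continuous_support(2)[OF G_cont supp'(2)])
  have Gi': "integrable lborel (\<lambda>x. (norm (G x))\<^sup>2 * exp ((norm x)\<^sup>2 / 2))"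
    by (rule L2_gauss_continuous_support(3)[OF G_cont supp'(2)])
  obtain r where r: "0 < r" "f r \<noteq> 0" using ex by blast
  \<comment> \<open>Positivity makes the final comparison strict; it comes from a single nonzero
    value of the continuous function v.\<close>
  have J: "0 < J"
    unfolding J_def
  proof (rule integral_pos_continuous[OF vi'])
    show "continuous_on UNIV (\<lambda>x. (norm (v x))\<^sup>2 * exp ((norm x)\<^sup>2 / 2))"
      by (intro continuous_intros v_cont) auto
    have "norm (r *\<^sub>R axis (undefined::'n) (1::real)) = r" using r by simp
    then have "v (r *\<^sub>R axis undefined 1) \<noteq> 0"
      using r rho_pos[OF r(1), of ?N] by (simp add: v_def)
    then show "0 < (norm (v (r *\<^sub>R axis undefined 1)))\<^sup>2 * exp ((norm (r *\<^sub>R axis (undefined::'n) (1::real)))\<^sup>2 / 2)"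
      by simp
    show "0 \<le> (norm (v x))\<^sup>2 * exp ((norm x)\<^sup>2 / 2)" for x
      by (intro mult_nonneg_nonneg) auto
  qed
  have Qi: "integrable lborel (\<lambda>x::real^'n. Q' (norm x) * norm x powr (1 - real ?N))"
  proof (rule integrable_continuous_support[of _ ?T])
    show "continuous_on UNIV (\<lambda>x::real^'n. Q' (norm x) * norm x powr (1 - real ?N))"
      by (rule continuous_on_radial[of "\<lambda>r. Q' r * r powr (1 - real ?N)" r1])
        (auto intro!: continuous_intros Q(2) simp: r1 lo)
  qed (simp add: hi)
  have "(\<integral>x. (norm (G x))\<^sup>2 * exp ((norm x)\<^sup>2 / 2) \<partial>lborel) \<le>
      (\<integral>x. (1/4 + 16 * \<omega>\<^sup>2) * ((norm (v x))\<^sup>2 * exp ((norm x)\<^sup>2 / 2)) + Q' (norm x) * norm x powr (1 - real ?N) \<partial>lborel)"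
  proof (rule integral_mono[OF Gi'])
    show "integrable lborel (\<lambda>x. (1/4 + 16 * \<omega>\<^sup>2) * ((norm (v x))\<^sup>2 * exp ((norm x)\<^sup>2 / 2)) + Q' (norm x) * norm x powr (1 - real ?N))"
      using vi' Qi by (intro Bochner_Integration.integrable_add integrable_mult_right)
    fix x :: "real^'n"
    show "(norm (G x))\<^sup>2 * exp ((norm x)\<^sup>2 / 2) \<le>
        (1/4 + 16 * \<omega>\<^sup>2) * ((norm (v x))\<^sup>2 * exp ((norm x)\<^sup>2 / 2)) + Q' (norm x) * norm x powr (1 - real ?N)"
    proof (cases "x = 0")
      case True
      then show ?thesis using lo[OF r1] by (simp add: G_def v_def)
    next
      case False
      then have "norm (G x) = \<bar>f' (norm x)\<bar>" by (simp add: G_def)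
      then show ?thesis using le[of "norm x"] False by (simp add: v_def power_mult_distrib)
    qed
  qed
  also have "\<dots> = (1/4 + 16 * \<omega>\<^sup>2) * J + (\<integral>x. Q' (norm x) * norm x powr (1 - real ?N) \<partial>(lborel :: (real^'n) measure))"
    using vi' Qi by (simp add: J_def)
  also have "(\<integral>x. Q' (norm x) * norm x powr (1 - real ?N) \<partial>(lborel :: (real^'n) measure)) = 0"
    by (rule integral_radial_divergence[OF Q r1, of ?T]) (simp_all add: lo hi)
  also have "(1/4 + 16 * \<omega>\<^sup>2) * J + 0 < c * J"
    using J \<omega>(2) by simp
  finally have "ennreal (\<integral>x. (norm (G x))\<^sup>2 * exp ((norm x)\<^sup>2 / 2) \<partial>lborel) < ennreal (c * J)"
    using J c by (intro ennreal_lessI) auto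
  then have "\<not> ((\<integral>\<^sup>+x. ennreal ((norm (G x))\<^sup>2) \<partial>gauss_measure)
      \<ge> ennreal c * (\<integral>\<^sup>+x. ennreal ((u x)\<^sup>2 * (rho_trunc ?N (norm x))\<^sup>2) \<partial>gauss_measure))"
    unfolding uv vi Gi J_def[symmetric] using J c by (simp add: ennreal_mult not_le)
  then show ?thesis using u_H1 weak by blast
qed

theorem theorem2p3:
  assumes "CARD('n::finite) \<ge> 2"
  shows "(\<forall>u \<in> H1 (gauss_measure :: (real^'n) measure). \<forall>g. has_weak_gradient u g \<longrightarrow>
            (\<integral>\<^sup>+x. ennreal ((norm (g x))\<^sup>2) \<partial>gauss_measure)
              \<ge> ennreal (1/4) *
                (\<integral>\<^sup>+x. ennreal ((u x)\<^sup>2 * (rho_trunc CARD('n) (norm x))\<^sup>2) \<partial>gauss_measure))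
       \<and> (\<forall>c > 1/4. \<exists>u \<in> H1 (gauss_measure :: (real^'n) measure). \<exists>g. has_weak_gradient u g \<and>
            \<not> ((\<integral>\<^sup>+x. ennreal ((norm (g x))\<^sup>2) \<partial>gauss_measure)
              \<ge> ennreal c *
                (\<integral>\<^sup>+x. ennreal ((u x)\<^sup>2 * (rho_trunc CARD('n) (norm x))\<^sup>2) \<partial>gauss_measure)))"
proof (intro conjI ballI allI impI)
  fix u :: "real^'n \<Rightarrow> real" and g
  assume "u \<in> H1 gauss_measure" "has_weak_gradient u g"
  then show "ennreal (1/4) * (\<integral>\<^sup>+x. ennreal ((u x)\<^sup>2 * (rho_trunc CARD('n) (norm x))\<^sup>2) \<partial>gauss_measure)
      \<le> (\<integral>\<^sup>+x. ennreal ((norm (g x))\<^sup>2) \<partial>gauss_measure)"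
    using assms by (intro hardy_weak_gradient) (auto simp: H1_def)
qed (rule hardy_constant_sharp[OF assms])

end
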